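(* For every fixed $\varepsilon>0$ there exists $p_0=p_0(\varepsilon)$ such that the following holds. Let $p\ge p_0$ be a prime, let $g$ be an integer with $\gcd(g,p)=1$ and let $T$ be the multiplicative order of $g$ modulo $p$. Let $\mathcal{N}=\{u+1,\ldots,u+N\}$ and $\mathcal{M}=\{v+1,\ldots,v+M\}$ be intervals of consecutive integers ($u,v\in\mathbb{Z}$) with $N\le p$, $M\le T$ and $$ N>p^{2/7+\varepsilon},\qquad M>p^{2/7+\varepsilon}. $$ Then for any integer $\lambda$ there exist $x_1,\ldots,x_{16}\in\mathcal{N}$ and $y_1,\ldots,y_{16}\in\mathcal{M}$ such that $$ x_1g^{y_1}+\cdots+x_{16}g^{y_{16}}\equiv\lambda\pmod p. $$
   Context: For a positive integer $k$, $g^{-k}$ denotes an integer with $g^{-k}g^{k}\equiv 1\pmod p$. *)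

theory Defs
  imports Complex_Main "HOL-Number_Theory.Number_Theory"
begin

text \<open>
  \<open>g\<close> to an arbitrary integer exponent modulo \<open>p\<close>. For \<open>k < 0\<close> any integer inverse of
  \<open>g ^ (-k)\<close> modulo \<open>p\<close> would do; the least nonnegative one is chosen. All inverses are
  congruent modulo \<open>p\<close>, so the choice is immaterial in congruences. The value is meaningful only
  if \<open>g\<close> and \<open>p\<close> are coprime.
\<close>
definition powi_mod :: "int \<Rightarrow> int \<Rightarrow> int \<Rightarrow> int" where
  "powi_mod p g k = (if k \<ge> 0 then g ^ nat k else modular_inverse p (g ^ nat (- k)))"

lemma powi_mod_inverse:
  assumes "coprime g p" and "k > 0"
  shows "[powi_mod p g (- k) * g ^ nat k = 1] (mod p)"
  using assms cong_modular_inverse2[of "g ^ nat k" p] by (simp add: powi_mod_def)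

end

theory Submission
  imports Defs "HOL-Analysis.Cartesian_Space" "HOL-Analysis.Convex" "HOL-Library.Function_Algebras"
begin

text \<open>
  Write \<open>G e\<close> for the residue of \<open>g\<close> to the power \<open>e\<close>. By shrinking the intervals, all lengths may be
  taken to be \<open>n\<close>, about \<open>p\<close> to the power \<open>2/7 + \<epsilon>\<close>; let \<open>m = n div 3\<close>.
  If \<open>A\<close>, \<open>B\<close> are sets of residues with \<open>card A * card B \<ge> 2 p\<close> and no two elements of \<open>B\<close> sum to zero,
  then every residue is a sum of eight products \<open>a * b\<close> (Glibichuk). Take \<open>B\<close> to be the \<open>m\<close> residues
  \<open>G y\<close>, and \<open>A\<close> the set of all \<open>G z * (x + x' * G d)\<close> with \<open>0 \<le> z < m\<close> and a suitable fixed
  \<open>d < m\<close>: each product is then a sum of two terms of the required shape. It remains to see that \<open>A\<close>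
  has about \<open>n\<close> to the power \<open>5/2\<close> elements. By Cauchy-Schwarz this follows once the lattices of all
  \<open>a \<in> \<int>\<^sup>4\<close> with \<open>a 1 + a 2 * G d \<equiv> G e * (a 3 + a 4 * G d)\<close> contain, on average over
  \<open>\<bar>e\<bar> \<le> m\<close>, at most about \<open>n\<close> to the power \<open>3/2\<close> points of the box of size \<open>n\<close>.

  The points in the box span a space of dimension at most 2, 3 or 4, and are counted by successive minima.
  In dimension at most 2 the count is \<open>O((n / q)\<^sup>2)\<close> with \<open>q\<close> the length of the shortest vector, and only
  \<open>O(q ^ 4)\<close> exponents \<open>e\<close> admit a vector of length \<open>q\<close>. In dimension 4 the determinant is a nonzero
  multiple of \<open>p\<close>. In dimension 3 the normal vector is congruent to a multiple of
  \<open>(1, G d, - G e, - G e * G d)\<close>; being small it factorises over the integers, so that \<open>G d\<close> and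
  \<open>G e\<close> are fractions with small numerators and denominators. The divisor bound shows that only about
  \<open>sqrt n\<close> exponents give such fractions, which both permits the choice of \<open>d\<close> and bounds this case.
\<close>

section \<open>Counting lemmas and the divisor bound\<close>

lemma card_le_fibres:
  assumes "finite S" "\<And>y. y \<in> f ` S \<Longrightarrow> card {a \<in> S. f a = y} \<le> B"
  shows "card S \<le> card (f ` S) * B"
proof -
  have "S = (\<Union>y\<in>f ` S. {a \<in> S. f a = y})" by auto
  hence "card S \<le> (\<Sum>y\<in>f ` S. card {a \<in> S. f a = y})"
    using card_UN_le[of "f ` S" "\<lambda>y. {a \<in> S. f a = y}"] assms(1) by auto
  also have "\<dots> \<le> card (f ` S) * B"
    using sum_bounded_above[of "f ` S" "\<lambda>y. card {a \<in> S. f a = y}" B] assms(2) by auto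
  finally show ?thesis .
qed

text \<open>Cauchy-Schwarz for the fibre sizes of \<open>f\<close>: they add up to
  \<open>card X\<close>, and their squares add up to the number of colliding pairs.\<close>

lemma card_image_energy:
  assumes "finite X"
  shows "(card X)\<^sup>2 \<le> card (f ` X) * card {(x, y). x \<in> X \<and> y \<in> X \<and> f x = f y}"
proof -
  let ?F = "\<lambda>k. {x \<in> X. f x = k}"
  have 1: "card X = (\<Sum>k\<in>f ` X. card (?F k))"
  proof -
    have "card (\<Union>k\<in>f ` X. ?F k) = (\<Sum>k\<in>f ` X. card (?F k))"
      using assms by (intro card_UN_disjoint) auto
    moreover have "(\<Union>k\<in>f ` X. ?F k) = X" by auto
    ultimately show ?thesis by simp
  qed
  have 2: "card {(x, y). x \<in> X \<and> y \<in> X \<and> f x = f y} = (\<Sum>k\<in>f ` X. card (?F k) ^ 2)"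
  proof -
    have "card (\<Union>k\<in>f ` X. ?F k \<times> ?F k) = (\<Sum>k\<in>f ` X. card (?F k \<times> ?F k))"
      using assms by (intro card_UN_disjoint) auto
    moreover have "(\<Union>k\<in>f ` X. ?F k \<times> ?F k) = {(x, y). x \<in> X \<and> y \<in> X \<and> f x = f y}" by auto
    ultimately show ?thesis by (simp add: card_cartesian_product power2_eq_square)
  qed
  have "(\<Sum>k\<in>f ` X. real (card (?F k)))\<^sup>2 \<le> (\<Sum>k\<in>f ` X. (real (card (?F k)))\<^sup>2) * card (f ` X)"
    by (rule sum_squared_le_sum_of_squares)
  hence "real ((card X)\<^sup>2) \<le> real (card (f ` X) * card {(x, y). x \<in> X \<and> y \<in> X \<and> f x = f y})"
    unfolding 2 by (simp add: 1 mult.commute)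
  thus ?thesis by (simp only: of_nat_le_iff)
qed

text \<open>The growth condition makes the k-th smallest value at least \<open>sqrt (k / C)\<close>,
  and the sum of \<open>1 / sqrt k\<close> up to n is at most \<open>2 * sqrt n\<close>. The
  induction removes an element \<open>z\<close> with the largest value. It is applied to squared
  lengths of shortest vectors and to heights of fractions.\<close>

lemma sum_inverse_le:
  fixes v :: "'a \<Rightarrow> real"
  assumes "finite F" "\<And>y. y \<in> F \<Longrightarrow> v y > 0" "C \<ge> 0"
    "\<And>t. t > 0 \<Longrightarrow> real (card {y \<in> F. v y \<le> t}) \<le> C * t\<^sup>2"
  shows "(\<Sum>y\<in>F. 1 / v y) \<le> 2 * sqrt (C * card F)"
  using assms
proof (induction "card F" arbitrary: F)
  case 0 thus ?case by simp
next
  case (Suc n)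
  have ne: "F \<noteq> {}" using Suc.hyps(2) by auto
  have "Max (v ` F) \<in> v ` F" using ne Suc.prems(1) by (intro Max_in) auto
  then obtain z where z: "z \<in> F" "Max (v ` F) = v z" by auto
  have zmax: "v y \<le> v z" if "y \<in> F" for y unfolding z(2)[symmetric] using that Suc.prems(1) by (intro Max_ge) auto
  have vz: "v z > 0" using z Suc.prems by auto
  have "{y \<in> F. v y \<le> v z} = F" using zmax by auto
  hence "real (Suc n) \<le> C * (v z)\<^sup>2" using Suc.prems(4)[OF vz] Suc.hyps(2) by simp
  hence "sqrt (Suc n) \<le> sqrt C * v z" using vz by (metis real_sqrt_le_iff real_sqrt_mult real_sqrt_abs abs_of_pos)
  hence iz: "1 / v z \<le> sqrt C / sqrt (Suc n)" using vz by (simp add: field_simps)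
  have IH: "(\<Sum>y\<in>F - {z}. 1 / v y) \<le> 2 * sqrt (C * card (F - {z}))"
  proof (rule Suc.hyps(1))
    show "n = card (F - {z})" using Suc.hyps(2) z by simp
    fix t :: real assume t: "t > 0"
    have "card {y \<in> F - {z}. v y \<le> t} \<le> card {y \<in> F. v y \<le> t}" using Suc.prems(1) by (intro card_mono) auto
    thus "real (card {y \<in> F - {z}. v y \<le> t}) \<le> C * t\<^sup>2" using Suc.prems(4)[OF t] by linarith
  qed (use Suc.prems in auto)
  have cd: "card (F - {z}) = n" using Suc.hyps(2) z by simp
  have "(\<Sum>y\<in>F. 1 / v y) = 1 / v z + (\<Sum>y\<in>F - {z}. 1 / v y)" using z Suc.prems(1) by (simp add: sum.remove)
  also have "\<dots> \<le> sqrt C / sqrt (Suc n) + 2 * (sqrt C * sqrt n)"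
    using iz IH by (simp add: cd real_sqrt_mult)
  also have "\<dots> = sqrt C * (1 / sqrt (Suc n) + 2 * sqrt n)" by (simp add: algebra_simps)
  also have "1 / sqrt (Suc n) + 2 * sqrt n \<le> 2 * sqrt (Suc n)"
  proof -
    let ?x = "sqrt (Suc n)" and ?y = "sqrt n"
    have "0 \<le> (?y - ?x)\<^sup>2" by simp
    hence "2 * ?y * ?x \<le> ?x\<^sup>2 + ?y\<^sup>2" by (simp only: power2_diff)
    moreover have "?x\<^sup>2 = real n + 1" "?y\<^sup>2 = real n" by simp_all
    ultimately have "1 + 2 * ?y * ?x \<le> 2 * ?x * ?x" unfolding power2_eq_square by linarith
    moreover have "?x > 0" by simp
    ultimately show ?thesis by (simp add: field_simps del: real_sqrt_gt_0_iff of_nat_Suc)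
  qed
  finally show ?case using Suc.prems(3) Suc.hyps(2)[symmetric] by (simp add: real_sqrt_mult mult_left_mono)
qed

section \<open>The divisor bound\<close>

lemma card_divisors_prime_power_mult:
  fixes q m :: nat
  assumes "prime q" "m > 0"
  shows "card {d. d dvd q ^ a * m} \<le> (a + 1) * card {d. d dvd m}"
proof -
  have "{d. d dvd q ^ a * m} \<subseteq> (\<lambda>(i, d). q ^ i * d) ` ({..a} \<times> {d. d dvd m})"
  proof
    fix d assume "d \<in> {d. d dvd q ^ a * m}"
    then obtain b c where d: "d = b * c" "b dvd q ^ a" "c dvd m"
      using division_decomp[of d "q ^ a" m] by auto
    then obtain i where "i \<le> a" "b = q ^ i" using divides_primepow_nat[OF assms(1)] by auto
    thus "d \<in> (\<lambda>(i, d). q ^ i * d) ` ({..a} \<times> {d. d dvd m})" using d by force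
  qed
  hence "card {d. d dvd q ^ a * m} \<le> card ({..a} \<times> {d. d dvd m})"
    using assms by (intro surj_card_le) auto
  thus ?thesis by (simp add: card_cartesian_product)
qed

text \<open>Prime powers \<open>q ^ a\<close> are split off one by one, each costing a factor
  \<open>a + 1\<close>. If \<open>q powr \<delta> \<ge> 2\<close>, then
  \<open>a + 1 \<le> 2 ^ a\<close> is absorbed by \<open>(q powr \<delta>) ^ a\<close>. Each of the
  finitely many smaller primes, collected in \<open>S\<close>, costs an additional constant factor
  \<open>A\<close> at most once.\<close>

lemma divisor_bound:
  fixes \<delta> :: real
  assumes \<delta>: "\<delta> > 0"
  obtains C where "C > 0" "\<And>n :: nat. n > 0 \<Longrightarrow> real (card {d. d dvd n}) \<le> C * real n powr \<delta>"
proof -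
  \<comment> \<open>Chosen such that \<open>a + 1 \<le> A * (1 + a * \<delta> * ln 2)\<close>, which
    is at most \<open>A * (2 powr \<delta>) ^ a\<close>.\<close>
  define A where "A = 1 + 1 / (\<delta> * ln 2)"
  have A1: "A \<ge> 1" using \<delta> by (simp add: A_def)
  define S where "S = {q :: nat. real q < 2 powr (1 / \<delta>)}"
  have finS: "finite S"
  proof (rule finite_subset)
    show "S \<subseteq> {..nat \<lceil>2 powr (1 / \<delta>)\<rceil>}" by (auto simp: S_def) linarith
  qed auto
  define e where "e n = card {q \<in> S. prime q \<and> q dvd n}" for n :: nat
  have main: "real (card {d. d dvd n}) \<le> A ^ e n * real n powr \<delta>" if "n > 0" for n
    using that
  proof (induction n rule: less_induct)
    case (less n)
    show ?case
    proof (cases "n = 1")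
      case True thus ?thesis using A1 by simp
    next
      case False
      then obtain q where q: "prime q" "q dvd n" using prime_factor_nat by blast
      obtain m where m: "n = q ^ multiplicity q n * m" "\<not> q dvd m"
        using multiplicity_decompose'[of n q] less.prems q by (metis not_prime_unit gr_implies_not_zero)
      define a where "a = multiplicity q n"
      have a: "a > 0" unfolding a_def using q less.prems by (simp add: prime_multiplicity_gt_zero_iff)
      have n: "n = q ^ a * m" using m by (simp add: a_def)
      have m0: "m > 0" using n less.prems by (cases m) auto
      have q2: "q \<ge> 2" using q prime_ge_2_nat by blast
      have "q ^ a > 1" using a q2 by (intro one_less_power) auto
      hence mn: "m < n" using n m0 by simp
      have IH: "real (card {d. d dvd m}) \<le> A ^ e m * real m powr \<delta>" by (rule less.IH[OF mn m0])
      have pw: "real n powr \<delta> = (real q powr \<delta>) ^ a * real m powr \<delta>"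
        using q2 by (simp add: n powr_mult powr_realpow[symmetric] powr_powr mult.commute)
      have sub: "{p \<in> S. prime p \<and> p dvd m} \<subseteq> {p \<in> S. prime p \<and> p dvd n}" by (auto simp: n)
      have "real (card {d. d dvd n}) \<le> real ((a + 1) * card {d. d dvd m})"
        unfolding n using card_divisors_prime_power_mult[OF q(1) m0, of a] by (simp only: of_nat_le_iff)
      also have "\<dots> \<le> real (a + 1) * (A ^ e m * real m powr \<delta>)"
        unfolding of_nat_mult by (rule mult_left_mono[OF IH]) simp
      also have "\<dots> \<le> A ^ e n * real n powr \<delta>"
      proof (cases "q \<in> S")
        case True
        have "{p \<in> S. prime p \<and> p dvd m} \<subset> {p \<in> S. prime p \<and> p dvd n}" using sub True q m by auto
        hence "e m < e n" unfolding e_def using finS by (intro psubset_card_mono) auto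
        hence "A * A ^ e m \<le> A ^ e n" using A1 power_increasing[of "Suc (e m)" "e n" A] by simp
        moreover have "real (a + 1) \<le> A * (real q powr \<delta>) ^ a"
        proof -
          have "real (a + 1) \<le> A * (1 + a * (\<delta> * ln 2))" using \<delta> by (simp add: A_def field_simps)
          also have "1 + a * (\<delta> * ln 2) \<le> exp (a * (\<delta> * ln 2))" by (rule exp_ge_add_one_self)
          also have "\<dots> = (2 powr \<delta>) ^ a" by (simp add: powr_def exp_of_nat_mult[symmetric])
          also have "\<dots> \<le> (real q powr \<delta>) ^ a" using q2 \<delta> by (intro power_mono powr_mono2) auto
          finally show ?thesis using A1 by simp
        qed
        ultimately have "real (a + 1) * A ^ e m \<le> (real q powr \<delta>) ^ a * A ^ e n"
        proof -
          assume 1: "A * A ^ e m \<le> A ^ e n" and 2: "real (a + 1) \<le> A * (real q powr \<delta>) ^ a"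
          have "real (a + 1) * A ^ e m \<le> (A * (real q powr \<delta>) ^ a) * A ^ e m"
            using 2 A1 by (intro mult_right_mono) auto
          also have "\<dots> = (real q powr \<delta>) ^ a * (A * A ^ e m)" by simp
          also have "\<dots> \<le> (real q powr \<delta>) ^ a * A ^ e n" using 1 by (intro mult_left_mono) auto
          finally show ?thesis .
        qed
        hence "real (a + 1) * A ^ e m * real m powr \<delta> \<le> (real q powr \<delta>) ^ a * A ^ e n * real m powr \<delta>"
          by (rule mult_right_mono) auto
        thus ?thesis by (simp add: pw algebra_simps)
      next
        case False
        hence "2 powr (1 / \<delta>) \<le> real q" by (simp add: S_def)
        hence "(2 powr (1 / \<delta>)) powr \<delta> \<le> real q powr \<delta>" using \<delta> by (intro powr_mono2) auto
        hence "2 \<le> real q powr \<delta>" using \<delta> by (simp add: powr_powr)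
        hence "2 ^ a \<le> (real q powr \<delta>) ^ a" by (intro power_mono) auto
        moreover have "a + 1 \<le> 2 ^ a" by (simp add: Suc_leI)
        ultimately have 1: "real (a + 1) \<le> (real q powr \<delta>) ^ a"
          by (metis of_nat_le_iff of_nat_numeral of_nat_power order_trans)
        have "e m \<le> e n" unfolding e_def using finS sub by (intro card_mono) auto
        hence 2: "A ^ e m \<le> A ^ e n" using A1 by (intro power_increasing)
        have "real (a + 1) * (A ^ e m * real m powr \<delta>) \<le> (real q powr \<delta>) ^ a * (A ^ e n * real m powr \<delta>)"
          using 1 2 A1 by (intro mult_mono) auto
        thus ?thesis by (simp add: pw algebra_simps)
      qed
      finally show ?thesis .
    qed
  qed
  show ?thesis
  proof (rule that[of "A ^ card S"])
    show "A ^ card S > 0" using A1 by simp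
    fix n :: nat assume n: "n > 0"
    have "e n \<le> card S" unfolding e_def by (rule card_mono[OF finS]) auto
    hence "A ^ e n * real n powr \<delta> \<le> A ^ card S * real n powr \<delta>"
      using A1 by (intro mult_right_mono power_increasing) auto
    thus "real (card {d. d dvd n}) \<le> A ^ card S * real n powr \<delta>" using main[OF n] by linarith
  qed
qed

section \<open>Sums of eight products\<close>

lemma residue_unique:
  fixes P x y :: int
  assumes "S \<subseteq> {0..<P}" "x \<in> S" "y \<in> S" "x mod P = y mod P"
  shows "x = y"
proof -
  have "x \<in> {0..<P}" "y \<in> {0..<P}" using assms by auto
  thus ?thesis using assms(4) by simp
qed

lemma card_mult_mod:
  fixes P c :: int
  assumes "coprime c P" "S \<subseteq> {0..<P}"
  shows "card ((\<lambda>x. (c * x) mod P) ` S) = card S"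
proof (rule card_image, rule inj_onI)
  fix x y assume xy: "x \<in> S" "y \<in> S" "(c * x) mod P = (c * y) mod P"
  hence "x mod P = y mod P" using assms(1) cong_mult_lcancel[of c P x y] by (simp add: cong_def)
  thus "x = y" using residue_unique[OF assms(2)] xy by blast
qed

text \<open>Pigeonhole: \<open>S\<close> and the reflected set of all \<open>l - x\<close> with
  \<open>x \<in> S'\<close> both contain more than half of the residues, so they meet.\<close>

lemma sumset_covers:
  fixes P l :: int
  assumes "S \<subseteq> {0..<P}" "S' \<subseteq> {0..<P}" "P < 2 * card S" "P < 2 * card S'" "P > 0"
  obtains s s' where "s \<in> S" "s' \<in> S'" "[s + s' = l] (mod P)"
proof -
  let ?R = "(\<lambda>x. (l - x) mod P) ` S'"
  have "inj_on (\<lambda>x. (l - x) mod P) S'"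
  proof (rule inj_onI)
    fix x y assume xy: "x \<in> S'" "y \<in> S'" "(l - x) mod P = (l - y) mod P"
    hence "P dvd y - x" by (simp add: mod_eq_dvd_iff)
    hence "x mod P = y mod P" by (metis mod_eq_dvd_iff)
    thus "x = y" using residue_unique[OF assms(2)] xy by blast
  qed
  hence c: "card ?R = card S'" by (rule card_image)
  have fin: "finite S" "finite ?R" using assms finite_subset[of _ "{0..<P}"] by auto
  have "S \<inter> ?R \<noteq> {}"
  proof
    assume "S \<inter> ?R = {}"
    hence "card (S \<union> ?R) = card S + card S'" using fin c by (simp add: card_Un_disjoint)
    moreover have "card (S \<union> ?R) \<le> card {0..<P}" using assms by (intro card_mono) auto
    ultimately show False using assms by simp
  qed
  then obtain s s' where "s \<in> S" "s' \<in> S'" "s = (l - s') mod P" by auto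
  moreover from this have "[s + s' = l] (mod P)" by (simp add: cong_def mod_simps)
  ultimately show ?thesis using that by blast
qed

text \<open>Averaging over \<xi>: two distinct pairs \<open>(a, b)\<close> and
  \<open>(a', b')\<close> give the same \<open>a + \<xi> * b\<close> for at most one \<xi>, so some
  \<xi> has few collisions \<open>E \<xi>\<close>, and Cauchy-Schwarz makes the image large.
  Exchanging \<open>b\<close> and \<open>b'\<close> turns a collision of
  \<open>a - \<xi> * b\<close> into one of \<open>a + \<xi> * b\<close>, so the same \<xi> serves
  both signs.\<close>

lemma ex_dilate_large:
  fixes P :: int and A B :: "int set"
  assumes P: "prime P" "P > 3" and A: "A \<subseteq> {0..<P}" and B: "B \<subseteq> {0..<P}"
    and AB: "2 * P \<le> card A * card B"
  obtains \<xi> where "\<not> P dvd \<xi>"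
    "P < 2 * card ((\<lambda>(a, b). (a + \<xi> * b) mod P) ` (A \<times> B))"
    "P < 2 * card ((\<lambda>(a, b). (a - \<xi> * b) mod P) ` (A \<times> B))"
proof -
  have fin: "finite A" "finite B" using A B finite_subset[of _ "{0..<P}"] by auto
  define k where "k = card A * card B"
  define X where "X = A \<times> B"
  have finX: "finite X" and cX: "card X = k" using fin by (auto simp: X_def k_def card_cartesian_product)
  define R where "R \<xi> z \<longleftrightarrow> (case z of ((a, b), (a', b')) \<Rightarrow> (a + \<xi> * b) mod P = (a' + \<xi> * b') mod P)"
    for \<xi> :: int and z :: "(int \<times> int) \<times> (int \<times> int)"
  define E where "E \<xi> = card {z \<in> X \<times> X. R \<xi> z}" for \<xi>
  let ?J = "{1..P - 1}"
  have each: "card {\<xi> \<in> ?J. R \<xi> z} \<le> (if fst z = snd z then nat (P - 1) else 0) + 1" if z: "z \<in> X \<times> X" for z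
  proof -
    obtain a b a' b' where zz: "z = ((a, b), (a', b'))" by (metis prod.exhaust)
    show ?thesis
    proof (cases "fst z = snd z")
      case True
      have "card {\<xi> \<in> ?J. R \<xi> z} \<le> card ?J" by (rule card_mono) auto
      thus ?thesis using True by simp
    next
      case False
      have "\<xi> = \<eta>" if xe: "\<xi> \<in> ?J" "R \<xi> z" "\<eta> \<in> ?J" "R \<eta> z" for \<xi> \<eta>
      proof -
        have 1: "P dvd (a + \<xi> * b) - (a' + \<xi> * b')" "P dvd (a + \<eta> * b) - (a' + \<eta> * b')"
          using xe by (auto simp: R_def zz mod_eq_dvd_iff)
        hence "P dvd ((a + \<xi> * b) - (a' + \<xi> * b')) - ((a + \<eta> * b) - (a' + \<eta> * b'))" by (rule dvd_diff)
        also have "((a + \<xi> * b) - (a' + \<xi> * b')) - ((a + \<eta> * b) - (a' + \<eta> * b')) = (\<xi> - \<eta>) * (b - b')"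
          by (simp add: algebra_simps)
        finally have "P dvd \<xi> - \<eta> \<or> P dvd b - b'" using P(1) by (simp add: prime_dvd_mult_iff)
        thus ?thesis
        proof
          assume "P dvd \<xi> - \<eta>"
          hence "\<xi> mod P = \<eta> mod P" by (simp add: mod_eq_dvd_iff)
          thus ?thesis using xe by simp
        next
          assume "P dvd b - b'"
          hence "b mod P = b' mod P" by (simp add: mod_eq_dvd_iff)
          hence bb: "b = b'" using residue_unique[OF B] z by (auto simp: zz X_def)
          hence "P dvd a - a'" using 1 by simp
          hence "a mod P = a' mod P" by (simp add: mod_eq_dvd_iff)
          hence "a = a'" using residue_unique[OF A] z by (auto simp: zz X_def)
          thus ?thesis using False bb zz by simp
        qed
      qed
      moreover have "finite {\<xi> \<in> ?J. R \<xi> z}" by (rule finite_subset[of _ ?J]) auto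
      ultimately have "card {\<xi> \<in> ?J. R \<xi> z} \<le> Suc 0" using card_le_Suc0_iff_eq by blast
      thus ?thesis by simp
    qed
  qed
  have "(\<Sum>\<xi>\<in>?J. E \<xi>) = (\<Sum>\<xi>\<in>?J. \<Sum>z\<in>X \<times> X. if R \<xi> z then 1 else 0)"
    unfolding E_def using finX by (simp add: sum.If_cases Int_def)
  also have "\<dots> = (\<Sum>z\<in>X \<times> X. \<Sum>\<xi>\<in>?J. if R \<xi> z then 1 else 0)" by (rule sum.swap)
  also have "\<dots> = (\<Sum>z\<in>X \<times> X. card {\<xi> \<in> ?J. R \<xi> z})"
    by (simp add: sum.If_cases Int_def)
  also have "\<dots> \<le> (\<Sum>z\<in>X \<times> X. (if fst z = snd z then nat (P - 1) else 0) + 1)"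
    by (rule sum_mono) (rule each)
  also have "\<dots> = (\<Sum>z\<in>X \<times> X. if fst z = snd z then nat (P - 1) else 0) + (\<Sum>z\<in>X \<times> X. 1)"
    by (rule sum.distrib)
  also have "(\<Sum>z\<in>X \<times> X. 1) = k * k" by (simp add: card_cartesian_product cX)
  also have "(\<Sum>z\<in>X \<times> X. if fst z = snd z then nat (P - 1) else 0) = card {z \<in> X \<times> X. fst z = snd z} * nat (P - 1)"
    using finX by (simp add: sum.If_cases Int_def)
  also have "{z \<in> X \<times> X. fst z = snd z} = (\<lambda>x. (x, x)) ` X" by auto
  also have "card \<dots> = k" using cX by (subst card_image) (auto simp: inj_on_def)
  finally have tot: "(\<Sum>\<xi>\<in>?J. E \<xi>) \<le> k * nat (P - 1) + k * k" .
  have "\<exists>\<xi>\<in>?J. nat (P - 1) * E \<xi> \<le> k * nat (P - 1) + k * k"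
  proof (rule ccontr)
    assume "\<not> ?thesis"
    hence "\<And>\<xi>. \<xi> \<in> ?J \<Longrightarrow> k * nat (P - 1) + k * k < nat (P - 1) * E \<xi>" by force
    hence "(\<Sum>\<xi>\<in>?J. k * nat (P - 1) + k * k) < (\<Sum>\<xi>\<in>?J. nat (P - 1) * E \<xi>)"
      using P by (intro sum_strict_mono) auto
    hence "nat (P - 1) * (k * nat (P - 1) + k * k) < nat (P - 1) * (\<Sum>\<xi>\<in>?J. E \<xi>)"
      by (simp add: sum_distrib_left)
    thus False using tot by simp
  qed
  then obtain \<xi> where \<xi>: "\<xi> \<in> ?J" "nat (P - 1) * E \<xi> \<le> k * nat (P - 1) + k * k" by blast
  \<comment> \<open>The choice of \<xi> gives \<open>n \<ge> k * (P - 1) / (P - 1 + k)\<close>. This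
    exceeds \<open>P / 2\<close> because \<open>k \<ge> 2 * P\<close> and
    \<open>P > 3\<close>.\<close>
  have big: "P < 2 * int n" if "k\<^sup>2 \<le> n * E \<xi>" for n
  proof (rule ccontr)
    assume "\<not> ?thesis"
    hence n: "2 * int n \<le> P" by simp
    have "int (nat (P - 1) * k\<^sup>2) \<le> int (nat (P - 1) * (n * E \<xi>))"
      using that by (simp only: of_nat_le_iff mult_le_mono2)
    also have "\<dots> = int n * int (nat (P - 1) * E \<xi>)" by simp
    also have "\<dots> \<le> int n * int (k * nat (P - 1) + k * k)"
      by (rule mult_left_mono, unfold of_nat_le_iff, rule \<xi>(2)) simp
    finally have "int k * ((P - 1) * int k) \<le> int k * (int n * (P - 1 + int k))"
      using P by (simp add: power2_eq_square algebra_simps)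
    moreover have k: "2 * P \<le> int k" using AB by (simp add: k_def)
    moreover from this have "int k > 0" using P by simp
    ultimately have "(P - 1) * int k \<le> int n * (P - 1 + int k)" by simp
    hence "2 * ((P - 1) * int k) \<le> (2 * int n) * (P - 1 + int k)" by simp
    also have "\<dots> \<le> P * (P - 1 + int k)" using n P by (intro mult_right_mono) auto
    finally have "(P - 2) * int k \<le> P * (P - 1)" by (simp add: algebra_simps)
    moreover have "(P - 2) * (2 * P) \<le> (P - 2) * int k" using k P by (intro mult_left_mono) auto
    ultimately have "P * (2 * (P - 2)) \<le> P * (P - 1)" by (simp add: algebra_simps)
    hence "2 * (P - 2) \<le> P - 1" using P by simp
    thus False using P by simp
  qed
  have Eeq: "card {(x, y). x \<in> X \<and> y \<in> X \<and> (\<lambda>(a, b). (a + \<xi> * b) mod P) x = (\<lambda>(a, b). (a + \<xi> * b) mod P) y} = E \<xi>"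
    unfolding E_def R_def by (rule arg_cong[where f=card]) auto
  have "card {(x, y). x \<in> X \<and> y \<in> X \<and> (\<lambda>(a, b). (a - \<xi> * b) mod P) x = (\<lambda>(a, b). (a - \<xi> * b) mod P) y} \<le> E \<xi>"
    unfolding E_def
  proof (rule card_inj_on_le)
    let ?h = "\<lambda>((a, b), (a', b')). ((a, b'), (a', b)) :: (int \<times> int) \<times> (int \<times> int)"
    show "inj_on ?h {(x, y). x \<in> X \<and> y \<in> X \<and> (\<lambda>(a, b). (a - \<xi> * b) mod P) x = (\<lambda>(a, b). (a - \<xi> * b) mod P) y}"
      by (auto simp: inj_on_def)
    show "?h ` {(x, y). x \<in> X \<and> y \<in> X \<and> (\<lambda>(a, b). (a - \<xi> * b) mod P) x = (\<lambda>(a, b). (a - \<xi> * b) mod P) y}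
       \<subseteq> {z \<in> X \<times> X. R \<xi> z}"
    proof
      fix z assume "z \<in> ?h ` {(x, y). x \<in> X \<and> y \<in> X \<and> (\<lambda>(a, b). (a - \<xi> * b) mod P) x = (\<lambda>(a, b). (a - \<xi> * b) mod P) y}"
      then obtain a b a' b' where z: "z = ((a, b'), (a', b))" "(a, b) \<in> X" "(a', b') \<in> X"
        "(a - \<xi> * b) mod P = (a' - \<xi> * b') mod P" by auto
      have "P dvd (a - \<xi> * b) - (a' - \<xi> * b')" using z(4) by (simp add: mod_eq_dvd_iff)
      also have "(a - \<xi> * b) - (a' - \<xi> * b') = (a + \<xi> * b') - (a' + \<xi> * b)" by simp
      finally have "(a + \<xi> * b') mod P = (a' + \<xi> * b) mod P" by (simp add: mod_eq_dvd_iff)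
      thus "z \<in> {z \<in> X \<times> X. R \<xi> z}" using z by (auto simp: R_def X_def)
    qed
    show "finite {z \<in> X \<times> X. R \<xi> z}" using finX by simp
  qed
  hence minus: "k\<^sup>2 \<le> card ((\<lambda>(a, b). (a - \<xi> * b) mod P) ` X) * E \<xi>"
    using card_image_energy[OF finX, of "\<lambda>(a, b). (a - \<xi> * b) mod P"] cX
    by (meson mult_le_mono2 order_trans)
  have plus: "k\<^sup>2 \<le> card ((\<lambda>(a, b). (a + \<xi> * b) mod P) ` X) * E \<xi>"
    using card_image_energy[OF finX, of "\<lambda>(a, b). (a + \<xi> * b) mod P"] unfolding Eeq cX .
  have "\<not> P dvd \<xi>" using \<xi>(1) zdvd_imp_le[of P \<xi>] by auto
  thus ?thesis using that big[OF plus] big[OF minus] by (simp add: X_def)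
qed

text \<open>
  Since \<open>A - \<xi> B\<close> contains more than half of all residues, zero is a sum of two of its elements, that is,
  \<open>\<xi> = (a1 + a2) / (b1 + b2)\<close>. Hence \<open>(b1 + b2) A + (a1 + a2) B\<close> is a dilate of \<open>A + \<xi> B\<close>, again more than
  half of all residues, and all its elements are sums of four products, with positive signs throughout.
\<close>

lemma eight_products_cover:
  fixes P l :: int and A B :: "int set"
  assumes P: "prime P" "P > 3" and A: "A \<subseteq> {0..<P}" and B: "B \<subseteq> {0..<P}"
    and AB: "2 * P \<le> card A * card B" and anti: "\<And>b b'. b \<in> B \<Longrightarrow> b' \<in> B \<Longrightarrow> \<not> P dvd b + b'"
  obtains a b :: "nat \<Rightarrow> int" where "\<And>i. i < 8 \<Longrightarrow> a i \<in> A" "\<And>i. i < 8 \<Longrightarrow> b i \<in> B"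
    "[(\<Sum>i<8. a i * b i) = l] (mod P)"
proof -
  obtain \<xi> where \<xi>: "\<not> P dvd \<xi>"
    "P < 2 * card ((\<lambda>(a, b). (a + \<xi> * b) mod P) ` (A \<times> B))" (is "P < 2 * card ?S")
    "P < 2 * card ((\<lambda>(a, b). (a - \<xi> * b) mod P) ` (A \<times> B))" (is "P < 2 * card ?D")
    using ex_dilate_large[OF P A B AB] by blast
  have P0: "P > 0" using P by simp
  have sub: "?S \<subseteq> {0..<P}" "?D \<subseteq> {0..<P}" using P0 by auto
  obtain s s' where s: "s \<in> ?D" "s' \<in> ?D" "[s + s' = 0] (mod P)"
    using sumset_covers[OF sub(2) sub(2) \<xi>(3) \<xi>(3) P0] by blast
  obtain a1 b1 where 1: "a1 \<in> A" "b1 \<in> B" "s = (a1 - \<xi> * b1) mod P" using s(1) by auto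
  obtain a2 b2 where 2: "a2 \<in> A" "b2 \<in> B" "s' = (a2 - \<xi> * b2) mod P" using s(2) by auto
  define \<alpha> where "\<alpha> = a1 + a2"
  define \<beta> where "\<beta> = b1 + b2"
  have "(a1 - \<xi> * b1 + (a2 - \<xi> * b2)) mod P = 0" using s(3) by (simp add: 1 2 cong_def mod_simps)
  moreover have "a1 - \<xi> * b1 + (a2 - \<xi> * b2) = \<alpha> - \<xi> * \<beta>" by (simp add: \<alpha>_def \<beta>_def algebra_simps)
  ultimately have ab: "P dvd \<alpha> - \<xi> * \<beta>" by auto
  \<comment> \<open>This is where \<open>anti\<close> enters: \<beta> has to be invertible for
    \<open>?U\<close> to contain a dilate of \<open>?S\<close>.\<close>
  have "\<not> P dvd \<beta>" unfolding \<beta>_def using anti 1 2 by blast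
  hence cop: "coprime \<beta> P" using P(1) prime_imp_coprime coprime_commute by blast
  let ?U = "(\<lambda>(a, b). (\<beta> * a + \<alpha> * b) mod P) ` (A \<times> B)"
  have "(\<lambda>x. (\<beta> * x) mod P) ` ?S \<subseteq> ?U"
  proof
    fix y assume "y \<in> (\<lambda>x. (\<beta> * x) mod P) ` ?S"
    then obtain a b where y: "a \<in> A" "b \<in> B" "y = (\<beta> * ((a + \<xi> * b) mod P)) mod P" by auto
    have "P dvd (\<alpha> - \<xi> * \<beta>) * b" using ab by simp
    also have "(\<alpha> - \<xi> * \<beta>) * b = (\<beta> * a + \<alpha> * b) - \<beta> * (a + \<xi> * b)" by (simp add: algebra_simps)
    finally have "(\<beta> * a + \<alpha> * b) mod P = (\<beta> * (a + \<xi> * b)) mod P" by (simp add: mod_eq_dvd_iff)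
    hence "y = (\<beta> * a + \<alpha> * b) mod P" using y by (simp add: mod_simps)
    thus "y \<in> ?U" using y by auto
  qed
  moreover have "finite (A \<times> B)" using A B finite_subset[of _ "{0..<P}"] by auto
  ultimately have "card ((\<lambda>x. (\<beta> * x) mod P) ` ?S) \<le> card ?U" by (intro card_mono) auto
  hence U: "P < 2 * card ?U" using card_mult_mod[OF cop sub(1)] \<xi>(2) by simp
  have "?U \<subseteq> {0..<P}" using P0 by auto
  then obtain u u' where u: "u \<in> ?U" "u' \<in> ?U" "[u + u' = l] (mod P)"
    using sumset_covers[OF _ _ U U P0] by blast
  obtain c d where cd: "c \<in> A" "d \<in> B" "u = (\<beta> * c + \<alpha> * d) mod P" using u(1) by auto
  obtain c' d' where cd': "c' \<in> A" "d' \<in> B" "u' = (\<beta> * c' + \<alpha> * d') mod P" using u(2) by auto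
  \<comment> \<open>The four products of \<open>(b1 + b2) * c + (a1 + a2) * d\<close>, followed by
    those of the same expression in \<open>c'\<close> and \<open>d'\<close>.\<close>
  let ?a = "\<lambda>i. [c, c, a1, a2, c', c', a1, a2] ! i"
  let ?b = "\<lambda>i. [b1, b2, d, d, b1, b2, d', d'] ! i"
  have all8: "(\<forall>i<8. Q i) \<longleftrightarrow> Q 0 \<and> Q 1 \<and> Q 2 \<and> Q 3 \<and> Q 4 \<and> Q 5 \<and> Q 6 \<and> Q (7::nat)" for Q
    by (simp add: numeral_eq_Suc All_less_Suc2)
  have "\<forall>i<8. ?a i \<in> A" "\<forall>i<8. ?b i \<in> B" unfolding all8 using 1 2 cd cd' by simp_all
  moreover have "(\<Sum>i<8. ?a i * ?b i) = (\<beta> * c + \<alpha> * d) + (\<beta> * c' + \<alpha> * d')"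
    by (simp add: numeral_eq_Suc \<alpha>_def \<beta>_def algebra_simps)
  moreover have "[(\<beta> * c + \<alpha> * d) + (\<beta> * c' + \<alpha> * d') = l] (mod P)"
    using u(3) by (simp add: cd cd' cong_def mod_simps)
  ultimately show ?thesis using that[of ?a ?b] by simp
qed

section \<open>Lattice points in a box\<close>

definition small :: "int \<Rightarrow> ('i \<Rightarrow> int) \<Rightarrow> bool" where
  "small q a \<longleftrightarrow> (\<forall>i. \<bar>a i\<bar> \<le> q)"

definition lattice_box :: "('i \<Rightarrow> int) set \<Rightarrow> int \<Rightarrow> ('i \<Rightarrow> int) set" where
  "lattice_box L q = {a \<in> L. small q a}"

text \<open>These are the additive subgroups; closure under differences is the form in which two
  points of one cell are compared.\<close>

definition diff_closed :: "('i \<Rightarrow> int) set \<Rightarrow> bool" where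
  "diff_closed L \<longleftrightarrow> 0 \<in> L \<and> (\<forall>a\<in>L. \<forall>b\<in>L. a - b \<in> L)"

lemma small_eq_PiE: "{a :: 'i::finite \<Rightarrow> int. small q a} = PiE UNIV (\<lambda>_. {-q..q})"
  by (auto simp: small_def PiE_def Pi_def abs_le_iff) (smt (verit))+

lemma finite_small: "finite {a :: 'i::finite \<Rightarrow> int. small q a}"
  unfolding small_eq_PiE by (auto intro: finite_PiE)

lemma card_small: "card {a :: 'i::finite \<Rightarrow> int. small q a} = nat (2 * q + 1) ^ CARD('i)"
  unfolding small_eq_PiE by (simp add: card_PiE)

lemma finite_lattice_box [simp]: "finite (lattice_box L q :: ('i::finite \<Rightarrow> int) set)"
  by (rule finite_subset[OF _ finite_small[of q]]) (auto simp: lattice_box_def)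

text \<open>
  The coordinates in \<open>I\<close> control all others on \<open>V\<close>, so points of \<open>V\<close> can be counted by cutting the
  box into cells in only \<open>k\<close> directions.
\<close>

definition dominated :: "('i \<Rightarrow> int) set \<Rightarrow> nat \<Rightarrow> bool" where
  "dominated V k \<longleftrightarrow> (\<exists>I. card I = k \<and> (\<forall>a\<in>V. \<forall>j. \<exists>i\<in>I. \<bar>a j\<bar> \<le> 3 * \<bar>a i\<bar>))"

text \<open>Two points of one cell differ by a vector \<open>x\<close> of \<open>L\<close> and
  \<open>V\<close> with \<open>3 * \<bar>x i\<bar> < q\<close> for all \<open>i\<close> in
  \<open>I\<close>. Domination then makes every coordinate smaller than \<open>q\<close>; the factor
  3 in \<open>cell\<close> compensates the one in \<open>dominated\<close>. So a cell holds at most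
  \<open>card (lattice_box L (q - 1))\<close> points, and each of the \<open>k\<close> cell
  coordinates takes at most \<open>8 * s / q\<close> values.\<close>

lemma card_lattice_box_le:
  fixes L V :: "('i::finite \<Rightarrow> int) set" and s q :: int
  assumes L: "diff_closed L" and V: "diff_closed V" "dominated V k" and q: "1 \<le> q" "q \<le> s"
  shows "real (card (lattice_box L s \<inter> V)) \<le> (8 * s / q) ^ k * card (lattice_box L (q - 1))"
proof -
  obtain I where I: "card I = k" and dom: "\<And>a j. a \<in> V \<Longrightarrow> \<exists>i\<in>I. \<bar>a j\<bar> \<le> 3 * \<bar>a i\<bar>"
    using V(2) by (auto simp: dominated_def)
  let ?S = "lattice_box L s \<inter> V"
  define cell where "cell a = restrict (\<lambda>i. (3 * a i) div q) I" for a :: "'i \<Rightarrow> int"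
  define R where "R = {(- (3 * s)) div q .. (3 * s) div q}"
  have img: "cell ` ?S \<subseteq> PiE I (\<lambda>_. R)"
  proof (intro subsetI, elim imageE)
    fix y a assume a: "a \<in> ?S" "y = cell a"
    have "- (3 * s) \<le> 3 * a i \<and> 3 * a i \<le> 3 * s" for i
      using a(1) by (auto simp: lattice_box_def small_def abs_le_iff) (smt (verit))+
    hence "(- (3 * s)) div q \<le> (3 * a i) div q \<and> (3 * a i) div q \<le> (3 * s) div q" for i
      using q by (meson less_le_trans zdiv_mono1 zero_less_one)
    thus "y \<in> PiE I (\<lambda>_. R)" using a(2) by (simp add: cell_def R_def)
  qed
  have fib: "card {a \<in> ?S. cell a = y} \<le> card (lattice_box L (q - 1))" if y: "y \<in> cell ` ?S" for y
  proof -
    from y obtain b where b: "b \<in> ?S" "y = cell b" by auto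
    have "(\<lambda>a. a - b) ` {a \<in> ?S. cell a = y} \<subseteq> lattice_box L (q - 1)"
    proof (intro subsetI, elim imageE)
      fix x a assume a: "a \<in> {a \<in> ?S. cell a = y}" and x: "x = a - b"
      have xL: "x \<in> L" using a b x L by (auto simp: diff_closed_def lattice_box_def)
      have xV: "x \<in> V" using a b x V by (auto simp: diff_closed_def)
      have "\<bar>x j\<bar> \<le> q - 1" for j
      proof -
        obtain i where i: "i \<in> I" "\<bar>x j\<bar> \<le> 3 * \<bar>x i\<bar>" using dom[OF xV] by auto
        have "cell a i = cell b i" using a b by auto
        hence e: "(3 * a i) div q = (3 * b i) div q" using i by (simp add: cell_def)
        define ra rb where "ra = (3 * a i) mod q" and "rb = (3 * b i) mod q"
        have r: "0 \<le> ra" "ra < q" "0 \<le> rb" "rb < q" using q by (simp_all add: ra_def rb_def)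
        obtain k where "3 * a i = q * k + ra" "3 * b i = q * k + rb"
          using that[of "(3 * a i) div q"] e unfolding ra_def rb_def by (metis mult_div_mod_eq)
        hence "3 * x i = ra - rb" by (simp add: algebra_simps x)
        hence "\<bar>3 * x i\<bar> < q" using r by (simp add: abs_less_iff)
        hence "3 * \<bar>x i\<bar> < q" by (simp add: abs_mult)
        thus ?thesis using i by simp
      qed
      thus "x \<in> lattice_box L (q - 1)" using xL by (simp add: lattice_box_def small_def)
    qed
    moreover have "inj_on (\<lambda>a. a - b) {a \<in> ?S. cell a = y}"
      by (rule inj_onI) (metis diff_add_cancel)
    ultimately show ?thesis using card_inj_on_le[OF _ _ finite_lattice_box] by blast
  qed
  have "card ?S \<le> card (cell ` ?S) * card (lattice_box L (q - 1))"
    by (rule card_le_fibres) (use fib in auto)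
  also have "card (cell ` ?S) \<le> card (PiE I (\<lambda>_. R))"
    by (rule card_mono[OF _ img]) (auto simp: R_def intro: finite_PiE)
  also have "card (PiE I (\<lambda>_. R)) = card R ^ k" by (simp add: card_PiE I)
  finally have 1: "card ?S \<le> card R ^ k * card (lattice_box L (q - 1))" by simp
  have nat_le: "real (nat (A - B + 1)) \<le> 2 * x + 2"
    if "real_of_int A \<le> x" "real_of_int B \<ge> - x - 1" "0 \<le> x" for A B :: int and x
    using that by linarith
  have up: "real_of_int ((3 * s) div q) \<le> real_of_int (3 * s) / real_of_int q"
    by (rule real_of_int_div4)
  have lo: "real_of_int ((- (3 * s)) div q) \<ge> - (real_of_int (3 * s) / real_of_int q) - 1"
    using real_of_int_div3[of "- (3 * s)" q] by simp
  have "card R = nat ((3 * s) div q - (- (3 * s)) div q + 1)" by (simp add: R_def)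
  moreover have "0 \<le> real_of_int (3 * s) / real_of_int q" using q by simp
  ultimately have "real (card R) \<le> 2 * (real_of_int (3 * s) / real_of_int q) + 2"
    using nat_le[OF up lo] by presburger
  \<comment> \<open>The additive 2 is absorbed because \<open>q \<le> s\<close>.\<close>
  also have "\<dots> \<le> 8 * s / q" using q by (simp add: field_simps)
  finally have "real (card R) ^ k \<le> (8 * s / q) ^ k" by (rule power_mono) simp
  hence "real (card R) ^ k * card (lattice_box L (q - 1)) \<le> (8 * s / q) ^ k * card (lattice_box L (q - 1))"
    by (rule mult_right_mono) simp
  moreover have "real (card ?S) \<le> real (card R) ^ k * card (lattice_box L (q - 1))"
    using 1 by (metis of_nat_le_iff of_nat_mult of_nat_power)
  ultimately show ?thesis by linarith
qed

text \<open>Here \<open>q\<close> is the least box size at which the lattice leaves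
  \<open>V\<close>. When \<open>V\<close> is the span of the vectors found so far, this is the next
  successive minimum. It is at least 1 because the box of size 0 contains only the zero
  vector.\<close>

lemma minimal_escape:
  assumes "\<not> lattice_box L n \<subseteq> V" "0 \<in> V" "0 \<le> (n::int)"
  obtains q v where "1 \<le> q" "q \<le> n" "v \<in> lattice_box L q" "v \<notin> V" "lattice_box L (q - 1) \<subseteq> V"
proof -
  define k where "k = (LEAST k::nat. \<not> lattice_box L (int k) \<subseteq> V)"
  have ex: "\<not> lattice_box L (int (nat n)) \<subseteq> V" using assms by simp
  have k1: "\<not> lattice_box L (int k) \<subseteq> V" unfolding k_def by (rule LeastI[where P="\<lambda>k. \<not> lattice_box L (int k) \<subseteq> V"], rule ex)
  have k2: "k \<le> nat n" unfolding k_def by (rule Least_le, rule ex)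
  have "x = 0" if "x \<in> lattice_box L 0" for x using that by (auto simp: lattice_box_def small_def fun_eq_iff)
  hence "lattice_box L 0 \<subseteq> V" using assms(2) by auto
  hence "k \<noteq> 0" using k1 by (intro notI) simp
  moreover have "lattice_box L (int (k - 1)) \<subseteq> V"
    using not_less_Least[of "k - 1" "\<lambda>k. \<not> lattice_box L (int k) \<subseteq> V"] \<open>k \<noteq> 0\<close> unfolding k_def[symmetric] by auto
  ultimately have "lattice_box L (int k - 1) \<subseteq> V" by (simp add: of_nat_diff)
  moreover obtain v where "v \<in> lattice_box L (int k)" "v \<notin> V" using k1 by auto
  ultimately show ?thesis using that[of "int k" v] k2 \<open>k \<noteq> 0\<close> assms by auto
qed

section \<open>Spans of one, two and three vectors, described by minors\<close>

definition minor2 :: "('i \<Rightarrow> int) \<Rightarrow> ('i \<Rightarrow> int) \<Rightarrow> 'i \<Rightarrow> 'i \<Rightarrow> int" where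
  "minor2 v w i j = v i * w j - v j * w i"

definition minor3 :: "('i \<Rightarrow> int) \<Rightarrow> ('i \<Rightarrow> int) \<Rightarrow> ('i \<Rightarrow> int) \<Rightarrow> 'i \<Rightarrow> 'i \<Rightarrow> 'i \<Rightarrow> int" where
  "minor3 v w x i j k = minor2 v w i j * x k - minor2 v w i k * x j + minor2 v w j k * x i"

text \<open>The generalised cross product in dimension four: the signed maximal minors of the three
  vectors, so that its scalar product with a fourth vector is, up to sign, the determinant of all
  four.\<close>

definition cross :: "(4 \<Rightarrow> int) \<Rightarrow> (4 \<Rightarrow> int) \<Rightarrow> (4 \<Rightarrow> int) \<Rightarrow> 4 \<Rightarrow> int" where
  "cross v w x i = (if i = 1 then minor3 v w x 2 3 4 else if i = 2 then - minor3 v w x 1 3 4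
     else if i = 3 then minor3 v w x 1 2 4 else - minor3 v w x 1 2 3)"

text \<open>For linearly independent arguments, \<open>line\<close> and \<open>plane\<close> consist
  of the integer points of the rational span. Vanishing minors express this without
  division.\<close>

definition line :: "('i \<Rightarrow> int) \<Rightarrow> ('i \<Rightarrow> int) set" where
  "line v = {a. \<forall>i j. minor2 v a i j = 0}"

definition plane :: "('i \<Rightarrow> int) \<Rightarrow> ('i \<Rightarrow> int) \<Rightarrow> ('i \<Rightarrow> int) set" where
  "plane v w = {a. \<forall>i j k. minor3 v w a i j k = 0}"

definition perp :: "('i::finite \<Rightarrow> int) \<Rightarrow> ('i \<Rightarrow> int) set" where
  "perp n = {a. (\<Sum>i\<in>UNIV. n i * a i) = 0}"

lemma diff_closed_line: "diff_closed (line v)"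
  by (auto simp: diff_closed_def line_def minor2_def algebra_simps)

lemma diff_closed_plane: "diff_closed (plane v w)"
proof -
  have "minor3 v w (a - b) i j k = minor3 v w a i j k - minor3 v w b i j k" for a b i j k
    by (simp add: minor3_def algebra_simps)
  thus ?thesis by (auto simp: diff_closed_def plane_def) (simp add: minor3_def)
qed

lemma diff_closed_perp: "diff_closed (perp n)"
  by (auto simp: diff_closed_def perp_def algebra_simps sum_subtractf)

lemma diff_closed_UNIV: "diff_closed UNIV"
  by (simp add: diff_closed_def)

lemma ex_abs_max:
  fixes f :: "'i::finite \<Rightarrow> int"
  obtains i where "\<And>j. \<bar>f j\<bar> \<le> \<bar>f i\<bar>"
proof -
  have "Max (range (\<lambda>i. \<bar>f i\<bar>)) \<in> range (\<lambda>i. \<bar>f i\<bar>)" by (rule Max_in) auto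
  then obtain i where i: "Max (range (\<lambda>i. \<bar>f i\<bar>)) = \<bar>f i\<bar>" by blast
  have "\<bar>f j\<bar> \<le> \<bar>f i\<bar>" for j unfolding i[symmetric] by (rule Max_ge) auto
  thus ?thesis by (rule that)
qed

text \<open>The coordinate at which \<open>v\<close> is largest in absolute value controls all
  others.\<close>

lemma dominated_line:
  fixes v :: "'i::finite \<Rightarrow> int"
  assumes "v \<noteq> 0" shows "dominated (line v) 1"
proof -
  obtain i where i: "\<And>j. \<bar>v j\<bar> \<le> \<bar>v i\<bar>" by (rule ex_abs_max[of v]) blast
  have vi: "\<bar>v i\<bar> > 0"
  proof (rule ccontr)
    assume "\<not> ?thesis"
    hence "v j = 0" for j using i[of j] by simp
    thus False using assms by (auto simp: fun_eq_iff)
  qed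
  have "\<bar>a j\<bar> \<le> 3 * \<bar>a i\<bar>" if "a \<in> line v" for a j
  proof -
    have "v i * a j = v j * a i" using that by (auto simp: line_def minor2_def)
    hence "\<bar>v i\<bar> * \<bar>a j\<bar> = \<bar>v j\<bar> * \<bar>a i\<bar>" by (metis abs_mult)
    also have "\<dots> \<le> \<bar>v i\<bar> * \<bar>a i\<bar>" by (rule mult_right_mono[OF i]) simp
    finally have "\<bar>a j\<bar> \<le> \<bar>a i\<bar>" using vi by simp
    thus ?thesis by simp
  qed
  thus ?thesis unfolding dominated_def by (intro exI[of _ "{i}"]) auto
qed

text \<open>Take \<open>i\<close>, \<open>j\<close> such that \<open>minor2 v w i j\<close> is
  largest in absolute value. By Cramer's rule every coordinate of a point of the plane is a
  combination of its coordinates \<open>i\<close> and \<open>j\<close> with coefficients at most 1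
  in absolute value.\<close>

lemma dominated_plane:
  fixes v w :: "'i::finite \<Rightarrow> int"
  assumes "w \<notin> line v" shows "dominated (plane v w) 2"
proof -
  obtain z where "\<And>j. \<bar>(\<lambda>(i,j). minor2 v w i j) j\<bar> \<le> \<bar>(\<lambda>(i,j). minor2 v w i j) z\<bar>"
    by (rule ex_abs_max[of "\<lambda>(i,j). minor2 v w i j"]) blast
  then obtain i j where m: "\<And>k l. \<bar>minor2 v w k l\<bar> \<le> \<bar>minor2 v w i j\<bar>"
    by (cases z) fastforce
  have pos: "\<bar>minor2 v w i j\<bar> > 0"
  proof (rule ccontr)
    assume "\<not> ?thesis"
    hence "minor2 v w k l = 0" for k l using m[of k l] by simp
    thus False using assms by (auto simp: line_def)
  qed
  hence ij: "i \<noteq> j" by (auto simp: minor2_def)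
  have "\<exists>l\<in>{i,j}. \<bar>a k\<bar> \<le> 3 * \<bar>a l\<bar>" if "a \<in> plane v w" for a k
  proof -
    have "minor3 v w a i j k = 0" using that by (auto simp: plane_def)
    hence "minor2 v w i j * a k = minor2 v w i k * a j - minor2 v w j k * a i" by (simp add: minor3_def)
    hence "\<bar>minor2 v w i j\<bar> * \<bar>a k\<bar> = \<bar>minor2 v w i k * a j - minor2 v w j k * a i\<bar>" by (metis abs_mult)
    also have "\<dots> \<le> \<bar>minor2 v w i k\<bar> * \<bar>a j\<bar> + \<bar>minor2 v w j k\<bar> * \<bar>a i\<bar>"
      by (metis abs_mult abs_triangle_ineq4)
    also have "\<dots> \<le> \<bar>minor2 v w i j\<bar> * \<bar>a j\<bar> + \<bar>minor2 v w i j\<bar> * \<bar>a i\<bar>"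
      by (intro add_mono mult_right_mono m) auto
    finally have "\<bar>minor2 v w i j\<bar> * \<bar>a k\<bar> \<le> \<bar>minor2 v w i j\<bar> * (\<bar>a j\<bar> + \<bar>a i\<bar>)" by (simp add: algebra_simps)
    hence "\<bar>a k\<bar> \<le> \<bar>a j\<bar> + \<bar>a i\<bar>" using pos by simp
    thus ?thesis by auto
  qed
  thus ?thesis unfolding dominated_def by (intro exI[of _ "{i,j}"]) (use ij in auto)
qed

text \<open>At the index \<open>i\<close> where \<open>n\<close> is largest, the equation expresses
  \<open>a i\<close> by the other three coordinates with coefficients at most 1 in absolute value.
  These three summands are the origin of the constant 3 in \<open>dominated\<close>.\<close>

lemma dominated_perp:
  fixes n :: "4 \<Rightarrow> int"
  assumes "n \<noteq> 0" shows "dominated (perp n) 3"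
proof -
  obtain i where i: "\<And>j. \<bar>n j\<bar> \<le> \<bar>n i\<bar>" by (rule ex_abs_max[of n]) blast
  have ni: "\<bar>n i\<bar> > 0"
  proof (rule ccontr)
    assume "\<not> ?thesis"
    hence "n j = 0" for j using i[of j] by simp
    thus False using assms by (auto simp: fun_eq_iff)
  qed
  have crd: "card (UNIV - {i}) = 3" by (simp add: card_Diff_singleton)
  have "\<exists>l\<in>UNIV - {i}. \<bar>a j\<bar> \<le> 3 * \<bar>a l\<bar>" if "a \<in> perp n" for a j
  proof (cases "j = i")
    case False thus ?thesis by (intro bexI[of _ j]) auto
  next
    case True
    define B where "B = Max ((\<lambda>l. \<bar>a l\<bar>) ` (UNIV - {i}))"
    have ne: "UNIV - {i} \<noteq> {}" using crd by force
    have "B \<in> (\<lambda>l. \<bar>a l\<bar>) ` (UNIV - {i})" unfolding B_def using ne by (intro Max_in) auto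
    then obtain l where l: "l \<in> UNIV - {i}" "B = \<bar>a l\<bar>" by auto
    have B: "\<bar>a k\<bar> \<le> B" if "k \<in> UNIV - {i}" for k unfolding B_def using that by (intro Max_ge) auto
    have "(\<Sum>k\<in>UNIV. n k * a k) = n i * a i + (\<Sum>k\<in>UNIV - {i}. n k * a k)"
      by (simp add: sum.remove)
    hence "n i * a i = - (\<Sum>k\<in>UNIV - {i}. n k * a k)" using that by (simp add: perp_def)
    hence "\<bar>n i\<bar> * \<bar>a i\<bar> = \<bar>\<Sum>k\<in>UNIV - {i}. n k * a k\<bar>" by (metis abs_minus_cancel abs_mult)
    also have "\<dots> \<le> (\<Sum>k\<in>UNIV - {i}. \<bar>n k * a k\<bar>)" by (rule sum_abs)
    also have "\<dots> \<le> (\<Sum>k\<in>UNIV - {i}. \<bar>n i\<bar> * B)"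
      unfolding abs_mult by (intro sum_mono mult_mono i B) auto
    also have "\<dots> = \<bar>n i\<bar> * (3 * B)" by (simp add: crd)
    finally have "\<bar>a i\<bar> \<le> 3 * B" using ni by simp
    thus ?thesis using True l by auto
  qed
  thus ?thesis unfolding dominated_def using crd by blast
qed

lemma dominated_UNIV: "dominated (UNIV :: ('i::finite \<Rightarrow> int) set) CARD('i)"
proof -
  have "\<exists>i\<in>UNIV. \<bar>a j\<bar> \<le> 3 * \<bar>a i\<bar>" for a :: "'i \<Rightarrow> int" and j
    by (rule bexI[of _ j]) auto
  thus ?thesis unfolding dominated_def by blast
qed

lemma line_subset_plane: "line v \<subseteq> plane v w"
proof
  fix a assume "a \<in> line v"
  hence m: "minor2 v a i j = 0" for i j by (auto simp: line_def)
  have "minor3 v w a i j k = - (minor2 v a i j * w k) + minor2 v a i k * w j - minor2 v a j k * w i" for i j k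
    by (simp add: minor3_def minor2_def algebra_simps)
  thus "a \<in> plane v w" by (simp add: plane_def m)
qed

text \<open>The scalar product of \<open>cross v w x\<close> with \<open>a\<close> is, up to sign,
  the determinant of \<open>v\<close>, \<open>w\<close>, \<open>x\<close>, \<open>a\<close>.
  Expanded along \<open>x\<close> instead, it has the vanishing minors of \<open>v\<close>,
  \<open>w\<close>, \<open>a\<close> as coefficients.\<close>

lemma plane_subset_perp: "plane v w \<subseteq> perp (cross v w x)"
proof
  fix a assume "a \<in> plane v w"
  hence m: "minor3 v w a i j k = 0" for i j k by (auto simp: plane_def)
  have "(\<Sum>i\<in>UNIV. cross v w x i * a i) =
    - (x 1 * minor3 v w a 2 3 4 - x 2 * minor3 v w a 1 3 4 + x 3 * minor3 v w a 1 2 4 - x 4 * minor3 v w a 1 2 3)"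
    by (simp add: sum_4 cross_def minor3_def minor2_def algebra_simps)
  thus "a \<in> perp (cross v w x)" by (simp add: perp_def m)
qed

text \<open>Minors are alternating in their indices, so all of them vanish as soon as the four with
  increasing indices do.\<close>

lemma cross_nonzero:
  assumes "x \<notin> plane v w" shows "cross v w x \<noteq> 0"
proof
  assume "cross v w x = 0"
  hence c: "cross v w x i = 0" for i by simp
  have z: "minor3 v w x 2 3 4 = 0" "minor3 v w x 1 3 4 = 0" "minor3 v w x 1 2 4 = 0" "minor3 v w x 1 2 3 = 0"
    using c[of 1] c[of 2] c[of 3] c[of 4] by (simp_all add: cross_def)
  have s1: "minor3 v w x i j k = - minor3 v w x j i k" for i j k
    by (simp add: minor3_def minor2_def algebra_simps)
  have s2: "minor3 v w x i j k = - minor3 v w x i k j" for i j k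
    by (simp add: minor3_def minor2_def algebra_simps)
  have "minor3 v w x i j k = 0" for i j k
    using exhaust_4[of i] exhaust_4[of j] exhaust_4[of k] z s1 s2
    by (smt (verit, ccfv_threshold))
  thus False using assms by (simp add: plane_def)
qed

section \<open>Lattices given by one linear congruence\<close>

definition kern :: "int \<Rightarrow> ('i::finite \<Rightarrow> int) \<Rightarrow> ('i \<Rightarrow> int) set" where
  "kern P c = {a. P dvd (\<Sum>i\<in>UNIV. c i * a i)}"

lemma diff_closed_kern: "diff_closed (kern P c)"
  by (auto simp: diff_closed_def kern_def algebra_simps sum_subtractf)

text \<open>Since \<open>c 1 = 1\<close>, each congruence can be solved for the first coordinate,
  with quotients \<open>k\<close>, \<open>l\<close>, \<open>m\<close>. After this substitution the
  difference is, up to sign, \<open>P\<close> times a minor in which the first coordinates are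
  replaced by these quotients.\<close>

lemma cross_proportional:
  fixes c :: "4 \<Rightarrow> int"
  assumes c: "c 1 = 1" and v: "v \<in> kern P c" and w: "w \<in> kern P c" and x: "x \<in> kern P c"
  shows "P dvd cross v w x i - c i * cross v w x 1"
proof -
  obtain k where k: "v 1 = P * k - (c 2 * v 2 + c 3 * v 3 + c 4 * v 4)"
    using v c by (auto simp: kern_def sum_4 elim!: dvdE) (metis (no_types) add.assoc add_diff_cancel_right')
  obtain l where l: "w 1 = P * l - (c 2 * w 2 + c 3 * w 3 + c 4 * w 4)"
    using w c by (auto simp: kern_def sum_4 elim!: dvdE) (metis (no_types) add.assoc add_diff_cancel_right')
  obtain m where m: "x 1 = P * m - (c 2 * x 2 + c 3 * x 3 + c 4 * x 4)"
    using x c by (auto simp: kern_def sum_4 elim!: dvdE) (metis (no_types) add.assoc add_diff_cancel_right')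
  let ?D = "minor3 (v(1 := k)) (w(1 := l)) (x(1 := m)) 1"
  have "cross v w x 2 - c 2 * cross v w x 1 = P * (- ?D 3 4)"
    "cross v w x 3 - c 3 * cross v w x 1 = P * ?D 2 4"
    "cross v w x 4 - c 4 * cross v w x 1 = P * (- ?D 2 3)"
    by (simp_all add: cross_def minor3_def minor2_def k l m) (simp_all add: algebra_simps)
  moreover have "cross v w x 1 - c 1 * cross v w x 1 = P * 0" by (simp add: c)
  ultimately show ?thesis using exhaust_4[of i] by (metis dvd_triv_left)
qed

lemma minor3_le:
  assumes "small p v" "small q w" "small r x" "0 \<le> p" "0 \<le> q" "0 \<le> r"
  shows "\<bar>minor3 v w x i j k\<bar> \<le> 6 * (p * q * r)"
proof -
  have t: "\<bar>v i * w j * x k\<bar> \<le> p * q * r" for i j k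
    using assms unfolding abs_mult small_def by (intro mult_mono) auto
  have "minor3 v w x i j k = v i * w j * x k - v j * w i * x k - v i * w k * x j + v k * w i * x j
     + v j * w k * x i - v k * w j * x i" by (simp add: minor3_def minor2_def algebra_simps)
  thus ?thesis using t[of i j k] t[of j i k] t[of i k j] t[of k i j] t[of j k i] t[of k j i] by linarith
qed

lemma small_cross:
  assumes "small p v" "small q w" "small r x" "0 \<le> p" "0 \<le> q" "0 \<le> r"
  shows "small (6 * (p * q * r)) (cross v w x)"
  using minor3_le[OF assms] by (simp add: small_def cross_def)

lemma lattice_box_eq_Int: "lattice_box L q \<subseteq> V \<Longrightarrow> lattice_box L q \<inter> V = lattice_box L q"
  by auto

lemma small_mono: "small q a \<Longrightarrow> q \<le> r \<Longrightarrow> small r a"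
  unfolding small_def by (meson order_trans)

lemma lattice_box_pred_subset: "lattice_box L (q - 1) \<subseteq> lattice_box L q"
  using small_mono[of "q - 1" _ q] by (auto simp: lattice_box_def)

lemma escape_le:
  assumes "v \<in> lattice_box L q" "v \<notin> V" "lattice_box L (r - 1) \<subseteq> V" shows "r \<le> q"
proof (rule ccontr)
  assume "\<not> r \<le> q"
  hence "v \<in> lattice_box L (r - 1)" using assms(1) small_mono[of q v "r - 1"] by (auto simp: lattice_box_def)
  thus False using assms by auto
qed

text \<open>
  The vectors \<open>v1, \<dots>, v4\<close> realise the successive minima \<open>q1 \<le> \<dots> \<le> q4\<close>. Points shorter than \<open>q(k+1)\<close> lie in
  the span of the first \<open>k\<close> vectors, so the cell counts telescope to \<open>n ^ k / (q1 * \<dots> * qk)\<close>. In the third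
  alternative \<open>N\<close> is the cross product of \<open>v1, v2, v3\<close> and \<open>H = 6 * q1 * q2 * q3\<close>.
\<close>

lemma lattice_count:
  fixes c :: "4 \<Rightarrow> int" and n P :: int
  assumes c: "c 1 = 1" and P: "P > 0" and n: "n \<ge> 1"
  defines "L \<equiv> kern P c"
  obtains "lattice_box L n \<subseteq> {0}"
  | q v where "1 \<le> q" "q \<le> n" "v \<in> lattice_box L q" "v \<noteq> 0" "lattice_box L (q - 1) \<subseteq> {0}"
      "real (card (lattice_box L n)) \<le> 512 * (n / q)\<^sup>2"
  | N H where "N \<noteq> 0" "small H N" "H \<ge> 1" "\<And>i. P dvd N i - c i * N 1"
      "real (card (lattice_box L n)) \<le> 6 * 8 ^ 6 * n ^ 3 / H"
  | "real (card (lattice_box L n)) \<le> 24 * 8 ^ 10 * n ^ 4 / P"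
proof (cases "lattice_box L n \<subseteq> {0}")
  case True thus ?thesis using that(1) by auto
next
  case F0: False
  have n0: "0 \<le> n" using n by simp
  have dc: "diff_closed L" unfolding L_def by (rule diff_closed_kern)
  have card0: "card (lattice_box L (q - 1)) \<le> 1" if "lattice_box L (q - 1) \<subseteq> {0}" for q
    using card_mono[OF _ that] by simp
  obtain q1 v1 where 1: "1 \<le> q1" "q1 \<le> n" "v1 \<in> lattice_box L q1" "v1 \<notin> {0}" "lattice_box L (q1 - 1) \<subseteq> {0}"
    by (rule minimal_escape[OF F0 _ n0]) auto
  have v1: "v1 \<noteq> 0" using 1 by auto
  have z1: "0 \<in> line v1" using diff_closed_line by (auto simp: diff_closed_def)
  have cnt1: "real (card (lattice_box L s \<inter> line v1)) \<le> 8 * s / q1" if "q1 \<le> s" for s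
  proof -
    have "real (card (lattice_box L s \<inter> line v1)) \<le> (8 * s / q1) ^ 1 * card (lattice_box L (q1 - 1))"
      by (rule card_lattice_box_le[OF dc diff_closed_line dominated_line[OF v1]]) (use 1 that in auto)
    also have "\<dots> \<le> (8 * s / q1) ^ 1 * 1"
      using card0[OF 1(5)] 1(1) that by (intro mult_left_mono) auto
    finally show ?thesis by simp
  qed
  have nq1: "1 \<le> n / q1" using 1 by simp
  show ?thesis
  proof (cases "lattice_box L n \<subseteq> line v1")
    case True
    have "real (card (lattice_box L n)) \<le> 8 * (n / q1)"
      using cnt1[of n] 1 by (simp add: lattice_box_eq_Int[OF True])
    \<comment> \<open>As \<open>n / q1 \<ge> 1\<close>, the linear count in dimension one is
      subsumed under the quadratic one of dimension two.\<close>
    also have "\<dots> \<le> 512 * (n / q1)\<^sup>2" using nq1 self_le_power[OF nq1, of 2] by linarith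
    finally show ?thesis using that(2) 1 v1 by blast
  next
    case F1: False
    obtain q2 v2 where 2: "1 \<le> q2" "q2 \<le> n" "v2 \<in> lattice_box L q2" "v2 \<notin> line v1" "lattice_box L (q2 - 1) \<subseteq> line v1"
      by (rule minimal_escape[OF F1 z1 n0]) blast
    have q12: "q1 \<le> q2" using 1(5) 2(3,4) z1 by (intro escape_le[of v2 L q2 "line v1"]) auto
    have cnt2: "real (card (lattice_box L s \<inter> plane v1 v2)) \<le> 512 * s\<^sup>2 / (q1 * q2)" if "q2 \<le> s" for s
    proof -
      have "real (card (lattice_box L s \<inter> plane v1 v2)) \<le> (8 * s / q2) ^ 2 * card (lattice_box L (q2 - 1))"
        by (rule card_lattice_box_le[OF dc diff_closed_plane dominated_plane[OF 2(4)]]) (use 2 that in auto)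
      also have "card (lattice_box L (q2 - 1)) \<le> card (lattice_box L q2 \<inter> line v1)"
        using lattice_box_pred_subset 2(5) by (intro card_mono) auto
      also have "real \<dots> \<le> 8 * real_of_int q2 / q1" using cnt1[OF q12] by simp
      finally have "real (card (lattice_box L s \<inter> plane v1 v2)) \<le> (8 * s / q2) ^ 2 * (8 * real_of_int q2 / q1)"
        by (simp add: mult_left_mono)
      also have "\<dots> = 512 * s\<^sup>2 / (q1 * q2)" using 1(1) 2(1) by (simp add: field_simps power2_eq_square)
      finally show ?thesis by simp
    qed
    show ?thesis
    proof (cases "lattice_box L n \<subseteq> plane v1 v2")
      case True
      have "real (card (lattice_box L n)) \<le> 512 * n\<^sup>2 / (q1 * q2)"
        using cnt2[of n] 2 by (simp add: lattice_box_eq_Int[OF True])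
      also have "\<dots> \<le> 512 * n\<^sup>2 / (q1 * q1)"
        using 1 q12 by (intro divide_left_mono) auto
      also have "\<dots> = 512 * (n / q1)\<^sup>2" by (simp add: power2_eq_square)
      finally show ?thesis using that(2) 1 v1 by blast
    next
      case F2: False
      obtain q3 v3 where 3: "1 \<le> q3" "q3 \<le> n" "v3 \<in> lattice_box L q3" "v3 \<notin> plane v1 v2" "lattice_box L (q3 - 1) \<subseteq> plane v1 v2"
          by (rule minimal_escape[OF F2 _ n0]) (use diff_closed_plane in \<open>auto simp: diff_closed_def\<close>)
      have q23: "q2 \<le> q3" using escape_le[OF 3(3) _ 2(5)] line_subset_plane 3(4) by blast
      define N where "N = cross v1 v2 v3"
      define H where "H = 6 * (q1 * q2 * q3)"
      have N0: "N \<noteq> 0" unfolding N_def by (rule cross_nonzero[OF 3(4)])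
      have NH: "small H N" unfolding N_def H_def
        using 1 2 3 by (intro small_cross) (auto simp: lattice_box_def)
      have Nc: "P dvd N i - c i * N 1" for i unfolding N_def
        using 1 2 3 by (intro cross_proportional c) (auto simp: lattice_box_def L_def)
      have "q1 * q2 * q3 > 0" using 1 2 3 by simp
      hence H1: "H \<ge> 1" unfolding H_def by linarith
      have cnt3: "real (card (lattice_box L s \<inter> perp N)) \<le> 8 ^ 6 * s ^ 3 / (q1 * q2 * q3)" if "q3 \<le> s" for s
      proof -
        have "real (card (lattice_box L s \<inter> perp N)) \<le> (8 * s / q3) ^ 3 * card (lattice_box L (q3 - 1))"
          by (rule card_lattice_box_le[OF dc diff_closed_perp dominated_perp[OF N0]]) (use 3 that in auto)
        also have "card (lattice_box L (q3 - 1)) \<le> card (lattice_box L q3 \<inter> plane v1 v2)"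
          using lattice_box_pred_subset 3(5) by (intro card_mono) auto
        also have "real \<dots> \<le> 512 * (real_of_int q3)\<^sup>2 / (q1 * q2)" using cnt2[OF q23] by simp
        finally have "real (card (lattice_box L s \<inter> perp N)) \<le> (8 * s / q3) ^ 3 * (512 * (real_of_int q3)\<^sup>2 / (q1 * q2))"
          using that 3 by (simp add: mult_left_mono)
        also have "\<dots> = 8 ^ 6 * s ^ 3 / (q1 * q2 * q3)" using 1(1) 2(1) 3(1)
          by (simp add: field_simps power2_eq_square power3_eq_cube)
        finally show ?thesis by simp
      qed
      show ?thesis
      proof (cases "lattice_box L n \<subseteq> perp N")
        case True
        have "real (card (lattice_box L n)) \<le> 8 ^ 6 * n ^ 3 / (q1 * q2 * q3)"
          using cnt3[of n] 3 by (simp add: lattice_box_eq_Int[OF True])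
        also have "\<dots> = 6 * 8 ^ 6 * n ^ 3 / H" by (simp add: H_def)
        finally show ?thesis using that(3) N0 NH H1 Nc by blast
      next
        case F3: False
        obtain q4 v4 where 4: "1 \<le> q4" "q4 \<le> n" "v4 \<in> lattice_box L q4" "v4 \<notin> perp N" "lattice_box L (q4 - 1) \<subseteq> perp N"
          by (rule minimal_escape[OF F3 _ n0]) (use diff_closed_perp in \<open>auto simp: diff_closed_def\<close>)
        have q34: "q3 \<le> q4" using escape_le[OF 4(3) _ 3(5)] plane_subset_perp 4(4) unfolding N_def by blast
        have "real (card (lattice_box L n \<inter> UNIV)) \<le> (8 * n / q4) ^ CARD(4) * card (lattice_box L (q4 - 1))"
          by (rule card_lattice_box_le[OF dc diff_closed_UNIV dominated_UNIV]) (use 4 in auto)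
        also have "card (lattice_box L (q4 - 1)) \<le> card (lattice_box L q4 \<inter> perp N)"
          using lattice_box_pred_subset 4(5) by (intro card_mono) auto
        also have "real \<dots> \<le> 8 ^ 6 * real_of_int q4 ^ 3 / (q1 * q2 * q3)" using cnt3[OF q34] by simp
        finally have "real (card (lattice_box L n)) \<le> (8 * n / q4) ^ 4 * (8 ^ 6 * real_of_int q4 ^ 3 / (q1 * q2 * q3))"
          using 4 n by (simp add: mult_left_mono)
        also have "\<dots> = 8 ^ 10 * n ^ 4 / (q1 * q2 * q3 * q4)" using 1(1) 2(1) 3(1) 4(1)
          by (simp add: field_simps power2_eq_square power3_eq_cube power4_eq_xxxx)
        also have "\<dots> \<le> 24 * 8 ^ 10 * n ^ 4 / P"
        proof -
          \<comment> \<open>Up to sign this is the determinant of \<open>v1\<close>,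
            \<open>v2\<close>, \<open>v3\<close>, \<open>v4\<close>. It is divisible by
            \<open>P\<close> because \<open>N\<close> is congruent to \<open>N 1\<close> times
            \<open>c\<close>, nonzero because \<open>v4\<close> lies outside \<open>perp N\<close>,
            and at most \<open>4 * H * q4\<close> in absolute value.\<close>
          let ?S = "\<Sum>i\<in>UNIV. N i * v4 i"
          have "?S = (\<Sum>i\<in>UNIV. (N i - c i * N 1) * v4 i) + N 1 * (\<Sum>i\<in>UNIV. c i * v4 i)"
            by (simp add: algebra_simps sum.distrib sum_subtractf sum_distrib_left)
          moreover have "P dvd (\<Sum>i\<in>UNIV. (N i - c i * N 1) * v4 i)"
            by (intro dvd_sum dvd_mult2 Nc)
          moreover have "P dvd (\<Sum>i\<in>UNIV. c i * v4 i)" using 4(3) by (auto simp: lattice_box_def L_def kern_def)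
          ultimately have "P dvd ?S" by simp
          moreover have "?S \<noteq> 0" using 4(4) by (simp add: perp_def)
          ultimately have "P \<le> \<bar>?S\<bar>" using zdvd_imp_le[of P "\<bar>?S\<bar>"] by simp
          also have "\<dots> \<le> (\<Sum>i\<in>UNIV. \<bar>N i\<bar> * \<bar>v4 i\<bar>)"
            using sum_abs[of "\<lambda>i. N i * v4 i" UNIV] by (simp add: abs_mult)
          also have "\<dots> \<le> (\<Sum>i\<in>(UNIV::4 set). H * q4)"
            using NH 4(3) H1 by (intro sum_mono mult_mono) (auto simp: small_def lattice_box_def)
          also have "\<dots> = 24 * (q1 * q2 * q3 * q4)" by (simp add: H_def)
          finally have le: "P \<le> 24 * (q1 * q2 * q3 * q4)" .
          have pos: "q1 * q2 * q3 * q4 > 0" using 1 2 3 4 by simp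
          have "real_of_int P \<le> 24 * (q1 * q2 * q3 * q4)" using le by linarith
          have "8 ^ 10 * real_of_int n ^ 4 / (q1 * q2 * q3 * q4) = 24 * 8 ^ 10 * n ^ 4 / (24 * (q1 * q2 * q3 * q4))" by simp
          also have "\<dots> \<le> 24 * 8 ^ 10 * n ^ 4 / P"
            using le pos P n by (intro divide_left_mono mult_pos_pos) (auto simp del: of_int_mult)
          finally show ?thesis by simp
        qed
        finally show ?thesis using that(4) by blast
      qed
    qed
  qed
qed

section \<open>Powers that are small fractions\<close>

text \<open>An abstraction of the powers of \<open>g\<close> modulo \<open>P\<close>, with arbitrary
  integer exponents so that differences of exponents are available. The last assumption replaces the
  order of \<open>g\<close>: exponents at distance less than \<open>3 * m\<close>, in particular any
  two distinct ones from \<open>{-m..m}\<close>, give distinct residues.\<close>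

locale geometric_residues =
  fixes P :: int and G :: "int \<Rightarrow> int" and m :: int
  assumes prime_P: "prime P" and P_gt: "P > 3" and m_pos: "m \<ge> 1"
    and G_add: "[G (a + b) = G a * G b] (mod P)"
    and G_unit: "\<not> P dvd G a"
    and G_inj: "\<bar>a - b\<bar> < 3 * m \<Longrightarrow> P dvd G a - G b \<Longrightarrow> a = b"
begin

text \<open>
  Modulo \<open>P\<close>, the power \<open>G e\<close> is a fraction \<open>r / s\<close> of height at most \<open>h\<close>.
\<close>

definition height_le :: "int \<Rightarrow> int \<Rightarrow> bool" where
  "height_le e h \<longleftrightarrow> (\<exists>r s. r \<noteq> 0 \<and> s \<noteq> 0 \<and> \<bar>r\<bar> \<le> h \<and> \<bar>s\<bar> \<le> h \<and> P dvd s * G e - r)"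

lemma P_dvd_mult_iff: "P dvd x * y \<longleftrightarrow> P dvd x \<or> P dvd y"
  using prime_P by (simp add: prime_dvd_mult_iff)

lemma not_P_dvd: "x \<noteq> 0 \<Longrightarrow> \<bar>x\<bar> < P \<Longrightarrow> \<not> P dvd x"
  using zdvd_not_zless[of "\<bar>x\<bar>" P] by auto

lemma zero_if_P_dvd: "P dvd x \<Longrightarrow> \<bar>x\<bar> < P \<Longrightarrow> x = 0"
  using not_P_dvd by blast

text \<open>The common factor can be cancelled modulo \<open>P\<close> because \<open>h < P\<close>
  keeps it prime to \<open>P\<close>. Giving it the sign of \<open>s\<close> makes the new
  denominator positive.\<close>

lemma height_le_reduced:
  assumes "height_le e h" "h < P"
  obtains r s where "coprime r s" "0 < s" "r \<noteq> 0" "\<bar>r\<bar> \<le> h" "s \<le> h" "P dvd s * G e - r"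
proof -
  obtain r s where rs: "r \<noteq> 0" "s \<noteq> 0" "\<bar>r\<bar> \<le> h" "\<bar>s\<bar> \<le> h" "P dvd s * G e - r"
    using assms by (auto simp: height_le_def)
  define g where "g = gcd r s * sgn s"
  have g: "g \<noteq> 0" "g dvd r" "g dvd s" using rs by (auto simp: g_def sgn_if)
  have ag: "\<bar>g\<bar> = gcd r s" using rs by (auto simp: g_def abs_mult sgn_if)
  obtain r' where r': "r = g * r'" using g by (auto elim: dvdE)
  obtain s' where s': "s = g * s'" using g by (auto elim: dvdE)
  have "gcd r s = \<bar>g\<bar> * gcd r' s'" by (simp add: r' s' gcd_mult_left abs_mult)
  hence cop: "coprime r' s'" using ag g rs by (simp add: coprime_iff_gcd_eq_1)
  have g1: "\<bar>g\<bar> \<ge> 1" using g by simp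
  have le: "\<bar>r'\<bar> \<le> \<bar>r\<bar>" "\<bar>s'\<bar> \<le> \<bar>s\<bar>"
    using g1 by (simp_all add: r' s' abs_mult mult_le_cancel_right1)
  have "s * sgn s > 0" using rs by (auto simp: sgn_if)
  moreover have "s * sgn s = g * s' * sgn s" by (rule arg_cong[where f = "\<lambda>x. x * sgn s"], rule s')
  moreover have "g * s' * sgn s = gcd r s * s' * (sgn s * sgn s)" unfolding g_def by (simp only: mult_ac)
  moreover have "sgn s * sgn s = 1" using rs(2) by (simp add: sgn_if)
  ultimately have "gcd r s * s' > 0" by simp
  moreover have "gcd r s > 0" using rs by simp
  ultimately have s0: "s' > 0" by (simp add: zero_less_mult_iff)
  have "\<bar>g\<bar> \<le> \<bar>s\<bar>" using ag rs by (metis dvd_imp_le_int gcd_dvd2 abs_gcd_int)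
  hence "\<not> P dvd g" using g rs assms by (intro not_P_dvd) auto
  moreover have "P dvd g * (s' * G e - r')" using rs(5) by (simp add: r' s' algebra_simps)
  ultimately have "P dvd s' * G e - r'" using P_dvd_mult_iff by blast
  moreover have "r' \<noteq> 0" using rs r' by auto
  ultimately show ?thesis using that[of r' s'] cop s0 le rs by simp
qed

lemma ratio_inj:
  assumes "P dvd s * G e - r" "P dvd s * G e' - r" "\<not> P dvd s" "\<bar>e - e'\<bar> < 3 * m"
  shows "e = e'"
proof -
  have "P dvd (s * G e - r) - (s * G e' - r)" by (rule dvd_diff) (fact assms)+
  also have "(s * G e - r) - (s * G e' - r) = s * (G e - G e')" by (simp add: algebra_simps)
  finally show ?thesis using assms G_inj P_dvd_mult_iff by blast
qed

lemma ratio_mult: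
  assumes "P dvd s * G e - r" "P dvd s' * G e' - r'"
  shows "P dvd s * s' * G (e + e') - r * r'"
proof -
  have "[s * G e = r] (mod P)" "[s' * G e' = r'] (mod P)" using assms by (simp_all add: cong_iff_dvd_diff)
  hence "[(s * G e) * (s' * G e') = r * r'] (mod P)" by (rule cong_mult)
  moreover have "[s * s' * G (e + e') = s * s' * (G e * G e')] (mod P)" by (intro cong_mult cong_refl G_add)
  ultimately have "[s * s' * G (e + e') = r * r'] (mod P)"
    by (metis (no_types, opaque_lifting) cong_trans mult.assoc mult.left_commute)
  thus ?thesis by (simp add: cong_iff_dvd_diff)
qed

text \<open>Both fractions represent \<open>x\<close>, so \<open>P\<close> divides
  \<open>s * r' - s' * r\<close>. By \<open>2 * B\<^sup>2 < P\<close> this number is zero, and equal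
  reduced fractions with positive denominators have the same terms.\<close>

lemma ratio_unique:
  assumes "P dvd s * x - r" "P dvd s' * x - r'" "coprime r s" "coprime r' s'" "0 < s" "0 < s'"
    "\<bar>r\<bar> \<le> B" "s \<le> B" "\<bar>r'\<bar> \<le> B" "s' \<le> B" "2 * B\<^sup>2 < P"
  shows "r = r' \<and> s = s'"
proof -
  have "P dvd s' * (s * x - r) - s * (s' * x - r')"
    by (rule dvd_diff) (rule dvd_mult, fact assms)+
  also have "s' * (s * x - r) - s * (s' * x - r') = s * r' - s' * r" by (simp add: algebra_simps)
  finally have d: "P dvd s * r' - s' * r" .
  have "\<bar>s * r' - s' * r\<bar> \<le> \<bar>s * r'\<bar> + \<bar>s' * r\<bar>" by (rule abs_triangle_ineq4)
  also have "\<dots> \<le> B * B + B * B" unfolding abs_mult using assms by (intro add_mono mult_mono) auto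
  finally have "s * r' - s' * r = 0" using d assms(11) by (intro zero_if_P_dvd) (auto simp: power2_eq_square)
  hence e: "s * r' = s' * r" by simp
  have "s dvd s' * r" by (metis e dvd_triv_left)
  hence "s dvd s'" using assms(3) by (simp add: coprime_commute coprime_dvd_mult_left_iff)
  moreover have "s' dvd s * r'" by (metis e dvd_triv_left)
  hence "s' dvd s" using assms(4) by (simp add: coprime_commute coprime_dvd_mult_left_iff)
  ultimately have "s = s'" using assms zdvd_antisym_nonneg[of s s'] by simp
  thus ?thesis using e assms by simp
qed

lemma card_int_divisors:
  assumes "x \<noteq> 0" shows "finite {d :: int. d dvd x}" "card {d :: int. d dvd x} \<le> 2 * card {d :: nat. d dvd nat \<bar>x\<bar>}"
    "finite {d :: int. d dvd x \<and> d > 0}" "card {d :: int. d dvd x \<and> d > 0} \<le> card {d :: nat. d dvd nat \<bar>x\<bar>}"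
proof -
  let ?D = "{d :: nat. d dvd nat \<bar>x\<bar>}"
  have fin: "finite ?D" by (rule finite_divisors_nat) (use assms in simp)
  have pos: "{d :: int. d dvd x \<and> d > 0} \<subseteq> int ` ?D"
  proof
    fix d :: int assume d: "d \<in> {d. d dvd x \<and> d > 0}"
    hence "nat \<bar>d\<bar> \<in> ?D" "d = int (nat \<bar>d\<bar>)" by (simp_all add: nat_abs_dvd_iff)
    thus "d \<in> int ` ?D" by blast
  qed
  have all: "{d :: int. d dvd x} \<subseteq> int ` ?D \<union> (\<lambda>n. - int n) ` ?D"
  proof
    fix d :: int assume d: "d \<in> {d. d dvd x}"
    hence "nat \<bar>d\<bar> \<in> ?D" by (simp add: nat_abs_dvd_iff)
    moreover have "d = int (nat \<bar>d\<bar>) \<or> d = - int (nat \<bar>d\<bar>)" by auto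
    ultimately show "d \<in> int ` ?D \<union> (\<lambda>n. - int n) ` ?D" by blast
  qed
  show "finite {d :: int. d dvd x}" by (rule finite_subset[OF all]) (use fin in auto)
  show "finite {d :: int. d dvd x \<and> d > 0}" by (rule finite_subset[OF pos]) (use fin in auto)
  have "card {d :: int. d dvd x \<and> d > 0} \<le> card (int ` ?D)" by (rule card_mono[OF _ pos]) (use fin in auto)
  also have "\<dots> \<le> card ?D" by (rule card_image_le[OF fin])
  finally show "card {d :: int. d dvd x \<and> d > 0} \<le> card ?D" .
  have "card {d :: int. d dvd x} \<le> card (int ` ?D \<union> (\<lambda>n. - int n) ` ?D)" by (rule card_mono[OF _ all]) (use fin in auto)
  also have "\<dots> \<le> card (int ` ?D) + card ((\<lambda>n. - int n) ` ?D)" by (rule card_Un_le)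
  also have "\<dots> \<le> card ?D + card ?D" by (intro add_mono card_image_le fin)
  finally show "card {d :: int. d dvd x} \<le> 2 * card ?D" by simp
qed

text \<open>
  Multiply two fractions \<open>r e / s e\<close> and \<open>r e' / s e'\<close>, cancelling \<open>c = gcd (r e) (s e')\<close> and
  \<open>c' = gcd (r e') (s e)\<close>. For fixed \<open>(c, c')\<close> the reduced product is determined by \<open>e + e'\<close>, and it
  determines both factors up to a choice of divisors; thus there are at most \<open>(4 * m + 1) * 2 * D\<^sup>2\<close> such pairs.
  Trivially there are at most \<open>b c c' * b c' c\<close>. The geometric mean of the two bounds can be summed over \<open>(c, c')\<close>.
\<close>

lemma card_small_height:
  fixes R :: int and D :: nat
  assumes F: "F \<subseteq> {-m..m}" "\<And>e. e \<in> F \<Longrightarrow> height_le e R" and R: "R \<ge> 1" "2 * R ^ 4 < P"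
    and D: "\<And>k :: nat. 0 < k \<Longrightarrow> int k \<le> R\<^sup>2 \<Longrightarrow> card {d. d dvd k} \<le> D"
  shows "real (card F) \<le> sqrt (2 * (4 * m + 1)) * D ^ 3"
proof -
  have finF: "finite F" using F(1) finite_subset by blast
  have RP: "R < P"
  proof -
    have "R \<le> R ^ 4" using R(1) self_le_power[of R 4] by simp
    thus ?thesis using R by linarith
  qed
  have "\<exists>z. coprime (fst z) (snd z) \<and> 0 < snd z \<and> fst z \<noteq> 0 \<and> \<bar>fst z\<bar> \<le> R \<and> snd z \<le> R \<and> P dvd snd z * G e - fst z"
    if e: "e \<in> F" for e
    by (rule height_le_reduced[OF F(2)[OF e] RP]) (metis fst_conv snd_conv)
  then obtain z where z: "\<And>e. e \<in> F \<Longrightarrow> coprime (fst (z e)) (snd (z e)) \<and> 0 < snd (z e) \<and> fst (z e) \<noteq> 0 \<and>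
      \<bar>fst (z e)\<bar> \<le> R \<and> snd (z e) \<le> R \<and> P dvd snd (z e) * G e - fst (z e)"
    by metis
  define r s where "r = fst \<circ> z" and "s = snd \<circ> z"
  have rs: "\<And>e. e \<in> F \<Longrightarrow> coprime (r e) (s e)" "\<And>e. e \<in> F \<Longrightarrow> 0 < s e" "\<And>e. e \<in> F \<Longrightarrow> r e \<noteq> 0"
    "\<And>e. e \<in> F \<Longrightarrow> \<bar>r e\<bar> \<le> R" "\<And>e. e \<in> F \<Longrightarrow> s e \<le> R" "\<And>e. e \<in> F \<Longrightarrow> P dvd s e * G e - r e"
    using z by (auto simp: r_def s_def)
  define Z where "Z = {1..R} \<times> {1..R}"
  define \<phi> where "\<phi> = (\<lambda>(e, e'). (gcd (r e) (s e'), gcd (r e') (s e)))"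
  define Q where "Q z = {x \<in> F \<times> F. \<phi> x = z}" for z
  define b where "b c c' = card {e \<in> F. c dvd r e \<and> c' dvd s e}" for c c'
  have phiZ: "\<phi> x \<in> Z" if x: "x \<in> F \<times> F" for x
  proof -
    have "gcd (r e) (s e') \<in> {1..R}" if "e \<in> F" "e' \<in> F" for e e'
    proof -
      have "gcd (r e) (s e') \<le> s e'" using rs(2)[OF that(2)] by (simp add: gcd_le2_int)
      moreover have "gcd (r e) (s e') \<noteq> 0" "gcd (r e) (s e') \<ge> 0" using rs(2)[OF that(2)] by auto
      hence "1 \<le> gcd (r e) (s e')" by linarith
      ultimately show ?thesis using rs(5)[OF that(2)] unfolding atLeastAtMost_iff by linarith
    qed
    thus ?thesis using x by (auto simp: \<phi>_def Z_def)
  qed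
  have claim1: "card (Q (c, c')) \<le> b c c' * b c' c" for c c'
  proof -
    have "Q (c, c') \<subseteq> {e \<in> F. c dvd r e \<and> c' dvd s e} \<times> {e \<in> F. c' dvd r e \<and> c dvd s e}"
      by (auto simp: Q_def \<phi>_def)
    hence "card (Q (c, c')) \<le> card ({e \<in> F. c dvd r e \<and> c' dvd s e} \<times> {e \<in> F. c' dvd r e \<and> c dvd s e})"
      using finF by (intro card_mono) auto
    thus ?thesis by (simp add: b_def card_cartesian_product)
  qed
  have claim2: "card (Q (c, c')) \<le> nat (4 * m + 1) * (2 * D\<^sup>2)" if cc: "(c, c') \<in> Z" for c c'
  proof -
    define \<rho> where "\<rho> = (\<lambda>(e, e'). (r e div c) * (r e' div c'))"
    define \<tau> where "\<tau> = (\<lambda>(e, e'). (s e div c') * (s e' div c))"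
    have cpos: "c > 0" "c' > 0" using cc by (auto simp: Z_def)
    have pr: "coprime (\<rho> x) (\<tau> x) \<and> 0 < \<tau> x \<and> \<bar>\<rho> x\<bar> \<le> R\<^sup>2 \<and> \<tau> x \<le> R\<^sup>2 \<and> \<rho> x \<noteq> 0 \<and>
       P dvd \<tau> x * G (fst x + snd x) - \<rho> x \<and> r (fst x) = c * (r (fst x) div c) \<and> s (fst x) = c' * (s (fst x) div c') \<and>
       r (fst x) div c dvd \<rho> x \<and> s (fst x) div c' dvd \<tau> x \<and> s (fst x) div c' > 0" if x: "x \<in> Q (c, c')" for x
    proof -
      obtain e e' where ee: "x = (e, e')" "e \<in> F" "e' \<in> F" "c = gcd (r e) (s e')" "c' = gcd (r e') (s e)"
        using x by (auto simp: Q_def \<phi>_def)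
      have "c dvd r e" "c dvd s e'" "c' dvd r e'" "c' dvd s e" using ee by auto
      then obtain r1 s2 r2 s1 where d: "r e = c * r1" "s e' = c * s2" "r e' = c' * r2" "s e = c' * s1"
        by (metis dvdE)
      have dv: "r e div c = r1" "s e' div c = s2" "r e' div c' = r2" "s e div c' = s1"
        using cpos by (auto simp: d)
      have "coprime r1 s2" using div_gcd_coprime[of "r e" "s e'"] rs(3)[OF ee(2)] dv ee by auto
      moreover have "coprime r2 s1" using div_gcd_coprime[of "r e'" "s e"] rs(3)[OF ee(3)] dv ee by auto
      moreover have "coprime r1 s1" using rs(1)[OF ee(2)] by (simp add: d)
      moreover have "coprime r2 s2" using rs(1)[OF ee(3)] by (simp add: d)
      ultimately have cop: "coprime (r1 * r2) (s1 * s2)" by simp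
      have spos: "s1 > 0" "s2 > 0" using rs(2)[OF ee(2)] rs(2)[OF ee(3)] cpos by (simp_all add: d zero_less_mult_iff)
      have le: "\<bar>y\<bar> \<le> k * \<bar>y\<bar>" if "k > 0" for k y :: int using that by (simp add: mult_le_cancel_right1)
      have bd: "\<bar>r1\<bar> \<le> R" "\<bar>r2\<bar> \<le> R"
        using rs(4)[OF ee(2)] rs(4)[OF ee(3)] le[OF cpos(1), of r1] le[OF cpos(2), of r2] cpos
        by (auto simp: d abs_mult)
      have bs: "s1 \<le> R" "s2 \<le> R"
        using rs(5)[OF ee(2)] rs(5)[OF ee(3)] le[OF cpos(2), of s1, unfolded abs_of_pos[OF spos(1)]]
          le[OF cpos(1), of s2, unfolded abs_of_pos[OF spos(2)]] unfolding d by linarith+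
      have "\<bar>r1 * r2\<bar> \<le> R * R" unfolding abs_mult using bd R by (intro mult_mono) auto
      moreover have "s1 * s2 \<le> R * R" using bs spos R by (intro mult_mono) auto
      moreover have "r1 * r2 \<noteq> 0" using rs(3)[OF ee(2)] rs(3)[OF ee(3)] by (auto simp: d)
      moreover have "P dvd s1 * s2 * G (e + e') - r1 * r2"
      proof -
        have "P dvd s e * s e' * G (e + e') - r e * r e'" by (intro ratio_mult rs ee)
        also have "s e * s e' * G (e + e') - r e * r e' = c * (c' * (s1 * s2 * G (e + e') - r1 * r2))"
          by (simp add: d algebra_simps)
        finally have "P dvd c \<or> P dvd c' \<or> P dvd s1 * s2 * G (e + e') - r1 * r2"
          by (simp only: P_dvd_mult_iff)
        moreover have "\<not> P dvd c" "\<not> P dvd c'" using cc RP not_P_dvd[of c] not_P_dvd[of c'] by (auto simp: Z_def)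
        ultimately show ?thesis by blast
      qed
      ultimately show ?thesis using cop spos dv by (simp add: ee(1) \<rho>_def \<tau>_def power2_eq_square d(1,4))
    qed
    have finQ: "finite (Q (c, c'))" using finF by (simp add: Q_def)
    have fib: "card {x \<in> Q (c, c'). fst x + snd x = \<sigma>} \<le> 2 * D\<^sup>2" if sig: "\<sigma> \<in> (\<lambda>x. fst x + snd x) ` Q (c, c')" for \<sigma>
    proof -
      obtain a where a: "a \<in> Q (c, c')" "\<sigma> = fst a + snd a" using sig by blast
      let ?S = "{x \<in> Q (c, c'). fst x + snd x = \<sigma>}"
      \<comment> \<open>The cancelled numerator is a divisor of \<open>\<rho> a\<close> of either
        sign, the cancelled denominator a positive divisor of \<open>\<tau> a\<close>; this gives
        the bound \<open>2 * D * D\<close>.\<close>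
      let ?h = "\<lambda>x. (r (fst x) div c, s (fst x) div c')"
      let ?T = "{d :: int. d dvd \<rho> a} \<times> {d :: int. d dvd \<tau> a \<and> d > 0}"
      have img: "?h ` ?S \<subseteq> ?T"
      proof (intro subsetI, elim imageE)
        fix y x assume x: "x \<in> ?S" and y: "y = ?h x"
        have "\<rho> x = \<rho> a \<and> \<tau> x = \<tau> a"
        proof (rule ratio_unique)
          show "P dvd \<tau> x * G \<sigma> - \<rho> x" using pr[of x] x by auto
          show "P dvd \<tau> a * G \<sigma> - \<rho> a" using pr[of a] a by auto
          show "2 * (R\<^sup>2)\<^sup>2 < P" using R by simp
        qed (use pr[of x] pr[of a] x a in auto)
        thus "y \<in> ?T" using pr[of x] x y by auto
      qed
      have "inj_on ?h ?S"
      proof (rule inj_onI)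
        fix x y assume x: "x \<in> ?S" and y: "y \<in> ?S" and h: "?h x = ?h y"
        have eqs: "r (fst x) = r (fst y)" "s (fst x) = s (fst y)"
          using pr[of x] pr[of y] x y h by (metis (mono_tags, lifting) mem_Collect_eq prod.inject)+
        have fF: "fst x \<in> F" "fst y \<in> F" using x y by (auto simp: Q_def)
        have "fst x = fst y"
        proof (rule ratio_inj)
          show "P dvd s (fst x) * G (fst x) - r (fst x)" by (rule rs(6)[OF fF(1)])
          show "P dvd s (fst x) * G (fst y) - r (fst x)" unfolding eqs by (rule rs(6)[OF fF(2)])
          show "\<not> P dvd s (fst x)" using rs(2,5)[OF fF(1)] RP by (intro not_P_dvd) auto
          have "fst x \<in> {-m..m}" "fst y \<in> {-m..m}" using F(1) fF by auto
          thus "\<bar>fst x - fst y\<bar> < 3 * m" using m_pos by auto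
        qed
        moreover have "fst x + snd x = fst y + snd y" using x y by simp
        ultimately show "x = y" by (simp add: prod_eq_iff)
      qed
      moreover have nz: "\<rho> a \<noteq> 0" "\<tau> a \<noteq> 0" using pr[OF a(1)] by auto
      moreover have "finite ?T" using card_int_divisors[OF nz(1)] card_int_divisors[OF nz(2)] by auto
      ultimately have "card ?S \<le> card ?T" using card_inj_on_le[OF _ img] by blast
      also have "\<dots> = card {d :: int. d dvd \<rho> a} * card {d :: int. d dvd \<tau> a \<and> d > 0}" by (rule card_cartesian_product)
      also have "\<dots> \<le> (2 * card {d :: nat. d dvd nat \<bar>\<rho> a\<bar>}) * card {d :: nat. d dvd nat \<bar>\<tau> a\<bar>}"
        using card_int_divisors[OF nz(1)] card_int_divisors[OF nz(2)] by (intro mult_le_mono) auto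
      also have "\<dots> \<le> (2 * D) * D"
        using pr[OF a(1)] nz by (intro mult_le_mono order_refl D) auto
      finally show ?thesis by (simp add: power2_eq_square)
    qed
    have "card (Q (c, c')) \<le> card ((\<lambda>x. fst x + snd x) ` Q (c, c')) * (2 * D\<^sup>2)"
      by (rule card_le_fibres[OF finQ fib])
    also have "card ((\<lambda>x. fst x + snd x) ` Q (c, c')) \<le> card {-2 * m..2 * m}"
    proof (rule card_mono)
      show "(\<lambda>x. fst x + snd x) ` Q (c, c') \<subseteq> {-2 * m..2 * m}"
      proof (intro subsetI, elim imageE)
        fix y x assume "x \<in> Q (c, c')" "y = fst x + snd x"
        moreover from this have "fst x \<in> {-m..m}" "snd x \<in> {-m..m}" using F(1) by (auto simp: Q_def)
        ultimately show "y \<in> {-2 * m..2 * m}" by auto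
      qed
    qed simp
    also have "card {-2 * m..2 * m} = nat (4 * m + 1)" by simp
    finally show ?thesis by simp
  qed
  define K where "K = sqrt (2 * (4 * m + 1)) * D"
  have K0: "K \<ge> 0" using m_pos by (simp add: K_def)
  have bound: "real (card (Q (c, c'))) \<le> K * ((b c c' + b c' c) / 2)" if "(c, c') \<in> Z" for c c'
  proof -
    have "real (nat (4 * m + 1) * (2 * D\<^sup>2)) = K\<^sup>2" using m_pos by (simp add: K_def power_mult_distrib)
    hence 2: "real (card (Q (c, c'))) \<le> K\<^sup>2" using claim2[OF that] by (metis of_nat_le_iff)
    have 1: "real (card (Q (c, c'))) \<le> real (b c c') * b c' c" using claim1[of c c'] by (metis of_nat_le_iff of_nat_mult)
    have "(real (card (Q (c, c'))))\<^sup>2 \<le> (real (b c c') * b c' c) * K\<^sup>2"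
      unfolding power2_eq_square[of "real (card _)"] using 1 2 by (intro mult_mono) auto
    \<comment> \<open>The inequality of arithmetic and geometric means makes the bound linear in
      \<open>b\<close>, so that summing it over \<open>Z\<close> reduces to counting
      divisors.\<close>
    also have "real (b c c') * b c' c \<le> ((b c c' + b c' c) / 2)\<^sup>2"
    proof -
      have "0 \<le> (real (b c c') - b c' c)\<^sup>2" by simp
      thus ?thesis by (simp add: power2_eq_square field_simps)
    qed
    finally have "(real (card (Q (c, c'))))\<^sup>2 \<le> (K * ((b c c' + b c' c) / 2))\<^sup>2"
      by (simp add: power_mult_distrib power_divide mult.commute mult_right_mono)
    thus ?thesis by (rule power2_le_imp_le) (use K0 in simp)
  qed
  have finZ: "finite Z" by (simp add: Z_def)
  have sumb: "(\<Sum>(c, c')\<in>Z. b c c') \<le> card F * D\<^sup>2"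
  proof -
    \<comment> \<open>Double counting: for fixed \<open>e\<close> the admissible \<open>c\<close>
      and \<open>c'\<close> are positive divisors of \<open>r e\<close> and \<open>s e\<close>,
      which leaves at most \<open>D\<^sup>2\<close> pairs.\<close>
    have "(\<Sum>(c, c')\<in>Z. b c c') = (\<Sum>z\<in>Z. \<Sum>e\<in>F. if fst z dvd r e \<and> snd z dvd s e then 1 else 0)"
      using finF by (auto simp: b_def sum.If_cases Int_def intro!: sum.cong)
    also have "\<dots> = (\<Sum>e\<in>F. \<Sum>z\<in>Z. if fst z dvd r e \<and> snd z dvd s e then 1 else 0)" by (rule sum.swap)
    also have "\<dots> = (\<Sum>e\<in>F. card {z \<in> Z. fst z dvd r e \<and> snd z dvd s e})"
      using finZ by (simp add: sum.If_cases Int_def)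
    also have "\<dots> \<le> (\<Sum>e\<in>F. D\<^sup>2)"
    proof (rule sum_mono)
      fix e assume e: "e \<in> F"
      have nz: "r e \<noteq> 0" "s e \<noteq> 0" using rs(2,3)[OF e] by auto
      have RR: "R \<le> R\<^sup>2" using R(1) self_le_power[of R 2] by simp
      have "card {z \<in> Z. fst z dvd r e \<and> snd z dvd s e} \<le> card ({d. d dvd r e \<and> d > 0} \<times> {d. d dvd s e \<and> d > 0})"
        using card_int_divisors[OF nz(1)] card_int_divisors[OF nz(2)] by (intro card_mono) (auto simp: Z_def)
      also have "\<dots> \<le> card {d :: nat. d dvd nat \<bar>r e\<bar>} * card {d :: nat. d dvd nat \<bar>s e\<bar>}"
        unfolding card_cartesian_product
        using card_int_divisors[OF nz(1)] card_int_divisors[OF nz(2)] by (intro mult_le_mono) auto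
      also have "\<dots> \<le> D * D" using nz rs[OF e] RR by (intro mult_le_mono D) auto
      finally show "card {z \<in> Z. fst z dvd r e \<and> snd z dvd s e} \<le> D\<^sup>2" by (simp add: power2_eq_square)
    qed
    finally show ?thesis by simp
  qed
  have swapb: "(\<Sum>(c, c')\<in>Z. real (b c' c)) = (\<Sum>(c, c')\<in>Z. real (b c c'))"
    by (rule sum.reindex_bij_witness[of _ prod.swap prod.swap]) (auto simp: Z_def)
  have "(card F)\<^sup>2 = card (F \<times> F)" by (simp add: card_cartesian_product power2_eq_square)
  also have "F \<times> F = (\<Union>z\<in>Z. Q z)" using phiZ by (auto simp: Q_def)
  also have "card \<dots> \<le> (\<Sum>z\<in>Z. card (Q z))" by (rule card_UN_le[OF finZ])
  finally have "real ((card F)\<^sup>2) \<le> (\<Sum>z\<in>Z. real (card (Q z)))" by (metis of_nat_le_iff of_nat_sum)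
  also have "\<dots> \<le> (\<Sum>(c, c')\<in>Z. K * ((b c c' + b c' c) / 2))"
    by (rule sum_mono) (use bound in auto)
  also have "\<dots> = K * (((\<Sum>(c, c')\<in>Z. real (b c c')) + (\<Sum>(c, c')\<in>Z. real (b c' c))) / 2)"
    by (simp add: sum_distrib_left sum.distrib[symmetric] case_prod_beta sum_divide_distrib)
  also have "\<dots> = K * (\<Sum>(c, c')\<in>Z. real (b c c'))" by (simp add: swapb)
  also have "\<dots> \<le> K * real (card F * D\<^sup>2)"
  proof (rule mult_left_mono[OF _ K0])
    have "(\<Sum>(c, c')\<in>Z. real (b c c')) = real (\<Sum>(c, c')\<in>Z. b c c')" by (simp add: case_prod_beta)
    thus "(\<Sum>(c, c')\<in>Z. real (b c c')) \<le> real (card F * D\<^sup>2)" using sumb by (simp only: of_nat_le_iff)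
  qed
  finally have fin: "real (card F) * real (card F) \<le> real (card F) * (K * (real D)\<^sup>2)"
    by (simp add: power2_eq_square algebra_simps)
  have KD: "K * (real D)\<^sup>2 = sqrt (2 * (4 * m + 1)) * D ^ 3" by (simp add: K_def power2_eq_square power3_eq_cube)
  show ?thesis
  proof (cases "card F = 0")
    case True thus ?thesis using m_pos by simp
  next
    case False
    thus ?thesis using fin unfolding KD by simp
  qed
qed

section \<open>The energy of the dilates\<close>

definition rel_coeff :: "int \<Rightarrow> int \<Rightarrow> 4 \<Rightarrow> int" where
  "rel_coeff d e i = (if i = 1 then 1 else if i = 2 then G d else if i = 3 then - G e else - (G e * G d))"

lemma mem_kern_rel_coeff:
  "a \<in> kern P (rel_coeff d e) \<longleftrightarrow> P dvd (a 1 + a 2 * G d) - G e * (a 3 + a 4 * G d)"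
  by (simp add: kern_def sum_4 rel_coeff_def algebra_simps)

text \<open>A relation with \<open>x\<close> and \<open>y\<close> both nonzero would exhibit
  \<open>G d\<close> as the fraction \<open>- x / y\<close> of height at most \<open>R\<close>. If
  one of them is zero, then \<open>P\<close> divides the other, which is smaller than
  \<open>P\<close>.\<close>

lemma no_small_relation:
  assumes d: "\<not> height_le d R" and P: "R < P" and xy: "P dvd x + y * G d" "\<bar>x\<bar> \<le> R" "\<bar>y\<bar> \<le> R"
  shows "x = 0 \<and> y = 0"
proof (rule ccontr)
  assume ne: "\<not> ?thesis"
  have "x \<noteq> 0"
  proof
    assume "x = 0"
    hence "P dvd y" using xy(1) G_unit P_dvd_mult_iff by simp
    thus False using ne \<open>x = 0\<close> xy P zero_if_P_dvd by auto
  qed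
  moreover have "y \<noteq> 0" using xy(1,2) P \<open>x \<noteq> 0\<close> not_P_dvd[of x] by auto
  moreover have "P dvd y * G d - (- x)" using xy(1) by (simp add: add.commute)
  ultimately have "height_le d R" unfolding height_le_def using xy by (intro exI[of _ "-x"] exI[of _ y]) auto
  thus False using d by simp
qed

text \<open>Proportionality gives \<open>N 1 * N 4 \<equiv> N 2 * N 3\<close>, an equality because
  the entries are at most \<open>R\<^sup>2\<close> in absolute value. Hence \<open>N\<close>
  factorises as \<open>(g * r, g * t, r * w, t * w)\<close>, and modulo \<open>P\<close> one has
  \<open>G d = t / r\<close> and \<open>G e = - w / g\<close>. As \<open>G d\<close> has no fraction
  of height at most \<open>R\<close>, one of \<open>\<bar>r\<bar>\<close>,
  \<open>\<bar>t\<bar>\<close> exceeds \<open>R\<close>, so \<open>g\<close> and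
  \<open>\<bar>w\<bar>\<close> are at most \<open>H / R\<close>.\<close>

lemma proportional_heights:
  fixes N :: "4 \<Rightarrow> int"
  assumes d: "\<not> height_le d R" and R: "R \<ge> 1" "2 * R ^ 4 < P"
    and N: "N \<noteq> 0" "small H N" "H \<le> R\<^sup>2" "\<And>i. P dvd N i - rel_coeff d e i * N 1"
  obtains h where "h \<ge> 1" "h \<le> R" "R * h \<le> H" "height_le e h"
proof -
  have R2P: "R\<^sup>2 < P"
  proof -
    have "R\<^sup>2 \<le> (R\<^sup>2)\<^sup>2" using R(1) self_le_power[of "R\<^sup>2" 2] by (simp add: one_le_power)
    also have "(R\<^sup>2)\<^sup>2 = R ^ 4" by simp
    finally show ?thesis using R one_le_power[of R 4] by linarith
  qed
  have NH: "\<bar>N i\<bar> \<le> H" for i using N(2) by (auto simp: small_def)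
  have NP: "\<bar>N i\<bar> < P" for i using NH[of i] N(3) R2P by linarith
  have c: "P dvd N 2 - G d * N 1" "P dvd N 3 + G e * N 1" "P dvd N 4 + G e * G d * N 1"
    using N(4)[of 2] N(4)[of 3] N(4)[of 4] by (simp_all add: rel_coeff_def)
  have n1: "N 1 \<noteq> 0"
  proof
    assume "N 1 = 0"
    hence "P dvd N i" for i using N(4)[of i] by simp
    hence "N i = 0" for i using NP zero_if_P_dvd by blast
    thus False using N(1) by (auto simp: fun_eq_iff)
  qed
  hence n1P: "\<not> P dvd N 1" using NP not_P_dvd by blast
  have n2: "N 2 \<noteq> 0"
  proof
    assume "N 2 = 0"
    hence "P dvd G d * N 1" using c(1) by simp
    thus False using n1P G_unit P_dvd_mult_iff by blast
  qed
  have n3: "N 3 \<noteq> 0"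
  proof
    assume "N 3 = 0"
    hence "P dvd G e * N 1" using c(2) by simp
    thus False using n1P G_unit P_dvd_mult_iff by blast
  qed
  have "P dvd N 1 * (N 4 + G e * G d * N 1) - (N 2 * (N 3 + G e * N 1) - G e * N 1 * (N 2 - G d * N 1))"
    by (rule dvd_diff[OF dvd_mult[OF c(3)] dvd_diff[OF dvd_mult[OF c(2)] dvd_mult[OF c(1)]]])
  also have "N 1 * (N 4 + G e * G d * N 1) - (N 2 * (N 3 + G e * N 1) - G e * N 1 * (N 2 - G d * N 1)) = N 1 * N 4 - N 2 * N 3"
    by (simp add: algebra_simps)
  finally have dv: "P dvd N 1 * N 4 - N 2 * N 3" .
  have "\<bar>N 1 * N 4 - N 2 * N 3\<bar> \<le> \<bar>N 1 * N 4\<bar> + \<bar>N 2 * N 3\<bar>" by (rule abs_triangle_ineq4)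
  also have "\<dots> \<le> R\<^sup>2 * R\<^sup>2 + R\<^sup>2 * R\<^sup>2"
    unfolding abs_mult using order_trans[OF NH N(3)] by (intro add_mono mult_mono) auto
  also have "\<dots> = 2 * R ^ 4" by (simp add: power2_eq_square power4_eq_xxxx)
  finally have "N 1 * N 4 - N 2 * N 3 = 0" using dv R by (intro zero_if_P_dvd) auto
  hence eq: "N 1 * N 4 = N 2 * N 3" by simp
  define g where "g = gcd (N 1) (N 2)"
  have g0: "g > 0" using n1 by (simp add: g_def)
  obtain r t where rt: "N 1 = g * r" "N 2 = g * t" by (metis g_def gcd_dvd1 gcd_dvd2 dvdE)
  have nz: "r \<noteq> 0" "t \<noteq> 0" using n1 n2 rt by auto
  have "r = N 1 div g" "t = N 2 div g" using g0 by (simp_all add: rt)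
  hence cop: "coprime r t" using div_gcd_coprime[of "N 1" "N 2"] n1 by (simp add: g_def)
  have "r * N 4 = t * N 3" using eq g0 by (simp add: rt)
  hence "r dvd t * N 3" by (metis dvd_triv_left)
  hence "r dvd N 3" using cop by (simp add: coprime_dvd_mult_right_iff)
  then obtain w where w: "N 3 = r * w" by (auto elim: dvdE)
  have w4: "N 4 = t * w" using \<open>r * N 4 = t * N 3\<close> nz by (simp add: w)
  have w0: "w \<noteq> 0" using n3 w by auto
  have "P dvd g * (t - G d * r)" using c(1) by (simp add: rt algebra_simps)
  moreover have "\<not> P dvd g" using n1P by (auto simp: rt)
  ultimately have "P dvd t - G d * r" using P_dvd_mult_iff by blast
  hence "P dvd - (t - G d * r)" by (simp only: dvd_minus_iff)
  hence pt: "P dvd r * G d - t" by (simp add: algebra_simps)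
  have big: "R < max \<bar>r\<bar> \<bar>t\<bar>"
  proof (rule ccontr)
    assume "\<not> ?thesis"
    hence "height_le d R" unfolding height_le_def using nz pt by (intro exI[of _ t] exI[of _ r]) auto
    thus False using d by simp
  qed
  have "P dvd r * (w + G e * g)" using c(2) by (simp add: rt w algebra_simps)
  moreover have "\<not> P dvd r" using n1P by (auto simp: rt)
  ultimately have "P dvd w + G e * g" using P_dvd_mult_iff by blast
  hence "P dvd g * G e - (- w)" by (simp add: algebra_simps)
  hence he: "height_le e (max g \<bar>w\<bar>)" unfolding height_le_def using g0 w0
    by (intro exI[of _ "-w"] exI[of _ g]) auto
  have "\<bar>r\<bar> * g \<le> H" "\<bar>t\<bar> * g \<le> H" "\<bar>r\<bar> * \<bar>w\<bar> \<le> H" "\<bar>t\<bar> * \<bar>w\<bar> \<le> H"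
    using NH[of 1] NH[of 2] NH[of 3] NH[of 4] g0 by (simp_all add: rt w w4 abs_mult mult.commute)
  hence MH: "max \<bar>r\<bar> \<bar>t\<bar> * max g \<bar>w\<bar> \<le> H" by (auto simp: max_def)
  have h1: "max g \<bar>w\<bar> \<ge> 1" using g0 by simp
  have "R * max g \<bar>w\<bar> \<le> max \<bar>r\<bar> \<bar>t\<bar> * max g \<bar>w\<bar>" using big h1 by (intro mult_right_mono) auto
  hence Rh: "R * max g \<bar>w\<bar> \<le> H" using MH by linarith
  hence "R * max g \<bar>w\<bar> \<le> R * R" using N(3) by (simp add: power2_eq_square)
  hence "max g \<bar>w\<bar> \<le> R" using R by simp
  thus ?thesis using that h1 Rh he by blast
qed

text \<open>
  Up to the factor \<open>m\<close>, the sum of \<open>energy d n e\<close> over \<open>e\<close> bounds the number of coincidences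
  \<open>G z * (x + x' * G d) \<equiv> G z' * (y + y' * G d)\<close>.
\<close>

definition energy :: "int \<Rightarrow> int \<Rightarrow> int \<Rightarrow> nat" where
  "energy d n e = card (lattice_box (kern P (rel_coeff d e)) n)"

definition shortest :: "int \<Rightarrow> int \<Rightarrow> nat" where
  "shortest d e = (LEAST q. \<exists>v\<in>lattice_box (kern P (rel_coeff d e)) (int q). v \<noteq> 0)"

definition height :: "int \<Rightarrow> nat" where
  "height e = (LEAST h. height_le e (int h))"

lemma height_le_mono: "height_le e h \<Longrightarrow> h \<le> k \<Longrightarrow> height_le e k"
  unfolding height_le_def by (meson order_trans)

lemma height_le_height:
  assumes "height_le e h" "0 \<le> h"
  shows "height_le e (int (height e))" "int (height e) \<le> h" "height e \<ge> 1"
proof -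
  have h: "height_le e (int (nat h))" using assms by simp
  show 1: "height_le e (int (height e))" unfolding height_def by (rule LeastI[where P = "\<lambda>h. height_le e (int h)"], rule h)
  have "height e \<le> nat h" unfolding height_def by (rule Least_le, rule h)
  thus "int (height e) \<le> h" using assms by simp
  show "height e \<ge> 1" using 1 by (auto simp: height_le_def)
qed

lemma shortest_vector:
  assumes "v \<in> lattice_box (kern P (rel_coeff d e)) q" "v \<noteq> 0" "0 \<le> q"
  shows "\<exists>w\<in>lattice_box (kern P (rel_coeff d e)) (int (shortest d e)). w \<noteq> 0" "int (shortest d e) \<le> q" "shortest d e \<ge> 1"
proof -
  have h: "\<exists>w\<in>lattice_box (kern P (rel_coeff d e)) (int (nat q)). w \<noteq> 0" using assms by auto
  show 1: "\<exists>w\<in>lattice_box (kern P (rel_coeff d e)) (int (shortest d e)). w \<noteq> 0"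
    unfolding shortest_def by (rule LeastI[where P = "\<lambda>q. \<exists>w\<in>lattice_box (kern P (rel_coeff d e)) (int q). w \<noteq> 0"], rule h)
  have "shortest d e \<le> nat q" unfolding shortest_def by (rule Least_le, rule h)
  thus "int (shortest d e) \<le> q" using assms by simp
  show "shortest d e \<ge> 1"
  proof (rule ccontr)
    assume "\<not> ?thesis"
    hence "shortest d e = 0" by simp
    with 1 have "\<exists>w :: 4 \<Rightarrow> int. w \<noteq> 0 \<and> small 0 w" by (auto simp: lattice_box_def)
    thus False by (auto simp: small_def fun_eq_iff)
  qed
qed

text \<open>Each alternative of \<open>lattice_count\<close> is bounded by one of the summands.
  Dimension three contributes two of them: for \<open>H > R\<^sup>2\<close> the count is already
  small, and otherwise \<open>G e\<close> is a small fraction with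
  \<open>R * height e \<le> H\<close>.\<close>

lemma energy_bound:
  assumes d: "\<not> height_le d R" and R: "R \<ge> 1" "2 * R ^ 4 < P" and n: "n \<ge> 1"
  shows "real (energy d n e) \<le> 1 + 24 * 8 ^ 10 * real_of_int n ^ 4 / P + 6 * 8 ^ 6 * real_of_int n ^ 3 / (real_of_int R)\<^sup>2
    + (if \<exists>v\<in>lattice_box (kern P (rel_coeff d e)) n. v \<noteq> 0 then 512 * (real_of_int n)\<^sup>2 * (1 / (real (shortest d e))\<^sup>2) else 0)
    + (if height_le e R then 6 * 8 ^ 6 * real_of_int n ^ 3 / R * (1 / real (height e)) else 0)"
    (is "_ \<le> 1 + ?a + ?b + ?s + ?h")
proof -
  have P0: "P > 0" using P_gt by simp
  have pos: "?a \<ge> 0" "?b \<ge> 0" "?s \<ge> 0" "?h \<ge> 0" using n R P0 by simp_all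
  have c1: "rel_coeff d e 1 = 1" by (simp add: rel_coeff_def)
  show ?thesis
  proof (cases rule: lattice_count[of "rel_coeff d e" P n, OF c1 P0 n])
    case 1
    hence "energy d n e \<le> 1" unfolding energy_def using card_mono[OF _ 1] by simp
    hence "real (energy d n e) \<le> 1" by simp
    thus ?thesis using pos by linarith
  next
    case (2 q v)
    have v: "v \<in> lattice_box (kern P (rel_coeff d e)) n" using 2 small_mono by (fastforce simp: lattice_box_def)
    hence ex: "\<exists>v\<in>lattice_box (kern P (rel_coeff d e)) n. v \<noteq> 0" using 2 by blast
    have sh: "int (shortest d e) \<le> q" "shortest d e \<ge> 1" using shortest_vector[OF 2(3,4)] 2(1) by auto
    have "n / q \<le> n / real (shortest d e)" using sh n by (intro divide_left_mono) auto
    hence "(n / q)\<^sup>2 \<le> (n / real (shortest d e))\<^sup>2" using n 2 by (intro power_mono) auto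
    hence "real (energy d n e) \<le> ?s" using 2(6) ex by (simp add: energy_def power_divide)
    thus ?thesis using pos by linarith
  next
    case (3 N H)
    show ?thesis
    proof (cases "H \<le> R\<^sup>2")
      case True
      obtain h where h: "h \<ge> 1" "h \<le> R" "R * h \<le> H" "height_le e h"
        using proportional_heights[OF d R 3(1,2) True 3(4)] by blast
      have he: "height_le e R" using height_le_mono[OF h(4,2)] .
      have hh: "int (height e) \<le> h" "height e \<ge> 1" using height_le_height[OF h(4)] h by auto
      have "R * int (height e) \<le> R * h" using hh R by (intro mult_left_mono) auto
      hence RH: "R * int (height e) \<le> H" using h by linarith
      have "real_of_int (R * int (height e)) \<le> real_of_int H" using RH by (simp only: of_int_le_iff)
      hence RH': "real_of_int R * real (height e) \<le> real_of_int H" by simp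
      have "real (energy d n e) \<le> 6 * 8 ^ 6 * n ^ 3 / H" using 3(5) by (simp add: energy_def)
      also have "\<dots> \<le> 6 * 8 ^ 6 * n ^ 3 / (real_of_int R * real (height e))"
        using RH' R hh n 3(3) by (intro divide_left_mono mult_pos_pos) auto
      also have "\<dots> = ?h" using he by simp
      finally show ?thesis using pos by linarith
    next
      case False
      hence "R\<^sup>2 \<le> H" by simp
      hence "real_of_int (R\<^sup>2) \<le> H" by (simp only: of_int_le_iff)
      hence RH: "(real_of_int R)\<^sup>2 \<le> H" by simp
      have "real (energy d n e) \<le> 6 * 8 ^ 6 * n ^ 3 / H" using 3(5) by (simp add: energy_def)
      also have "\<dots> \<le> 6 * 8 ^ 6 * n ^ 3 / (real_of_int R)\<^sup>2"
        using RH R n 3(3) by (intro divide_left_mono mult_pos_pos) auto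
      finally have "real (energy d n e) \<le> ?b" by simp
      thus ?thesis using pos by linarith
    qed
  next
    case 4
    hence "real (energy d n e) \<le> ?a" by (simp add: energy_def)
    thus ?thesis using pos by linarith
  qed
qed

text \<open>A nonzero vector \<open>a\<close> of the box belongs to at most one exponent, since
  \<open>G e\<close> is the quotient of \<open>a 1 + a 2 * G d\<close> by
  \<open>a 3 + a 4 * G d\<close>. Were the denominator zero modulo \<open>P\<close>, the numerator
  would be too, and \<open>no_small_relation\<close> would force \<open>a = 0\<close>. So there are
  no more exponents than vectors.\<close>

lemma card_shortest_le:
  assumes d: "\<not> height_le d R" and R: "R \<ge> 1" "R < P" and q: "0 \<le> q" "q \<le> R"
  shows "card {e \<in> {-m..m}. \<exists>v\<in>lattice_box (kern P (rel_coeff d e)) q. v \<noteq> 0} \<le> nat (2 * q + 1) ^ 4"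
proof -
  let ?S = "{e \<in> {-m..m}. \<exists>v\<in>lattice_box (kern P (rel_coeff d e)) q. v \<noteq> 0}"
  obtain f where f: "\<And>e. e \<in> ?S \<Longrightarrow> f e \<in> lattice_box (kern P (rel_coeff d e)) q \<and> f e \<noteq> 0"
    using bchoice[of ?S "\<lambda>e v. v \<in> lattice_box (kern P (rel_coeff d e)) q \<and> v \<noteq> 0"] by blast
  have "inj_on f ?S"
  proof (rule inj_onI)
    fix e e' assume e: "e \<in> ?S" "e' \<in> ?S" "f e = f e'"
    define a where "a = f e"
    have a: "a \<noteq> 0" "small q a" "a \<in> kern P (rel_coeff d e)" "a \<in> kern P (rel_coeff d e')"
      using f[OF e(1)] f[OF e(2)] e(3) by (auto simp: a_def lattice_box_def)
    have aR: "\<bar>a i\<bar> \<le> R" for i using a(2) q by (auto simp: small_def intro: order_trans)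
    let ?y = "a 3 + a 4 * G d"
    have 1: "P dvd (a 1 + a 2 * G d) - G e * ?y" using a(3) by (simp only: mem_kern_rel_coeff)
    have 2: "P dvd (a 1 + a 2 * G d) - G e' * ?y" using a(4) by (simp only: mem_kern_rel_coeff)
    show "e = e'"
    proof (cases "P dvd ?y")
      case True
      have "P dvd a 1 + a 2 * G d" using dvd_add[OF 1 dvd_mult[OF True, of "G e"]] by simp
      hence "a 1 = 0 \<and> a 2 = 0" by (intro no_small_relation[OF d R(2)] aR)
      moreover have "a 3 = 0 \<and> a 4 = 0" using True by (intro no_small_relation[OF d R(2)] aR)
      ultimately have "a i = 0" for i using exhaust_4[of i] by auto
      thus ?thesis using a(1) by (auto simp: fun_eq_iff)
    next
      case False
      show ?thesis
      proof (rule ratio_inj[OF _ _ False])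
        have "P dvd - ((a 1 + a 2 * G d) - G e * ?y)" using 1 by (simp only: dvd_minus_iff)
        thus "P dvd ?y * G e - (a 1 + a 2 * G d)" by (simp add: algebra_simps)
        have "P dvd - ((a 1 + a 2 * G d) - G e' * ?y)" using 2 by (simp only: dvd_minus_iff)
        thus "P dvd ?y * G e' - (a 1 + a 2 * G d)" by (simp add: algebra_simps)
        show "\<bar>e - e'\<bar> < 3 * m" using e m_pos by auto
      qed
    qed
  qed
  moreover have "f ` ?S \<subseteq> {a. small q a}" using f by (auto simp: lattice_box_def)
  ultimately have "card ?S \<le> card {a :: 4 \<Rightarrow> int. small q a}" using card_inj_on_le[OF _ _ finite_small] by blast
  thus ?thesis by (simp add: card_small)
qed

text \<open>An application of \<open>sum_inverse_le\<close> with \<open>C = 81\<close>: for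
  \<open>1 \<le> q \<le> R\<close> at most \<open>(2 * q + 1) ^ 4 \<le> 81 * q ^ 4\<close> exponents
  have a shortest vector of length at most \<open>q\<close>. For \<open>q > R\<close> the trivial
  bound \<open>2 * m + 1\<close> suffices because \<open>m \<le> R ^ 4\<close>.\<close>

lemma sum_shortest_le:
  assumes d: "\<not> height_le d R" and R: "R \<ge> 1" "R < P" "m \<le> R ^ 4" and n: "n \<ge> 1"
  defines "S \<equiv> {e \<in> {-m..m}. \<exists>v\<in>lattice_box (kern P (rel_coeff d e)) n. v \<noteq> 0}"
  shows "(\<Sum>e\<in>S. 1 / (real (shortest d e))\<^sup>2) \<le> 2 * sqrt (81 * (2 * m + 1))"
proof -
  have finS: "finite S" by (rule finite_subset[of _ "{-m..m}"]) (auto simp: S_def)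
  have "S \<subseteq> {-m..m}" by (auto simp: S_def)
  hence "card S \<le> card {-m..m}" by (rule card_mono[rotated]) simp
  hence cS: "card S \<le> nat (2 * m + 1)" by simp
  have sv: "shortest d e \<ge> 1 \<and> (\<exists>v\<in>lattice_box (kern P (rel_coeff d e)) (int (shortest d e)). v \<noteq> 0)" if "e \<in> S" for e
    using that shortest_vector[of _ d e n] n unfolding S_def by force
  have "(\<Sum>e\<in>S. 1 / (real (shortest d e))\<^sup>2) \<le> 2 * sqrt (81 * real (card S))"
  proof (rule sum_inverse_le[OF finS])
    show "(real (shortest d e))\<^sup>2 > 0" if "e \<in> S" for e using sv[OF that] by simp
    fix t :: real assume t: "t > 0"
    define q where "q = \<lfloor>sqrt t\<rfloor>"
    have q0: "0 \<le> q" using t by (simp add: q_def)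
    have qt: "real_of_int q ^ 2 \<le> t"
    proof -
      have "real_of_int q \<le> sqrt t" by (simp add: q_def)
      hence "real_of_int q ^ 2 \<le> (sqrt t)\<^sup>2" using q0 by (intro power_mono) auto
      thus ?thesis using t by simp
    qed
    have le_q: "int (shortest d e) \<le> q" if "(real (shortest d e))\<^sup>2 \<le> t" for e
    proof -
      have "real (shortest d e) \<le> sqrt t" using that by (simp add: real_le_rsqrt)
      thus ?thesis by (simp add: q_def le_floor_iff)
    qed
    let ?T = "{e \<in> S. (real (shortest d e))\<^sup>2 \<le> t}"
    have q4: "real_of_int q ^ 4 \<le> t\<^sup>2"
    proof -
      have "(real_of_int q ^ 2)\<^sup>2 \<le> t\<^sup>2" using qt by (intro power_mono) auto
      thus ?thesis by simp
    qed
    show "real (card ?T) \<le> 81 * t\<^sup>2"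
    proof (cases "q = 0")
      case True
      have empty: "?T = {}" using le_q sv True by force
      show ?thesis unfolding empty by simp
    next
      case False
      hence q1: "q \<ge> 1" using q0 by simp
      show ?thesis
      proof (cases "q \<le> R")
        case True
        have "?T \<subseteq> {e \<in> {-m..m}. \<exists>v\<in>lattice_box (kern P (rel_coeff d e)) q. v \<noteq> 0}"
        proof
          fix e assume e: "e \<in> ?T"
          hence eS: "e \<in> S" by simp
          obtain v where "v \<in> lattice_box (kern P (rel_coeff d e)) (int (shortest d e))" "v \<noteq> 0" using sv[OF eS] by blast
          moreover have "int (shortest d e) \<le> q" using e le_q by simp
          ultimately have "v \<in> lattice_box (kern P (rel_coeff d e)) q" "v \<noteq> 0" by (auto simp: lattice_box_def intro: small_mono)
          thus "e \<in> {e \<in> {-m..m}. \<exists>v\<in>lattice_box (kern P (rel_coeff d e)) q. v \<noteq> 0}" using eS by (auto simp: S_def)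
        qed
        moreover have "finite {e \<in> {-m..m}. \<exists>v\<in>lattice_box (kern P (rel_coeff d e)) q. v \<noteq> 0}"
          by (rule finite_subset[of _ "{-m..m}"]) auto
        ultimately have "card ?T \<le> nat (2 * q + 1) ^ 4"
          using card_shortest_le[OF d R(1,2) q0 True] card_mono order_trans by meson
        hence "real (card ?T) \<le> real (nat (2 * q + 1) ^ 4)" by (simp only: of_nat_le_iff)
        also have "\<dots> = (2 * real_of_int q + 1) ^ 4" using q0 by simp
        also have "\<dots> \<le> (3 * real_of_int q) ^ 4" using q1 by (intro power_mono) auto
        also have "\<dots> \<le> 81 * t\<^sup>2" using q4 by (simp add: power_mult_distrib)
        finally show ?thesis .
      next
        case False
        have "card ?T \<le> card S" using finS by (intro card_mono) auto
        hence "real (card ?T) \<le> real (nat (2 * m + 1))" using cS by linarith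
        also have "\<dots> \<le> 3 * real_of_int m" using m_pos by simp
        also have "\<dots> \<le> 3 * real_of_int (R ^ 4)" using R(3) by (simp only: mult_le_cancel_left_pos of_int_le_iff)
        also have "\<dots> \<le> 3 * real_of_int q ^ 4" using False R(1) by (simp add: power_mono)
        also have "\<dots> \<le> 81 * t\<^sup>2" using q4 zero_le_power2[of t] by linarith
        finally show ?thesis .
      qed
    qed
  qed simp
  also have "\<dots> \<le> 2 * sqrt (81 * (2 * m + 1))" using cS m_pos by simp
  finally show ?thesis by simp
qed

text \<open>A fraction determines its exponent in \<open>{-m..m}\<close>, so at most
  \<open>(2 * q + 1)\<^sup>2 \<le> 9 * q\<^sup>2\<close> exponents have height at most
  \<open>q \<ge> 1\<close>, and \<open>sum_inverse_le\<close> applies with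
  \<open>C = 9\<close>.\<close>

lemma sum_height_le:
  assumes R: "R \<ge> 1" "R < P"
  defines "F \<equiv> {e \<in> {-m..m}. height_le e R}"
  shows "(\<Sum>e\<in>F. 1 / real (height e)) \<le> 6 * sqrt (card F)"
proof -
  have finF: "finite F" by (rule finite_subset[of _ "{-m..m}"]) (auto simp: F_def)
  have hv: "height_le e (int (height e)) \<and> int (height e) \<le> R \<and> height e \<ge> 1" if "e \<in> F" for e
    using that height_le_height[of e R] R by (auto simp: F_def)
  have "(\<Sum>e\<in>F. 1 / real (height e)) \<le> 2 * sqrt (9 * real (card F))"
  proof (rule sum_inverse_le[OF finF])
    show "real (height e) > 0" if "e \<in> F" for e using hv[OF that] by simp
    fix t :: real assume t: "t > 0"
    define q where "q = \<lfloor>t\<rfloor>"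
    have q0: "0 \<le> q" using t by (simp add: q_def)
    let ?T = "{e \<in> F. real (height e) \<le> t}"
    have le_q: "int (height e) \<le> q" if "e \<in> ?T" for e using that by (simp add: q_def le_floor_iff)
    show "real (card ?T) \<le> 9 * t\<^sup>2"
    proof (cases "q = 0")
      case True
      have empty: "?T = {}" using le_q hv True by force
      show ?thesis unfolding empty by simp
    next
      case False
      hence q1: "q \<ge> 1" using q0 by simp
      have "\<forall>e\<in>?T. \<exists>x. fst x \<in> {-q..q} \<and> snd x \<in> {-q..q} \<and> snd x \<noteq> 0 \<and> \<bar>snd x\<bar> \<le> R \<and> P dvd snd x * G e - fst x"
      proof
        fix e assume e: "e \<in> ?T"
        hence "height_le e (int (height e))" "int (height e) \<le> R" "int (height e) \<le> q" using hv le_q by auto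
        then obtain r s where "s \<noteq> 0" "\<bar>r\<bar> \<le> q" "\<bar>s\<bar> \<le> q" "\<bar>s\<bar> \<le> R" "P dvd s * G e - r"
          unfolding height_le_def by (meson order_trans)
        thus "\<exists>x. fst x \<in> {-q..q} \<and> snd x \<in> {-q..q} \<and> snd x \<noteq> 0 \<and> \<bar>snd x\<bar> \<le> R \<and> P dvd snd x * G e - fst x"
          by (intro exI[of _ "(r, s)"]) auto
      qed
      then obtain f where f: "\<And>e. e \<in> ?T \<Longrightarrow> fst (f e) \<in> {-q..q} \<and> snd (f e) \<in> {-q..q} \<and> snd (f e) \<noteq> 0 \<and>
          \<bar>snd (f e)\<bar> \<le> R \<and> P dvd snd (f e) * G e - fst (f e)"
        by metis
      have "inj_on f ?T"
      proof (rule inj_onI)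
        fix e e' assume e: "e \<in> ?T" "e' \<in> ?T" "f e = f e'"
        show "e = e'"
        proof (rule ratio_inj)
          show "P dvd snd (f e) * G e - fst (f e)" using f[OF e(1)] by blast
          show "P dvd snd (f e) * G e' - fst (f e)" unfolding e(3) using f[OF e(2)] by blast
          show "\<not> P dvd snd (f e)" using f[OF e(1)] R by (intro not_P_dvd) auto
          show "\<bar>e - e'\<bar> < 3 * m" using e m_pos by (auto simp: F_def)
        qed
      qed
      moreover have "f ` ?T \<subseteq> {-q..q} \<times> {-q..q}"
      proof
        fix x assume "x \<in> f ` ?T"
        then obtain e where "e \<in> ?T" "x = f e" by (rule imageE)
        thus "x \<in> {-q..q} \<times> {-q..q}" using f[of e] by (simp only: mem_Times_iff)
      qed
      ultimately have "card ?T \<le> card ({-q..q} \<times> {-q..q})" by (intro card_inj_on_le) auto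
      hence "card ?T \<le> nat (2 * q + 1) * nat (2 * q + 1)" by (simp add: card_cartesian_product)
      hence "real (card ?T) \<le> real (nat (2 * q + 1) * nat (2 * q + 1))" by (simp only: of_nat_le_iff)
      also have "\<dots> = (2 * real_of_int q + 1)\<^sup>2" using q0 by (simp add: power2_eq_square)
      also have "\<dots> \<le> (3 * t)\<^sup>2"
      proof (rule power_mono)
        have "real_of_int q \<le> t" by (simp add: q_def)
        thus "2 * real_of_int q + 1 \<le> 3 * t" using q1 by linarith
      qed (use q0 in simp)
      finally show ?thesis by (simp add: power_mult_distrib)
    qed
  qed simp
  also have "\<dots> = 6 * sqrt (card F)" by (simp add: real_sqrt_mult)
  finally show ?thesis .
qed

lemma sum_energy_le:
  assumes d: "\<not> height_le d R" and R: "R \<ge> 1" "2 * R ^ 4 < P" "m \<le> R ^ 4" and n: "n \<ge> 1"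
  shows "(\<Sum>e\<in>{-m..m}. real (energy d n e)) \<le>
    (2 * m + 1) * (1 + 24 * 8 ^ 10 * real_of_int n ^ 4 / P + 6 * 8 ^ 6 * real_of_int n ^ 3 / (real_of_int R)\<^sup>2)
    + 512 * (real_of_int n)\<^sup>2 * (2 * sqrt (81 * (2 * m + 1)))
    + 6 * 8 ^ 6 * real_of_int n ^ 3 / R * (6 * sqrt (card {e \<in> {-m..m}. height_le e R}))"
proof -
  have RP: "R < P"
  proof -
    have "R \<le> R ^ 4" using R(1) self_le_power[of R 4] by simp
    thus ?thesis using R by linarith
  qed
  let ?a = "1 + 24 * 8 ^ 10 * real_of_int n ^ 4 / P + 6 * 8 ^ 6 * real_of_int n ^ 3 / (real_of_int R)\<^sup>2"
  let ?S = "\<lambda>e. \<exists>v\<in>lattice_box (kern P (rel_coeff d e)) n. v \<noteq> 0"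
  let ?s = "\<lambda>e. 512 * (real_of_int n)\<^sup>2 * (1 / (real (shortest d e))\<^sup>2)"
  let ?h = "\<lambda>e. 6 * 8 ^ 6 * real_of_int n ^ 3 / R * (1 / real (height e))"
  have "(\<Sum>e\<in>{-m..m}. real (energy d n e)) \<le>
      (\<Sum>e\<in>{-m..m}. ?a + (if ?S e then ?s e else 0) + (if height_le e R then ?h e else 0))"
    by (rule sum_mono) (rule energy_bound[OF d R(1,2) n])
  also have "\<dots> = (\<Sum>e\<in>{-m..m}. ?a) + (\<Sum>e\<in>{-m..m}. if ?S e then ?s e else 0) + (\<Sum>e\<in>{-m..m}. if height_le e R then ?h e else 0)"
    by (simp only: sum.distrib)
  also have "(\<Sum>e\<in>{-m..m}. ?a) = (2 * m + 1) * ?a" using m_pos by simp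
  also have "(\<Sum>e\<in>{-m..m}. if ?S e then ?s e else 0) = (\<Sum>e\<in>{e \<in> {-m..m}. ?S e}. ?s e)"
    by (rule sum.inter_filter[symmetric]) simp
  also have "\<dots> = 512 * (real_of_int n)\<^sup>2 * (\<Sum>e\<in>{e \<in> {-m..m}. ?S e}. 1 / (real (shortest d e))\<^sup>2)"
    by (rule sum_distrib_left[symmetric])
  also have "(\<Sum>e\<in>{-m..m}. if height_le e R then ?h e else 0) = (\<Sum>e\<in>{e \<in> {-m..m}. height_le e R}. ?h e)"
    by (rule sum.inter_filter[symmetric]) simp
  also have "\<dots> = 6 * 8 ^ 6 * real_of_int n ^ 3 / R * (\<Sum>e\<in>{e \<in> {-m..m}. height_le e R}. 1 / real (height e))"
    by (rule sum_distrib_left[symmetric])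
  finally show ?thesis
    by (rule order_trans[OF _ add_mono[OF add_mono[OF order_refl mult_left_mono[OF sum_shortest_le[OF d R(1) RP R(3) n]]]
      mult_left_mono[OF sum_height_le[OF R(1) RP]]]]) (use n R in auto)
qed

section \<open>The set of dilates and the representation of every residue\<close>

definition dilates :: "int \<Rightarrow> int \<Rightarrow> int \<Rightarrow> int set" where
  "dilates d u n = (\<lambda>(z, x, x'). (G z * (x + x' * G d)) mod P) ` ({0..<m} \<times> {u + 1..u + n} \<times> {u + 1..u + n})"

text \<open>By Cauchy-Schwarz it suffices to bound the collisions of triples. Those with first
  components \<open>z\<close> and \<open>z + e\<close> satisfy one linear congruence in the four
  remaining variables. Subtracting a fixed collision \<open>w0\<close> maps them injectively into
  the lattice points counted by \<open>energy d n e\<close>.\<close>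

lemma card_dilates:
  assumes n: "n \<ge> 1"
  shows "(real_of_int m * (real_of_int n)\<^sup>2)\<^sup>2 \<le>
    real (card (dilates d u n)) * (real_of_int m * (\<Sum>e\<in>{-m..m}. real (energy d n e)))"
proof -
  let ?I = "{u + 1..u + n}"
  let ?X = "{0..<m} \<times> ?I \<times> ?I"
  define f where "f = (\<lambda>(z, x, x'). (G z * (x + x' * G d)) mod P)"
  let ?E = "{(x, y). x \<in> ?X \<and> y \<in> ?X \<and> f x = f y}"
  define Fib where "Fib z e = {w \<in> ?E. fst (fst w) = z \<and> fst (snd w) = z + e}" for z e
  have finE: "finite ?E" by (rule finite_subset[of _ "?X \<times> ?X"]) auto
  have fib: "card (Fib z e) \<le> energy d n e" for z e
  proof (cases "Fib z e = {}")
    case True thus ?thesis by simp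
  next
    case False
    have eq: "P dvd (fst (snd (fst w)) + snd (snd (fst w)) * G d) - G e * (fst (snd (snd w)) + snd (snd (snd w)) * G d)"
      if wF: "w \<in> Fib z e" for w
    proof -
      obtain z1 x x' z2 y y' where w': "w = ((z1, x, x'), (z2, y, y'))" by (metis prod.exhaust)
      have w: "w = ((z, x, x'), (z + e, y, y'))" using wF by (auto simp: Fib_def w')
      have "(G z * (x + x' * G d)) mod P = (G (z + e) * (y + y' * G d)) mod P"
        using wF by (auto simp: Fib_def f_def w)
      hence "[G z * (x + x' * G d) = G (z + e) * (y + y' * G d)] (mod P)" by (simp add: cong_def)
      also have "[G (z + e) * (y + y' * G d) = (G z * G e) * (y + y' * G d)] (mod P)"
        by (intro cong_mult G_add cong_refl)
      finally have "P dvd G z * (x + x' * G d) - G z * G e * (y + y' * G d)" by (simp add: cong_iff_dvd_diff)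
      also have "G z * (x + x' * G d) - G z * G e * (y + y' * G d) = G z * ((x + x' * G d) - G e * (y + y' * G d))"
        by (simp add: algebra_simps)
      finally show ?thesis using P_dvd_mult_iff G_unit by (simp add: w)
    qed
    obtain w0 where w0: "w0 \<in> Fib z e" using False by blast
    define h where "h w i = (if i = 1 then fst (snd (fst w)) - fst (snd (fst w0))
        else if i = 2 then snd (snd (fst w)) - snd (snd (fst w0))
        else if i = 3 then fst (snd (snd w)) - fst (snd (snd w0))
        else snd (snd (snd w)) - snd (snd (snd w0)))" for w :: "(int \<times> int \<times> int) \<times> (int \<times> int \<times> int)" and i :: 4
    have "h ` Fib z e \<subseteq> lattice_box (kern P (rel_coeff d e)) n"
    proof (intro subsetI, elim imageE)
      fix a w assume w: "w \<in> Fib z e" and a: "a = h w"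
      have "P dvd ((fst (snd (fst w)) + snd (snd (fst w)) * G d) - G e * (fst (snd (snd w)) + snd (snd (snd w)) * G d))
        - ((fst (snd (fst w0)) + snd (snd (fst w0)) * G d) - G e * (fst (snd (snd w0)) + snd (snd (snd w0)) * G d))"
        by (rule dvd_diff[OF eq[OF w] eq[OF w0]])
      also have "\<dots> = (a 1 + a 2 * G d) - G e * (a 3 + a 4 * G d)"
        by (simp add: a h_def algebra_simps)
      finally have "a \<in> kern P (rel_coeff d e)" by (simp only: mem_kern_rel_coeff)
      moreover have "small n a"
        using w w0 by (auto simp: small_def a h_def Fib_def)
      ultimately show "a \<in> lattice_box (kern P (rel_coeff d e)) n" by (simp add: lattice_box_def)
    qed
    moreover have "inj_on h (Fib z e)"
    proof (rule inj_onI)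
      fix w w' assume w: "w \<in> Fib z e" "w' \<in> Fib z e" "h w = h w'"
      have "h w i = h w' i" for i using w(3) by simp
      from this[of 1] this[of 2] this[of 3] this[of 4] show "w = w'"
        using w(1,2) by (auto simp: h_def Fib_def prod_eq_iff)
    qed
    ultimately show ?thesis unfolding energy_def by (intro card_inj_on_le) auto
  qed
  have "?E \<subseteq> (\<Union>(z, e)\<in>{0..<m} \<times> {-m..m}. Fib z e)"
  proof
    fix w assume w: "w \<in> ?E"
    have "fst (fst w) \<in> {0..<m}" "fst (snd w) \<in> {0..<m}" using w by auto
    hence "(fst (fst w), fst (snd w) - fst (fst w)) \<in> {0..<m} \<times> {-m..m}" by auto
    moreover have "w \<in> Fib (fst (fst w)) (fst (snd w) - fst (fst w))" using w by (simp add: Fib_def)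
    ultimately show "w \<in> (\<Union>(z, e)\<in>{0..<m} \<times> {-m..m}. Fib z e)" by blast
  qed
  hence "card ?E \<le> card (\<Union>(z, e)\<in>{0..<m} \<times> {-m..m}. Fib z e)"
    by (rule card_mono[rotated]) (auto intro!: finite_subset[OF _ finE] simp: Fib_def)
  also have "\<dots> \<le> (\<Sum>x\<in>{0..<m} \<times> {-m..m}. card ((\<lambda>(z, e). Fib z e) x))"
    by (rule card_UN_le) simp
  also have "\<dots> \<le> (\<Sum>x\<in>{0..<m} \<times> {-m..m}. energy d n (snd x))"
    by (rule sum_mono) (use fib in auto)
  also have "\<dots> = (\<Sum>z\<in>{0..<m}. \<Sum>e\<in>{-m..m}. energy d n e)"
    by (subst sum.cartesian_product) (auto intro: sum.cong)
  also have "\<dots> = nat m * (\<Sum>e\<in>{-m..m}. energy d n e)" by simp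
  finally have E: "card ?E \<le> nat m * (\<Sum>e\<in>{-m..m}. energy d n e)" .
  have "(card ?X)\<^sup>2 \<le> card (f ` ?X) * card ?E" by (rule card_image_energy) simp
  also have "\<dots> \<le> card (f ` ?X) * (nat m * (\<Sum>e\<in>{-m..m}. energy d n e))" using E by (rule mult_le_mono2)
  finally have "real ((card ?X)\<^sup>2) \<le> real (card (f ` ?X) * (nat m * (\<Sum>e\<in>{-m..m}. energy d n e)))"
    by (simp only: of_nat_le_iff)
  moreover have "real (card ?X) = real_of_int m * (real_of_int n)\<^sup>2"
    using n m_pos by (simp add: card_cartesian_product power2_eq_square)
  moreover have "f ` ?X = dilates d u n" by (simp add: dilates_def f_def)
  ultimately show ?thesis using m_pos by simp
qed

lemma G_add_add: "[G (a + b + c) = G a * G b * G c] (mod P)"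
  using cong_trans[OF G_add[of "a + b" c] cong_mult[OF G_add[of a b] cong_refl[of "G c"]]] .

text \<open>The assumption \<open>small\<close> leaves some \<open>d < m\<close> for which
  \<open>G d\<close> is not a small fraction; \<open>large\<close> turns the energy bound into
  \<open>card A * m \<ge> 2 * P\<close> for the set \<open>A\<close> of dilates, as required for
  eight products. Expanding the products gives the exponents \<open>z + y\<close> and
  \<open>z + d + y\<close>, which lie in \<open>{v + 1..v + 3 * m}\<close>.\<close>

lemma representation:
  fixes R n l u v :: int and D :: nat
  assumes R: "R \<ge> 1" "2 * R ^ 4 < P" "m \<le> R ^ 4" and n: "n \<ge> 1"
    and D: "\<And>k :: nat. 0 < k \<Longrightarrow> int k \<le> R\<^sup>2 \<Longrightarrow> card {d. d dvd k} \<le> D"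
    and small: "sqrt (2 * (4 * m + 1)) * D ^ 3 < m"
    and large: "2 * P * ((2 * m + 1) * (1 + 24 * 8 ^ 10 * real_of_int n ^ 4 / P + 6 * 8 ^ 6 * real_of_int n ^ 3 / (real_of_int R)\<^sup>2)
      + 512 * (real_of_int n)\<^sup>2 * (2 * sqrt (81 * (2 * m + 1)))
      + 6 * 8 ^ 6 * real_of_int n ^ 3 / R * (6 * sqrt (sqrt (2 * (4 * m + 1)) * D ^ 3))) \<le> (real_of_int m)\<^sup>2 * real_of_int n ^ 4"
  shows "\<exists>x y :: nat \<Rightarrow> int. (\<forall>i\<in>{1..16}. x i \<in> {u + 1..u + n} \<and> y i \<in> {v + 1..v + 3 * m}) \<and>
    [(\<Sum>i = 1..16. x i * G (y i)) = l] (mod P)"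
proof -
  have P0: "P > 0" using P_gt by simp
  let ?F = "{e \<in> {-m..m}. height_le e R}"
  have cF: "real (card ?F) \<le> sqrt (2 * (4 * m + 1)) * D ^ 3"
    by (rule card_small_height[OF _ _ R(1,2) D]) auto
  have "\<exists>d\<in>{0..<m}. \<not> height_le d R"
  proof (rule ccontr)
    assume "\<not> ?thesis"
    hence "{0..<m} \<subseteq> ?F" by auto
    hence "card {0..<m} \<le> card ?F" by (rule card_mono[rotated]) (rule finite_subset[of _ "{-m..m}"], auto)
    hence "real_of_int m \<le> real (card ?F)" using m_pos by simp
    thus False using cF small by linarith
  qed
  then obtain d where d: "d \<in> {0..<m}" "\<not> height_le d R" by blast
  define \<Sigma> where "\<Sigma> = (\<Sum>e\<in>{-m..m}. real (energy d n e))"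
  have "6 * 8 ^ 6 * real_of_int n ^ 3 / R * (6 * sqrt (card ?F)) \<le>
      6 * 8 ^ 6 * real_of_int n ^ 3 / R * (6 * sqrt (sqrt (2 * (4 * m + 1)) * D ^ 3))"
    using n R cF by (intro mult_left_mono) auto
  hence "\<Sigma> \<le> (2 * m + 1) * (1 + 24 * 8 ^ 10 * real_of_int n ^ 4 / P + 6 * 8 ^ 6 * real_of_int n ^ 3 / (real_of_int R)\<^sup>2)
      + 512 * (real_of_int n)\<^sup>2 * (2 * sqrt (81 * (2 * m + 1)))
      + 6 * 8 ^ 6 * real_of_int n ^ 3 / R * (6 * sqrt (sqrt (2 * (4 * m + 1)) * D ^ 3))"
    using sum_energy_le[OF d(2) R n] unfolding \<Sigma>_def by linarith
  hence "2 * P * \<Sigma> \<le> (real_of_int m)\<^sup>2 * real_of_int n ^ 4"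
    using large P0 by (meson mult_left_mono order_trans of_int_0_le_iff mult_nonneg_nonneg less_imp_le zero_le_numeral)
  hence big: "m * (2 * P * \<Sigma>) \<le> m * ((real_of_int m)\<^sup>2 * real_of_int n ^ 4)"
    using m_pos by (intro mult_left_mono) auto
  let ?A = "dilates d u n"
  have "(real_of_int m * (real_of_int n)\<^sup>2)\<^sup>2 \<le> real (card ?A) * (real_of_int m * \<Sigma>)"
    unfolding \<Sigma>_def by (rule card_dilates[OF n])
  hence "m * ((real_of_int m)\<^sup>2 * real_of_int n ^ 4) \<le> m * (real (card ?A) * (real_of_int m * \<Sigma>))"
    using m_pos by (intro mult_left_mono) (auto simp: power_mult_distrib)
  hence "(m * \<Sigma>) * (2 * real_of_int P) \<le> (m * \<Sigma>) * (real (card ?A) * m)" using big by (simp add: algebra_simps)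
  moreover have "m * \<Sigma> > 0"
  proof -
    have "(real_of_int m * (real_of_int n)\<^sup>2)\<^sup>2 > 0" using m_pos n by simp
    hence "real (card ?A) * (real_of_int m * \<Sigma>) > 0"
      using card_dilates[OF n, of d u] unfolding \<Sigma>_def[symmetric] by linarith
    thus ?thesis by (simp add: zero_less_mult_iff)
  qed
  ultimately have "2 * real_of_int P \<le> real (card ?A) * m" by (rule mult_left_le_imp_le)
  hence "real_of_int (2 * P) \<le> real_of_int (int (card ?A) * m)" by simp
  hence Am: "2 * P \<le> int (card ?A) * m" by (simp only: of_int_le_iff)
  let ?B = "(\<lambda>y. G y mod P) ` {v + 1..v + m}"
  have "inj_on (\<lambda>y. G y mod P) {v + 1..v + m}"
  proof (rule inj_onI)
    fix a b assume "a \<in> {v + 1..v + m}" "b \<in> {v + 1..v + m}" "G a mod P = G b mod P"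
    thus "a = b" by (intro G_inj) (auto simp: mod_eq_dvd_iff)
  qed
  hence cB: "card ?B = nat m" by (simp add: card_image)
  have AB: "2 * P \<le> card ?A * card ?B" using Am m_pos by (simp add: cB)
  have A: "?A \<subseteq> {0..<P}" using P0 by (auto simp: dilates_def)
  have B: "?B \<subseteq> {0..<P}" using P0 by auto
  \<comment> \<open>If \<open>G y \<equiv> - G y'\<close>, then squaring gives
    \<open>G (2 * y) \<equiv> G (2 * y')\<close>. These exponents differ by less than
    \<open>2 * m\<close>, so \<open>y = y'\<close>, and \<open>2 * G y \<equiv> 0\<close>
    contradicts that \<open>P\<close> is odd.\<close>
  have anti: "\<not> P dvd b + b'" if bb: "b \<in> ?B" "b' \<in> ?B" for b b'
  proof
    assume "P dvd b + b'"
    obtain y y' where y: "b = G y mod P" "b' = G y' mod P" "y \<in> {v + 1..v + m}" "y' \<in> {v + 1..v + m}" using bb by blast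
    have s: "P dvd G y + G y'" using \<open>P dvd b + b'\<close> by (simp add: y mod_add_eq dvd_eq_mod_eq_0)
    have "P dvd (G y + G y') * (G y - G y')" using s by simp
    hence "[G y * G y = G y' * G y'] (mod P)" by (simp add: cong_iff_dvd_diff algebra_simps)
    hence "[G (y + y) = G (y' + y')] (mod P)"
      using G_add[of y y] G_add[of y' y'] by (meson cong_sym cong_trans)
    hence "P dvd G (y + y) - G (y' + y')" by (simp add: cong_iff_dvd_diff)
    hence "y + y = y' + y'" using y by (intro G_inj) auto
    hence "P dvd 2 * G y" using s by simp
    hence "P dvd 2 \<or> P dvd G y" by (simp only: P_dvd_mult_iff)
    thus False using G_unit not_P_dvd[of 2] P_gt by auto
  qed
  obtain a b :: "nat \<Rightarrow> int" where ab: "\<And>i. i < 8 \<Longrightarrow> a i \<in> ?A" "\<And>i. i < 8 \<Longrightarrow> b i \<in> ?B" "[(\<Sum>i<8. a i * b i) = l] (mod P)"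
    by (rule eight_products_cover[OF prime_P P_gt A B AB anti, of l]) blast+
  have "\<exists>x x' z y. i < 8 \<longrightarrow> x \<in> {u + 1..u + n} \<and> x' \<in> {u + 1..u + n} \<and> z \<in> {0..<m} \<and> y \<in> {v + 1..v + m} \<and>
     a i = (G z * (x + x' * G d)) mod P \<and> b i = G y mod P" for i :: nat
  proof (cases "i < 8")
    case True
    obtain z x x' where "a i = (G z * (x + x' * G d)) mod P" "z \<in> {0..<m}" "x \<in> {u + 1..u + n}" "x' \<in> {u + 1..u + n}"
      using ab(1)[OF True] by (auto simp: dilates_def)
    moreover obtain y where "b i = G y mod P" "y \<in> {v + 1..v + m}" using ab(2)[OF True] by blast
    ultimately show ?thesis by blast
  qed simp
  then obtain x x' z y where xy: "\<And>i :: nat. i < 8 \<Longrightarrow> x i \<in> {u + 1..u + n} \<and> x' i \<in> {u + 1..u + n} \<and> z i \<in> {0..<m} \<and>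
     y i \<in> {v + 1..v + m} \<and> a i = (G (z i) * (x i + x' i * G d)) mod P \<and> b i = G (y i) mod P"
    by metis
  \<comment> \<open>Each of the eight products splits into two terms: indices 1 to 8 take the part
    with \<open>x\<close>, indices 9 to 16 the part with \<open>x'\<close> and the shift
    \<open>d\<close>.\<close>
  define X where "X j = (if j \<le> 8 then x (j - 1) else x' (j - 9))" for j :: nat
  define Y where "Y j = (if j \<le> 8 then z (j - 1) + y (j - 1) else z (j - 9) + d + y (j - 9))" for j :: nat
  have term_eq: "[a i * b i = x i * G (z i + y i) + x' i * G (z i + d + y i)] (mod P)" if i: "i < 8" for i
  proof -
    have "[a i * b i = (G (z i) * (x i + x' i * G d)) * G (y i)] (mod P)"
      using xy[OF i] by (auto simp: cong_def mod_simps)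
    also have "(G (z i) * (x i + x' i * G d)) * G (y i) = x i * (G (z i) * G (y i)) + x' i * (G (z i) * G d * G (y i))"
      by (simp add: algebra_simps)
    also have "[\<dots> = x i * G (z i + y i) + x' i * G (z i + d + y i)] (mod P)"
      by (intro cong_add cong_mult cong_refl cong_sym[OF G_add] cong_sym[OF G_add_add])
    finally show ?thesis .
  qed
  have split: "(\<Sum>i = 1..16. f i) = (\<Sum>i<8. f (i + 1) + f (i + 9))" for f :: "nat \<Rightarrow> int"
    by (simp add: numeral_eq_Suc)
  have "(\<Sum>i = 1..16. X i * G (Y i)) = (\<Sum>i<8. x i * G (z i + y i) + x' i * G (z i + d + y i))"
    unfolding split by (rule sum.cong) (auto simp: X_def Y_def)
  moreover have "[(\<Sum>i<8. x i * G (z i + y i) + x' i * G (z i + d + y i)) = (\<Sum>i<8. a i * b i)] (mod P)"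
    by (rule cong_sum) (use term_eq cong_sym in auto)
  ultimately have "[(\<Sum>i = 1..16. X i * G (Y i)) = l] (mod P)" using ab(3) cong_trans by metis
  moreover have "X i \<in> {u + 1..u + n} \<and> Y i \<in> {v + 1..v + 3 * m}" if "i \<in> {1..16}" for i
  proof (cases "i \<le> 8")
    case True
    hence "i - 1 < 8" using that by auto
    from xy[OF this] show ?thesis using True by (auto simp: X_def Y_def)
  next
    case False
    hence "i - 9 < 8" using that by auto
    from xy[OF this] show ?thesis using False d(1) by (auto simp: X_def Y_def)
  qed
  ultimately show ?thesis by blast
qed

end

section \<open>Powers modulo a prime and the choice of parameters\<close>

text \<open>Multiplication by a high power of \<open>g\<close> moves the exponent into the
  nonnegative range. Identities between ordinary powers then transfer to integer exponents by
  cancelling that power, with no further distinction of signs.\<close>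

lemma powi_mod_shift:
  assumes "coprime g p" "0 \<le> a + int k"
  shows "[powi_mod p g a * g ^ k = g ^ nat (a + int k)] (mod p)"
proof (cases "a \<ge> 0")
  case True
  thus ?thesis by (simp add: powi_mod_def power_add[symmetric] nat_add_distrib)
next
  case False
  define j where "j = nat (a + int k)"
  have k: "k = nat (- a) + j" using assms(2) False by (simp add: j_def)
  have "[powi_mod p g (- (- a)) * g ^ nat (- a) = 1] (mod p)"
    by (rule powi_mod_inverse[OF assms(1)]) (use False in simp)
  hence "[powi_mod p g a * g ^ nat (- a) * g ^ j = 1 * g ^ j] (mod p)" by (intro cong_mult cong_refl) simp
  thus ?thesis unfolding j_def[symmetric] by (simp add: k power_add mult.assoc)
qed

lemma powi_mod_add:
  assumes "coprime g p"
  shows "[powi_mod p g (a + b) = powi_mod p g a * powi_mod p g b] (mod p)"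
proof -
  define k l where "k = nat \<bar>a\<bar>" and "l = nat \<bar>b\<bar>"
  have kl: "0 \<le> a + int k" "0 \<le> b + int l" by (auto simp: k_def l_def)
  have "[powi_mod p g (a + b) * g ^ (k + l) = g ^ nat (a + b + int (k + l))] (mod p)"
    by (rule powi_mod_shift[OF assms]) (use kl in simp)
  also have "nat (a + b + int (k + l)) = nat (a + int k) + nat (b + int l)" using kl by (simp add: nat_add_distrib[symmetric])
  also have "g ^ \<dots> = g ^ nat (a + int k) * g ^ nat (b + int l)" by (rule power_add)
  also have "[\<dots> = (powi_mod p g a * g ^ k) * (powi_mod p g b * g ^ l)] (mod p)"
    by (intro cong_mult cong_sym[OF powi_mod_shift[OF assms]] kl)
  also have "(powi_mod p g a * g ^ k) * (powi_mod p g b * g ^ l) = (powi_mod p g a * powi_mod p g b) * g ^ (k + l)"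
    by (simp add: power_add)
  finally show ?thesis using assms by (simp add: cong_mult_rcancel)
qed

text \<open>Two congruent powers with distinct exponents give, after cancellation, a positive
  exponent with power 1. It is at least the order of \<open>g\<close>, hence at least
  \<open>3 * m\<close>.\<close>

lemma geometric_residues_powi_mod:
  assumes p: "prime p" "p > 3" and g: "coprime g (int p)" and m: "1 \<le> m" "3 * m \<le> int (ord (int p) g)"
  shows "geometric_residues (int p) (powi_mod (int p) g) m"
proof
  show "prime (int p)" "int p > 3" "m \<ge> 1" using p m by simp_all
  fix a b
  show "[powi_mod (int p) g (a + b) = powi_mod (int p) g a * powi_mod (int p) g b] (mod int p)"
    by (rule powi_mod_add[OF g])
  define k where "k = nat (\<bar>a\<bar> + \<bar>b\<bar>)"
  have k: "0 \<le> a + int k" "0 \<le> b + int k" by (auto simp: k_def)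
  have sh: "[powi_mod (int p) g a * g ^ k = g ^ nat (a + int k)] (mod int p)"
    "[powi_mod (int p) g b * g ^ k = g ^ nat (b + int k)] (mod int p)"
    using powi_mod_shift[OF g] k by auto
  have ndvd: "\<not> int p dvd g ^ i" for i
  proof
    assume "int p dvd g ^ i"
    moreover have "coprime (g ^ i) (int p)" using g by simp
    ultimately have "is_unit (int p)" by (metis coprime_common_divisor dvd_refl)
    thus False using p by simp
  qed
  show "\<not> int p dvd powi_mod (int p) g a"
  proof
    assume "int p dvd powi_mod (int p) g a"
    hence "int p dvd powi_mod (int p) g a * g ^ k" by simp
    hence "int p dvd g ^ nat (a + int k)" using sh(1) cong_dvd_iff by blast
    thus False using ndvd by blast
  qed
  assume ab: "\<bar>a - b\<bar> < 3 * m" "int p dvd powi_mod (int p) g a - powi_mod (int p) g b"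
  have "[powi_mod (int p) g a * g ^ k = powi_mod (int p) g b * g ^ k] (mod int p)"
    using ab(2) by (intro cong_mult cong_refl) (simp add: cong_iff_dvd_diff)
  hence eq: "[g ^ nat (a + int k) = g ^ nat (b + int k)] (mod int p)"
    using sh cong_trans cong_sym by meson
  have less: "ord (int p) g \<le> j - i" if ij: "[g ^ i = g ^ j] (mod int p)" "i < j" for i j :: nat
  proof (rule ccontr)
    assume lt: "\<not> ?thesis"
    have "[g ^ i * 1 = g ^ i * g ^ (j - i)] (mod int p)" using ij by (simp add: power_add[symmetric])
    moreover have "coprime (g ^ i) (int p)" using g by simp
    ultimately have "[g ^ (j - i) = 1] (mod int p)" using cong_mult_lcancel cong_sym by blast
    moreover have "ord (int p) g = (LEAST d. d > 0 \<and> [g ^ d = 1] (mod int p))"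
      using g by (simp add: ord_def coprime_commute)
    ultimately show False using lt ij(2) not_less_Least[of "j - i" "\<lambda>d. d > 0 \<and> [g ^ d = 1] (mod int p)"] by simp
  qed
  show "a = b"
  proof (rule linorder_cases[of a b])
    assume "a < b"
    hence "ord (int p) g \<le> nat (b + int k) - nat (a + int k)" using k by (intro less[OF eq]) auto
    thus ?thesis using ab(1) m(2) k \<open>a < b\<close> by linarith
  next
    assume "b < a"
    hence "ord (int p) g \<le> nat (a + int k) - nat (b + int k)" using k by (intro less[OF cong_sym[OF eq]]) auto
    thus ?thesis using ab(1) m(2) k \<open>b < a\<close> by linarith
  qed
qed

text \<open>All three terms of the energy bound are at most a constant times \<open>E\<close>: the
  first two are of order \<open>n powr (5 / 2)\<close>, and the third gets
  \<open>n powr (9 / 4)\<close> from \<open>n ^ 3 / R\<close> and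
  \<open>n powr (1 / 4 + \<epsilon> / 2)\<close> from \<open>sqrt s\<close>. As the right-hand side
  is at least \<open>n ^ 6 / 16\<close>, it remains to bound \<open>P\<close> by a small multiple of
  \<open>n powr (7 / 2 - \<epsilon> / 2)\<close>, which is the source of the exponent 2/7.\<close>

lemma energy_term_le:
  fixes n m R P s K \<epsilon> :: real
  assumes n: "n \<ge> 12" and m: "n / 4 \<le> m" "m \<le> n / 3" and R: "n powr (3 / 4) \<le> R" and P: "n ^ 3 \<le> P"
    and s: "0 \<le> s" "s \<le> 2 * K * n powr (1 / 2 + \<epsilon>)" and K: "K \<ge> 0" and \<epsilon>: "\<epsilon> \<ge> 0"
    and big: "32 * (1 + 24 * 8 ^ 10 + 6 * 8 ^ 6 + 9216 + 36 * 8 ^ 6 * sqrt (2 * K)) * P \<le> n powr (7 / 2 - \<epsilon> / 2)"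
  shows "2 * P * ((2 * m + 1) * (1 + 24 * 8 ^ 10 * n ^ 4 / P + 6 * 8 ^ 6 * n ^ 3 / R\<^sup>2)
      + 512 * n\<^sup>2 * (2 * sqrt (81 * (2 * m + 1))) + 6 * 8 ^ 6 * n ^ 3 / R * (6 * sqrt s)) \<le> m\<^sup>2 * n ^ 4"
proof -
  define E where "E = n powr (5 / 2 + \<epsilon> / 2)"
  have n0: "n > 0" and n1: "n \<ge> 1" using n by auto
  have E: "n powr (5 / 2) \<le> E" unfolding E_def using n1 \<epsilon> by (intro powr_mono) auto
  have Q: "n powr (3 / 4) > 0" using n0 by simp
  have R0: "R > 0" using R Q by linarith
  have P0: "P > 0" using P n0 by (meson less_le_trans zero_less_power)
  have m2: "2 * m + 1 \<le> n" using m n by linarith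
  have m0: "m \<ge> 0" using m n by linarith
  have half: "1 \<le> n powr (3 / 2)" "n \<le> n powr (3 / 2)"
    using n1 powr_mono[of 0 "3 / 2" n] powr_mono[of 1 "3 / 2" n] by auto
  have a: "n ^ 4 / P \<le> n powr (3 / 2)"
  proof -
    have "n ^ 4 / P \<le> n ^ 4 / n ^ 3" using P n0 P0 by (intro divide_left_mono) auto
    also have "\<dots> = n" using n0 by (simp add: power4_eq_xxxx power3_eq_cube)
    finally show ?thesis using half by linarith
  qed
  have b: "n ^ 3 / R\<^sup>2 \<le> n powr (3 / 2)"
  proof -
    have "(n powr (3 / 4))\<^sup>2 \<le> R\<^sup>2" using R by (intro power_mono) auto
    hence "n ^ 3 / R\<^sup>2 \<le> n ^ 3 / (n powr (3 / 4))\<^sup>2" using n0 R0 by (intro divide_left_mono) auto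
    also have "\<dots> = n powr 3 / n powr (3 / 2)" using n0 by (simp add: powr_power)
    also have "\<dots> = n powr (3 / 2)" by (simp add: powr_diff[symmetric])
    finally show ?thesis .
  qed
  have T1: "(2 * m + 1) * (1 + 24 * 8 ^ 10 * n ^ 4 / P + 6 * 8 ^ 6 * n ^ 3 / R\<^sup>2) \<le> (1 + 24 * 8 ^ 10 + 6 * 8 ^ 6) * E"
  proof -
    have "1 + 24 * 8 ^ 10 * n ^ 4 / P + 6 * 8 ^ 6 * n ^ 3 / R\<^sup>2 = 1 + 24 * 8 ^ 10 * (n ^ 4 / P) + 6 * 8 ^ 6 * (n ^ 3 / R\<^sup>2)" by simp
    also have "\<dots> \<le> (1 + 24 * 8 ^ 10 + 6 * 8 ^ 6) * n powr (3 / 2)"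
      using a b half by (simp add: distrib_right)
    finally have "(2 * m + 1) * (1 + 24 * 8 ^ 10 * n ^ 4 / P + 6 * 8 ^ 6 * n ^ 3 / R\<^sup>2)
        \<le> n * ((1 + 24 * 8 ^ 10 + 6 * 8 ^ 6) * n powr (3 / 2))"
      using m2 m0 n0 P0 R0 by (intro mult_mono) auto
    also have "\<dots> = (1 + 24 * 8 ^ 10 + 6 * 8 ^ 6) * (n powr 1 * n powr (3 / 2))" using n0 by simp
    also have "n powr 1 * n powr (3 / 2) = n powr (5 / 2)" unfolding powr_add[symmetric] by simp
    also have "(1 + 24 * 8 ^ 10 + 6 * 8 ^ 6) * n powr (5 / 2) \<le> (1 + 24 * 8 ^ 10 + 6 * 8 ^ 6) * E"
      using E by (intro mult_left_mono) auto
    finally show ?thesis .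
  qed
  have T2: "512 * n\<^sup>2 * (2 * sqrt (81 * (2 * m + 1))) \<le> 9216 * E"
  proof -
    have "sqrt (81 * (2 * m + 1)) \<le> sqrt (81 * n)" using m2 by simp
    also have "\<dots> = 9 * n powr (1 / 2)" using n0 by (simp add: real_sqrt_mult powr_half_sqrt)
    finally have "512 * n\<^sup>2 * (2 * sqrt (81 * (2 * m + 1))) \<le> 512 * n\<^sup>2 * (2 * (9 * n powr (1 / 2)))"
      by (intro mult_left_mono) auto
    also have "\<dots> = 9216 * (n powr 2 * n powr (1 / 2))" using n0 by simp
    also have "n powr 2 * n powr (1 / 2) = n powr (5 / 2)" unfolding powr_add[symmetric] by simp
    finally show ?thesis using E by linarith
  qed
  have T3: "6 * 8 ^ 6 * n ^ 3 / R * (6 * sqrt s) \<le> 36 * 8 ^ 6 * sqrt (2 * K) * E"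
  proof -
    have "sqrt s \<le> sqrt (2 * K * n powr (1 / 2 + \<epsilon>))" using s by simp
    also have "\<dots> = sqrt (2 * K) * n powr ((1 / 2 + \<epsilon>) / 2)"
      by (simp add: real_sqrt_mult powr_half_sqrt[symmetric] powr_powr)
    finally have ss: "sqrt s \<le> sqrt (2 * K) * n powr ((1 / 2 + \<epsilon>) / 2)" .
    have "6 * 8 ^ 6 * n ^ 3 / R * (6 * sqrt s) \<le> 6 * 8 ^ 6 * n ^ 3 / n powr (3 / 4) * (6 * (sqrt (2 * K) * n powr ((1 / 2 + \<epsilon>) / 2)))"
      using ss R Q R0 n0 s by (intro mult_mono divide_left_mono) auto
    also have "\<dots> = 36 * 8 ^ 6 * sqrt (2 * K) * (n powr 3 / n powr (3 / 4) * n powr ((1 / 2 + \<epsilon>) / 2))"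
      using n0 by simp
    also have "n powr 3 / n powr (3 / 4) * n powr ((1 / 2 + \<epsilon>) / 2) = n powr (3 - 3 / 4 + (1 / 2 + \<epsilon>) / 2)"
      by (simp only: powr_diff powr_add)
    also have "3 - 3 / 4 + (1 / 2 + \<epsilon>) / 2 = 5 / 2 + \<epsilon> / 2" by (simp add: field_simps)
    finally show ?thesis by (simp add: E_def)
  qed
  let ?C = "1 + 24 * 8 ^ 10 + 6 * 8 ^ 6 + 9216 + 36 * 8 ^ 6 * sqrt (2 * K)"
  have "(2 * m + 1) * (1 + 24 * 8 ^ 10 * n ^ 4 / P + 6 * 8 ^ 6 * n ^ 3 / R\<^sup>2)
      + 512 * n\<^sup>2 * (2 * sqrt (81 * (2 * m + 1))) + 6 * 8 ^ 6 * n ^ 3 / R * (6 * sqrt s) \<le> ?C * E"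
    using T1 T2 T3 by (simp add: distrib_right)
  hence "2 * P * ((2 * m + 1) * (1 + 24 * 8 ^ 10 * n ^ 4 / P + 6 * 8 ^ 6 * n ^ 3 / R\<^sup>2)
      + 512 * n\<^sup>2 * (2 * sqrt (81 * (2 * m + 1))) + 6 * 8 ^ 6 * n ^ 3 / R * (6 * sqrt s)) \<le> 2 * P * (?C * E)"
    using P0 by (intro mult_left_mono) auto
  also have "\<dots> = (32 * ?C * P) * (E / 16)" by simp
  also have "\<dots> \<le> n powr (7 / 2 - \<epsilon> / 2) * (E / 16)" using big by (rule mult_right_mono) (simp add: E_def)
  also have "\<dots> = (n powr (7 / 2 - \<epsilon> / 2) * E) / 16" by simp
  also have "n powr (7 / 2 - \<epsilon> / 2) * E = n powr 6" unfolding E_def powr_add[symmetric] by simp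
  also have "n powr 6 / 16 = (n / 4)\<^sup>2 * n ^ 4" using n0 by (simp add: power_divide power_add[symmetric])
  also have "\<dots> \<le> m\<^sup>2 * n ^ 4" using m n0 by (intro mult_right_mono power_mono) auto
  finally show ?thesis .
qed

text \<open>The parameters are \<open>m = n div 3\<close> and \<open>R\<close> about
  \<open>n powr (3 / 4)\<close>, so that \<open>R ^ 4\<close> is at most \<open>16 * n ^ 3\<close>.
  The bound \<open>\<epsilon> \<le> 1 / 100\<close> gives
  \<open>3 * (2 / 7 + \<epsilon>) \<le> 9 / 10\<close>, hence \<open>2 * R ^ 4 < p\<close>, and it
  also gives \<open>1 + 3 * \<epsilon> \<le> (2 / 7 + \<epsilon>) * (7 / 2 - \<epsilon> /
  2)\<close>.\<close>

lemma representation_large_prime: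
  fixes \<epsilon> :: real
  assumes \<epsilon>: "0 < \<epsilon>" "\<epsilon> \<le> 1 / 100"
  obtains p0 :: nat where "\<And>(p :: nat) g u v l n. p \<ge> p0 \<Longrightarrow> prime p \<Longrightarrow> coprime g (int p) \<Longrightarrow>
    n = \<lfloor>real p powr (2 / 7 + \<epsilon>)\<rfloor> \<Longrightarrow> n \<le> int (ord (int p) g) \<Longrightarrow>
    \<exists>x y :: nat \<Rightarrow> int. (\<forall>i\<in>{1..16}. x i \<in> {u + 1..u + n} \<and> y i \<in> {v + 1..v + n}) \<and>
    [(\<Sum>i = 1..16. x i * powi_mod (int p) g (y i)) = l] (mod int p)"
proof -
  \<comment> \<open>With exponent \<open>\<epsilon> / 6\<close>, the cube of the divisor bound for
    numbers up to \<open>R\<^sup>2\<close> is a constant times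
    \<open>R powr \<epsilon>\<close>.\<close>
  obtain C where C: "C > 0" "\<And>n :: nat. n > 0 \<Longrightarrow> real (card {d. d dvd n}) \<le> C * real n powr (\<epsilon> / 6)"
    using divisor_bound[of "\<epsilon> / 6"] \<epsilon> by auto
  define K where "K = 2 * C ^ 3"
  define C3 where "C3 = 1 + 24 * 8 ^ 10 + 6 * 8 ^ 6 + 9216 + 36 * 8 ^ 6 * sqrt (2 * K)"
  have K0: "K > 0" using C by (simp add: K_def)
  have C30: "C3 > 0" unfolding C3_def using K0 by (intro add_pos_nonneg) auto
  have big_powr: "eventually (\<lambda>p. A \<le> real p powr \<theta>) sequentially" if "\<theta> > 0" for A \<theta> :: real
  proof (rule eventually_sequentiallyI)
    fix p :: nat assume "nat \<lceil>(max 1 A) powr (1 / \<theta>)\<rceil> \<le> p"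
    hence "(max 1 A) powr (1 / \<theta>) \<le> real p" by linarith
    hence "((max 1 A) powr (1 / \<theta>)) powr \<theta> \<le> real p powr \<theta>" using that by (intro powr_mono2) auto
    moreover have "((max 1 A) powr (1 / \<theta>)) powr \<theta> = max 1 A" using that by (simp add: powr_powr)
    ultimately show "A \<le> real p powr \<theta>" by simp
  qed
  \<comment> \<open>The factor 512 is \<open>32 * 2 ^ 4\<close>, the power of 2 paying for
    \<open>N \<ge> t / 2\<close>. The fourth power of \<open>8 * K + 1\<close> ensures
    \<open>s < m\<close>, the summand 14 ensures \<open>N \<ge> 13\<close>, and 33 yields the strict
    inequality \<open>32 * N ^ 3 < p\<close>.\<close>
  have "eventually (\<lambda>p. 4 \<le> p \<and> 512 * C3 \<le> real p powr (3 * \<epsilon>) \<and> (8 * K + 1) ^ 4 + 14 \<le> real p powr (2 / 7)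
      \<and> 33 \<le> real p powr (1 / 10)) sequentially"
    using \<epsilon> by (intro eventually_conj eventually_ge_at_top big_powr) auto
  then obtain p0 where p0: "\<And>p. p \<ge> p0 \<Longrightarrow> 4 \<le> p \<and> 512 * C3 \<le> real p powr (3 * \<epsilon>) \<and>
      (8 * K + 1) ^ 4 + 14 \<le> real p powr (2 / 7) \<and> 33 \<le> real p powr (1 / 10)"
    by (auto simp: eventually_at_top_linorder)
  show ?thesis
  proof (rule that[of p0])
    fix p :: nat and g u v l n :: int
    assume pp: "p \<ge> p0" "prime p" and g: "coprime g (int p)" and n: "n = \<lfloor>real p powr (2 / 7 + \<epsilon>)\<rfloor>"
      and nT: "n \<le> int (ord (int p) g)"
    define t where "t = real p powr (2 / 7 + \<epsilon>)"
    have p4: "p \<ge> 4" and c1: "512 * C3 \<le> real p powr (3 * \<epsilon>)"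
      and c2: "(8 * K + 1) ^ 4 + 14 \<le> real p powr (2 / 7)" and c3: "33 \<le> real p powr (1 / 10)"
      using p0[OF pp(1)] by auto
    have p1: "real p \<ge> 1" using p4 by simp
    have t1: "real p powr (2 / 7) \<le> t" unfolding t_def using p1 \<epsilon> by (intro powr_mono) auto
    have nt: "real_of_int n \<le> t" "t - 1 \<le> real_of_int n" using n by (simp_all add: t_def)
    have nK: "(8 * K + 1) ^ 4 + 13 \<le> real_of_int n" using nt t1 c2 by linarith
    have "(8 * K + 1) ^ 4 > 0" using K0 by simp
    hence n13: "real_of_int n \<ge> 13" using nK by linarith
    have half: "t / 2 \<le> real_of_int n" using nt n13 by linarith
    define N where "N = real_of_int n"
    have N: "N \<ge> 13" "N \<le> t" "t / 2 \<le> N" using n13 nt half by (auto simp: N_def)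
    define m where "m = n div 3"
    have m3: "3 * m \<le> n" "n < 3 * m + 3" by (auto simp: m_def)
    have m_bounds: "N / 4 \<le> m" "m \<le> N / 3" using m3 n13 unfolding N_def by linarith+
    have m1: "m \<ge> 1" using m3 n13 by linarith
    define R where "R = \<lceil>N powr (3 / 4)\<rceil>"
    have N34: "N powr (3 / 4) \<ge> 1" using N by (intro ge_one_powr_ge_zero) auto
    have R: "N powr (3 / 4) \<le> R" "R \<le> 2 * N powr (3 / 4)" using N34 unfolding R_def by linarith+
    have R1: "R \<ge> 1" using R N34 by linarith
    have N3: "32 * N ^ 3 < p"
    proof -
      have "N ^ 3 \<le> t ^ 3" using N by (intro power_mono) auto
      also have "\<dots> = real p powr (3 * (2 / 7 + \<epsilon>))" unfolding t_def using p1 by (simp add: powr_power mult.commute)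
      also have "\<dots> \<le> real p powr (9 / 10)" using p1 \<epsilon> by (intro powr_mono) auto
      finally have "33 * N ^ 3 \<le> real p powr (1 / 10) * real p powr (9 / 10)"
        using c3 N by (intro mult_mono) auto
      also have "\<dots> = p" using p1 by (simp add: powr_add[symmetric])
      finally have "33 * N ^ 3 \<le> p" .
      moreover have "N ^ 3 > 0" using N by simp
      ultimately show ?thesis by linarith
    qed
    have N4: "(N powr (3 / 4)) ^ 4 = N ^ 3" using N by (simp add: powr_power)
    have R4: "real_of_int R ^ 4 \<le> 16 * N ^ 3"
    proof -
      have "real_of_int R ^ 4 \<le> (2 * N powr (3 / 4)) ^ 4" using R R1 by (intro power_mono) auto
      thus ?thesis by (simp add: power_mult_distrib N4)
    qed
    have "real_of_int (2 * R ^ 4) < real_of_int (int p)" using R4 N3 by simp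
    hence R4P: "2 * R ^ 4 < int p" by (simp only: of_int_less_iff)
    have mR: "m \<le> R ^ 4"
    proof -
      have "real_of_int m \<le> N" using m_bounds N by linarith
      also have "\<dots> \<le> N ^ 3" using N self_le_power[of N 3] by simp
      also have "\<dots> \<le> real_of_int R ^ 4" unfolding N4[symmetric] using R by (intro power_mono) auto
      finally have "real_of_int m \<le> real_of_int (R ^ 4)" by simp
      thus ?thesis by (simp only: of_int_le_iff)
    qed
    define D where "D = nat \<lfloor>C * (real_of_int R)\<^sup>2 powr (\<epsilon> / 6)\<rfloor>"
    have D: "card {d. d dvd k} \<le> D" if k: "0 < k" "int k \<le> R\<^sup>2" for k :: nat
    proof -
      have "real_of_int (int k) \<le> real_of_int (R\<^sup>2)" using k by (simp only: of_int_le_iff)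
      hence "real k \<le> (real_of_int R)\<^sup>2" by simp
      hence "real k powr (\<epsilon> / 6) \<le> (real_of_int R)\<^sup>2 powr (\<epsilon> / 6)" using \<epsilon> by (intro powr_mono2) auto
      hence "C * real k powr (\<epsilon> / 6) \<le> C * (real_of_int R)\<^sup>2 powr (\<epsilon> / 6)" using C by simp
      hence "real (card {d. d dvd k}) \<le> C * (real_of_int R)\<^sup>2 powr (\<epsilon> / 6)" using C(2)[OF k(1)] by linarith
      thus ?thesis unfolding D_def by (simp add: le_nat_floor)
    qed
    have DK: "real D ^ 3 \<le> K * N powr \<epsilon>"
    proof -
      have "real D \<le> C * (real_of_int R)\<^sup>2 powr (\<epsilon> / 6)" unfolding D_def using C by (intro of_nat_floor) simp
      hence "real D ^ 3 \<le> (C * (real_of_int R)\<^sup>2 powr (\<epsilon> / 6)) ^ 3" by (intro power_mono) auto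
      also have "(real_of_int R)\<^sup>2 = real_of_int R powr 2" using R1 by simp
      also have "(C * (real_of_int R powr 2) powr (\<epsilon> / 6)) ^ 3 = C ^ 3 * ((real_of_int R powr 2) powr (\<epsilon> / 6)) ^ 3"
        by (rule power_mult_distrib)
      also have "((real_of_int R powr 2) powr (\<epsilon> / 6)) ^ 3 = real_of_int R powr \<epsilon>"
        using R1 by (subst powr_powr, subst powr_power) auto
      also have "real_of_int R powr \<epsilon> \<le> (2 * N) powr \<epsilon>"
      proof (rule powr_mono2)
        have "N powr (3 / 4) \<le> N powr 1" using N by (intro powr_mono) auto
        thus "real_of_int R \<le> 2 * N" using R N by simp
      qed (use \<epsilon> R1 in auto)
      also have "\<dots> = 2 powr \<epsilon> * N powr \<epsilon>" using N by (simp add: powr_mult)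
      also have "2 powr \<epsilon> \<le> 2 powr (1::real)" using \<epsilon> by (intro powr_mono) auto
      finally show ?thesis using C by (simp add: K_def mult_left_mono mult_right_mono algebra_simps)
    qed
    define s where "s = sqrt (2 * (4 * m + 1)) * real D ^ 3"
    have s0: "s \<ge> 0" using m1 by (simp add: s_def)
    have sK: "s \<le> 2 * K * N powr (1 / 2 + \<epsilon>)"
    proof -
      have "real_of_int (2 * (4 * m + 1)) \<le> 4 * N" using m_bounds N by simp
      hence "sqrt (2 * (4 * m + 1)) \<le> sqrt (4 * N)" by (rule real_sqrt_le_mono)
      also have "\<dots> = 2 * N powr (1 / 2)" using N by (simp add: real_sqrt_mult powr_half_sqrt)
      finally have "s \<le> (2 * N powr (1 / 2)) * (K * N powr \<epsilon>)"
        unfolding s_def using DK N by (intro mult_mono) auto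
      thus ?thesis by (simp add: powr_add algebra_simps)
    qed
    have small: "s < m"
    proof -
      have "8 * K < N powr (1 / 4)"
      proof -
        have "(8 * K + 1) powr 4 \<le> N" using nK K0 by (simp add: N_def)
        hence "((8 * K + 1) powr 4) powr (1 / 4) \<le> N powr (1 / 4)" by (intro powr_mono2) auto
        moreover have "((8 * K + 1) powr 4) powr (1 / 4) = 8 * K + 1"
          using K0 by (subst powr_powr) simp
        ultimately show ?thesis by linarith
      qed
      also have "\<dots> \<le> N powr (1 / 2 - \<epsilon>)" using N \<epsilon> by (intro powr_mono) auto
      finally have "8 * K * N powr (1 / 2 + \<epsilon>) < N powr (1 / 2 - \<epsilon>) * N powr (1 / 2 + \<epsilon>)"
        using N by (intro mult_strict_right_mono) auto
      also have "\<dots> = N" using N by (simp add: powr_add[symmetric])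
      finally have "2 * K * N powr (1 / 2 + \<epsilon>) < N / 4" by simp
      thus ?thesis using sK m_bounds by linarith
    qed
    have bigp: "32 * C3 * real p \<le> N powr (7 / 2 - \<epsilon> / 2)"
    proof -
      have "512 * C3 * p \<le> real p powr (3 * \<epsilon>) * real p powr 1" using c1 p1 by (intro mult_mono) auto
      also have "\<dots> = real p powr (1 + 3 * \<epsilon>)" by (simp add: powr_add)
      also have "\<dots> \<le> real p powr ((2 / 7 + \<epsilon>) * (7 / 2 - \<epsilon> / 2))"
      proof (rule powr_mono[OF _ p1])
        have "\<epsilon> * \<epsilon> \<le> (1 / 100) * \<epsilon>" using \<epsilon> by (intro mult_right_mono) auto
        thus "1 + 3 * \<epsilon> \<le> (2 / 7 + \<epsilon>) * (7 / 2 - \<epsilon> / 2)" using \<epsilon> by (simp add: field_simps)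
      qed
      also have "\<dots> = t powr (7 / 2 - \<epsilon> / 2)" by (simp add: t_def powr_powr)
      also have "\<dots> \<le> (2 * N) powr (7 / 2 - \<epsilon> / 2)" using N \<epsilon> by (intro powr_mono2) (auto simp: t_def)
      also have "\<dots> = 2 powr (7 / 2 - \<epsilon> / 2) * N powr (7 / 2 - \<epsilon> / 2)" using N by (simp add: powr_mult)
      also have "2 powr (7 / 2 - \<epsilon> / 2) \<le> 2 powr (4::real)" using \<epsilon> by (intro powr_mono) auto
      finally show ?thesis by (simp add: mult_right_mono)
    qed
    interpret geometric_residues "int p" "powi_mod (int p) g" m
      by (rule geometric_residues_powi_mod[OF pp(2) _ g m1]) (use p4 m3 nT in auto)
    have P3: "N ^ 3 \<le> real_of_int (int p)" using N3 N by simp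
    have large: "2 * real p * ((2 * m + 1) * (1 + 24 * 8 ^ 10 * N ^ 4 / real p + 6 * 8 ^ 6 * N ^ 3 / (real_of_int R)\<^sup>2)
        + 512 * N\<^sup>2 * (2 * sqrt (81 * (2 * m + 1))) + 6 * 8 ^ 6 * N ^ 3 / R * (6 * sqrt s)) \<le> (real_of_int m)\<^sup>2 * N ^ 4"
      using energy_term_le[of N m R "real p" s K \<epsilon>] N m_bounds R P3 s0 sK K0 \<epsilon> bigp by (simp add: C3_def)
    have "\<exists>x y :: nat \<Rightarrow> int. (\<forall>i\<in>{1..16}. x i \<in> {u + 1..u + n} \<and> y i \<in> {v + 1..v + 3 * m}) \<and>
      [(\<Sum>i = 1..16. x i * powi_mod (int p) g (y i)) = l] (mod int p)"
      by (rule representation[OF R1 R4P mR _ D]) (use n13 small large in \<open>simp_all add: s_def N_def\<close>)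
    then obtain x y :: "nat \<Rightarrow> int" where xy: "\<forall>i\<in>{1..16}. x i \<in> {u + 1..u + n} \<and> y i \<in> {v + 1..v + 3 * m}"
      "[(\<Sum>i = 1..16. x i * powi_mod (int p) g (y i)) = l] (mod int p)" by blast
    have "\<forall>i\<in>{1..16}. x i \<in> {u + 1..u + n} \<and> y i \<in> {v + 1..v + n}"
      using xy(1) m3(1) by fastforce
    thus "\<exists>x y :: nat \<Rightarrow> int. (\<forall>i\<in>{1..16}. x i \<in> {u + 1..u + n} \<and> y i \<in> {v + 1..v + n}) \<and>
      [(\<Sum>i = 1..16. x i * powi_mod (int p) g (y i)) = l] (mod int p)" using xy(2) by blast
  qed
qed

theorem theorem4:
  fixes \<epsilon> :: real
  assumes "\<epsilon> > 0"
  shows "\<exists>p\<^sub>0 :: nat. \<forall>(p :: nat) (g :: int) (T :: nat) (u :: int) (v :: int) (N :: nat) (M :: nat).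
    p \<ge> p\<^sub>0 \<longrightarrow> prime p \<longrightarrow> gcd g (int p) = 1 \<longrightarrow> T = ord (int p) g \<longrightarrow>
    N \<le> p \<longrightarrow> M \<le> T \<longrightarrow>
    real N > real p powr (2 / 7 + \<epsilon>) \<longrightarrow> real M > real p powr (2 / 7 + \<epsilon>) \<longrightarrow>
    (\<forall>l :: int. \<exists>(x :: nat \<Rightarrow> int) (y :: nat \<Rightarrow> int).
      (\<forall>i \<in> {1..16}. x i \<in> {u + 1..u + int N} \<and> y i \<in> {v + 1..v + int M}) \<and>
      [(\<Sum>i = 1..16. x i * powi_mod (int p) g (y i)) = l] (mod int p))"
proof -
  \<comment> \<open>With the smaller exponent, the first \<open>n\<close> elements of both intervals
    suffice; \<open>n\<close> is also at most the order of \<open>g\<close> because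
    \<open>n \<le> M \<le> T\<close>.\<close>
  define \<eta> where "\<eta> = min \<epsilon> (1 / 100)"
  have \<eta>: "0 < \<eta>" "\<eta> \<le> 1 / 100" using assms by (auto simp: \<eta>_def)
  obtain p0 :: nat where p0: "\<And>(p :: nat) g u v l n. p \<ge> p0 \<Longrightarrow> prime p \<Longrightarrow> coprime g (int p) \<Longrightarrow>
    n = \<lfloor>real p powr (2 / 7 + \<eta>)\<rfloor> \<Longrightarrow> n \<le> int (ord (int p) g) \<Longrightarrow>
    \<exists>x y :: nat \<Rightarrow> int. (\<forall>i\<in>{1..16}. x i \<in> {u + 1..u + n} \<and> y i \<in> {v + 1..v + n}) \<and>
    [(\<Sum>i = 1..16. x i * powi_mod (int p) g (y i)) = l] (mod int p)"
    by (rule representation_large_prime[OF \<eta>]) blast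
  show ?thesis
  proof (intro exI[of _ p0] allI impI)
    fix p :: nat and g :: int and T :: nat and u v :: int and N M :: nat and l :: int
    assume h: "p0 \<le> p" "prime p" "gcd g (int p) = 1" "T = ord (int p) g" "N \<le> p" "M \<le> T"
      "real N > real p powr (2 / 7 + \<epsilon>)" "real M > real p powr (2 / 7 + \<epsilon>)"
    define n where "n = \<lfloor>real p powr (2 / 7 + \<eta>)\<rfloor>"
    have "real p powr (2 / 7 + \<eta>) \<le> real p powr (2 / 7 + \<epsilon>)"
      using prime_ge_1_nat[OF h(2)] by (intro powr_mono) (auto simp: \<eta>_def)
    hence n: "n \<le> int N" "n \<le> int M" using h(7,8) unfolding n_def by linarith+
    hence "n \<le> int (ord (int p) g)" using h(4,6) by simp
    moreover have "coprime g (int p)" using h(3) by (simp add: coprime_iff_gcd_eq_1)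
    ultimately obtain x y :: "nat \<Rightarrow> int" where
      xy: "\<forall>i\<in>{1..16}. x i \<in> {u + 1..u + n} \<and> y i \<in> {v + 1..v + n}"
      "[(\<Sum>i = 1..16. x i * powi_mod (int p) g (y i)) = l] (mod int p)"
      using p0[OF h(1,2) _ n_def, of g u v l] by blast
    have "\<forall>i\<in>{1..16}. x i \<in> {u + 1..u + int N} \<and> y i \<in> {v + 1..v + int M}" using xy(1) n by fastforce
    thus "\<exists>x y :: nat \<Rightarrow> int. (\<forall>i \<in> {1..16}. x i \<in> {u + 1..u + int N} \<and> y i \<in> {v + 1..v + int M}) \<and>
      [(\<Sum>i = 1..16. x i * powi_mod (int p) g (y i)) = l] (mod int p)" using xy(2) by blast
  qed
qed

end
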